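(* Assume $1 \leq p < \infty$ and $\psi \in L^p(\mathbb{R}^d)$ with $P|\psi| \in L^p_{loc}(\mathbb{R}^d)$ and $\int_{\mathbb{R}^d} \psi \, dx = 1$. Let $\frac1p+\frac1q=1$. Then $S : \ell^1(\ell^p) \to L^p(\mathbb{R}^d)$ is open, and surjective. Indeed, if $f \in L^p$ and $\varepsilon>0$ then a sequence $c \in \ell^1(\ell^p)$ exists such that $Sc=f$, where the series $Sc=\sum_{j>0}\sum_{k\in\mathbb{Z}^d} c_{j,k}\psi_{j,k}$ converges in the sense that the sum over $k$ converges pointwise absolutely a.e. to a function in $L^p$ and the sum over $j$ converges absolutely in $L^p$, and such that $$\| c \|_{\ell^1(\ell^p)} \leq |\det b|^{1/q} \| f \|_p + \varepsilon.$$
   Context: Fix $d \in \mathbb{N}$. The dilation matrices $a_j$ ($j=1,2,3,\ldots$) are invertible $d \times d$ real matrices that are expanding: $\|a_j^{-1}\| \to 0$ as $j \to \infty$ (operator norm on $\mathbb{R}^d$). The translation matrix $b$ is an invertible $d \times d$ real matrix. $L^p=L^p(\mathbb{R}^d)$ consists of complex-valued functions. Sums over $j>0$ are over $j=1,2,3,\ldots$; $1/\infty=0$. For $\psi \in L^p$ put $\psi_{j,k}(x) = |\det a_j|^{1/p}\psi(a_j x - bk)$, $x \in \mathbb{R}^d$, $k \in \mathbb{Z}^d$. The synthesis operator is $Sc=\sum_{j>0}\sum_{k\in\mathbb{Z}^d}c_{j,k}\psi_{j,k}$. For sequences $c=\{c_{j,k}\}_{j>0,k\in\mathbb{Z}^d}$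 of complex numbers, $\|c\|_{\ell^1(\ell^p)} = \sum_{j>0} \big(\sum_{k\in\mathbb{Z}^d}|c_{j,k}|^p\big)^{1/p}$, and $\ell^1(\ell^p)$ is the Banach space of sequences with finite norm. The periodization of a function $f$ is $Pf(x) = |\det b|\sum_{k\in\mathbb{Z}^d} f(x-bk)$. (The condition $P|\psi|\in L^p_{loc}$ implies $\psi \in L^1$, so $\int\psi\,dx$ is well defined.) *)

theory Defs
  imports "HOL-Analysis.Analysis"
begin

section \<open>The spaces \<open>L\<^sup>p\<close>, for real exponents\<close>

text \<open>\<open>Lp_fun M p\<close> consists of functions; \<open>Lp_space M p\<close> consists of
  classes of almost everywhere equal functions.\<close>

definition Lp_fun :: "'a measure \<Rightarrow> real \<Rightarrow> ('a \<Rightarrow> complex) set" where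
  "Lp_fun M p = {f \<in> borel_measurable M. integrable M (\<lambda>x. norm (f x) powr p)}"

definition Lp_norm :: "'a measure \<Rightarrow> real \<Rightarrow> ('a \<Rightarrow> complex) \<Rightarrow> real" where
  "Lp_norm M p f = (\<integral>x. norm (f x) powr p \<partial>M) powr (1 / p)"

definition Lp_eq :: "'a measure \<Rightarrow> real \<Rightarrow> ('a \<Rightarrow> complex) rel" where
  "Lp_eq M p = {(f, g). f \<in> Lp_fun M p \<and> g \<in> Lp_fun M p \<and> (AE x in M. f x = g x)}"

definition Lp_space :: "'a measure \<Rightarrow> real \<Rightarrow> ('a \<Rightarrow> complex) set set" where
  "Lp_space M p = Lp_fun M p // Lp_eq M p"

text \<open>The choice of representatives is immaterial, see \<open>Lp_dist_class\<close> below.\<close>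

definition Lp_dist ::
    "'a measure \<Rightarrow> real \<Rightarrow> ('a \<Rightarrow> complex) set \<Rightarrow> ('a \<Rightarrow> complex) set \<Rightarrow> real" where
  "Lp_dist M p F G = Lp_norm M p (\<lambda>x. (SOME f. f \<in> F) x - (SOME g. g \<in> G) x)"

definition Lp_topology :: "'a measure \<Rightarrow> real \<Rightarrow> ('a \<Rightarrow> complex) set topology" where
  "Lp_topology M p = Metric_space.mtopology (Lp_space M p) (Lp_dist M p)"

definition Lp_loc :: "real \<Rightarrow> (real^'n \<Rightarrow> real) set" where
  "Lp_loc p = {g \<in> borel_measurable lebesgue.
     \<forall>K. compact K \<longrightarrow> set_integrable lebesgue K (\<lambda>x. \<bar>g x\<bar> powr p)}"

section \<open>The mixed-norm sequence space \<open>\<ell>\<^sup>1(\<ell>\<^sup>p)\<close>\<close>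

text \<open>Sequences are indexed by \<open>j > 0\<close> and \<open>k \<in> \<int>\<^sup>d\<close>. Since the type of the index \<open>j\<close> also
  contains \<open>0\<close>, the non-existent entries at \<open>j = 0\<close> are fixed to be zero.\<close>

definition lp_norm :: "real \<Rightarrow> ('k \<Rightarrow> complex) \<Rightarrow> real" where
  "lp_norm p u = (\<Sum>\<^sub>\<infinity>k. norm (u k) powr p) powr (1 / p)"

definition l1lp :: "real \<Rightarrow> (nat \<Rightarrow> 'k \<Rightarrow> complex) set" where
  "l1lp p = {c. c 0 = (\<lambda>k. 0) \<and>
     (\<forall>j>0. (\<lambda>k. norm (c j k) powr p) summable_on UNIV) \<and>
     (\<lambda>j. lp_norm p (c j)) summable_on {0<..}}"

definition l1lp_norm :: "real \<Rightarrow> (nat \<Rightarrow> 'k \<Rightarrow> complex) \<Rightarrow> real" where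
  "l1lp_norm p c = (\<Sum>\<^sub>\<infinity>j\<in>{0<..}. lp_norm p (c j))"

definition l1lp_dist ::
    "real \<Rightarrow> (nat \<Rightarrow> 'k \<Rightarrow> complex) \<Rightarrow> (nat \<Rightarrow> 'k \<Rightarrow> complex) \<Rightarrow> real" where
  "l1lp_dist p c e = l1lp_norm p (\<lambda>j k. c j k - e j k)"

definition l1lp_topology :: "real \<Rightarrow> (nat \<Rightarrow> 'k \<Rightarrow> complex) topology" where
  "l1lp_topology p = Metric_space.mtopology (l1lp p) (l1lp_dist p)"

section \<open>Periodization and synthesis\<close>

definition lattice_point :: "real^'n^'n \<Rightarrow> int^'n \<Rightarrow> real^'n" where
  "lattice_point b k = b *v (\<chi> i. real_of_int (k $ i))"

text \<open>The sum takes the value \<open>0\<close> at points where it does not converge absolutely, so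
  almost everywhere convergence has to be required separately.\<close>

definition periodization :: "real^'n^'n \<Rightarrow> (real^'n \<Rightarrow> real) \<Rightarrow> real^'n \<Rightarrow> real" where
  "periodization b f x = \<bar>det b\<bar> * (\<Sum>\<^sub>\<infinity>k. f (x - lattice_point b k))"

definition periodization_in_Lp_loc :: "real \<Rightarrow> real^'n^'n \<Rightarrow> (real^'n \<Rightarrow> real) \<Rightarrow> bool" where
  "periodization_in_Lp_loc p b f \<longleftrightarrow>
     (AE x in lebesgue. (\<lambda>k. f (x - lattice_point b k)) summable_on UNIV) \<and>
     periodization b f \<in> Lp_loc p"

definition wavelet :: "real \<Rightarrow> (nat \<Rightarrow> real^'n^'n) \<Rightarrow> real^'n^'n \<Rightarrow> (real^'n \<Rightarrow> complex) \<Rightarrow>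
    nat \<Rightarrow> int^'n \<Rightarrow> real^'n \<Rightarrow> complex" where
  "wavelet p a b \<psi> j k x =
     of_real (\<bar>det (a j)\<bar> powr (1 / p)) * \<psi> (a j *v x - lattice_point b k)"

definition synthesis_level :: "real \<Rightarrow> (nat \<Rightarrow> real^'n^'n) \<Rightarrow> real^'n^'n \<Rightarrow> (real^'n \<Rightarrow> complex) \<Rightarrow>
    (nat \<Rightarrow> int^'n \<Rightarrow> complex) \<Rightarrow> nat \<Rightarrow> real^'n \<Rightarrow> complex" where
  "synthesis_level p a b \<psi> c j x = (\<Sum>\<^sub>\<infinity>k. c j k * wavelet p a b \<psi> j k x)"

text \<open>\<open>synthesis_sums p a b \<psi> c f\<close>: the series \<open>\<Sum>\<^sub>j \<Sum>\<^sub>k c\<^sub>j\<^sub>k \<psi>\<^sub>j\<^sub>k\<close> converges to \<open>f\<close>, where the sum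
  over \<open>k\<close> converges pointwise absolutely almost everywhere to a function in \<open>L\<^sup>p\<close>, and the
  sum over \<open>j\<close> converges absolutely in \<open>L\<^sup>p\<close>.\<close>

definition synthesis_sums :: "real \<Rightarrow> (nat \<Rightarrow> real^'n^'n) \<Rightarrow> real^'n^'n \<Rightarrow> (real^'n \<Rightarrow> complex) \<Rightarrow>
    (nat \<Rightarrow> int^'n \<Rightarrow> complex) \<Rightarrow> (real^'n \<Rightarrow> complex) \<Rightarrow> bool" where
  "synthesis_sums p a b \<psi> c f \<longleftrightarrow>
     (\<forall>j>0. AE x in lebesgue. (\<lambda>k. norm (c j k * wavelet p a b \<psi> j k x)) summable_on UNIV) \<and>
     (\<forall>j>0. synthesis_level p a b \<psi> c j \<in> Lp_fun lebesgue p) \<and>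
     (\<lambda>j. Lp_norm lebesgue p (synthesis_level p a b \<psi> c j)) summable_on {0<..} \<and>
     f \<in> Lp_fun lebesgue p \<and>
     (\<lambda>n. Lp_norm lebesgue p (\<lambda>x. f x - (\<Sum>j=1..n. synthesis_level p a b \<psi> c j x)))
       \<longlonglongrightarrow> 0"

text \<open>The synthesis operator. If the series for \<open>c\<close> converges, then its value is the full class
  of limit functions, an element of \<open>Lp_space\<close>; otherwise it is the empty set, which is not
  an element of \<open>Lp_space\<close>.\<close>

definition synthesis :: "real \<Rightarrow> (nat \<Rightarrow> real^'n^'n) \<Rightarrow> real^'n^'n \<Rightarrow> (real^'n \<Rightarrow> complex) \<Rightarrow>
    (nat \<Rightarrow> int^'n \<Rightarrow> complex) \<Rightarrow> (real^'n \<Rightarrow> complex) set" where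
  "synthesis p a b \<psi> c = {f. synthesis_sums p a b \<psi> c f}"

section \<open>The distances are metrics\<close>

lemma powr_sum_le:
  fixes x y s t p :: real
  assumes "1 \<le> p" "0 < s" "0 < t" "0 \<le> x" "0 \<le> y"
  shows "(x + y) powr p \<le> (s + t) powr p * (s / (s + t) * (x powr p / s powr p)
           + t / (s + t) * (y powr p / t powr p))"
proof -
  have pos: "(\<alpha> * u + (1 - \<alpha>) * v) powr p \<le> \<alpha> * u powr p + (1 - \<alpha>) * v powr p"
    if "0 < \<alpha>" "\<alpha> < 1" "0 \<le> u" "0 \<le> v" for \<alpha> u v :: real
  proof -
    have shrink: "(\<beta> * w) powr p \<le> \<beta> * w powr p" if "0 < \<beta>" "\<beta> < 1" "0 \<le> w" for \<beta> w :: real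
    proof -
      have "\<beta> powr p \<le> \<beta> powr 1"
        using that assms(1) by (intro powr_mono') auto
      then show ?thesis
        using that by (simp add: powr_mult mult_right_mono)
    qed
    consider "u = 0" | "v = 0" | "u > 0" "v > 0" using \<open>0 \<le> u\<close> \<open>0 \<le> v\<close> by linarith
    then show ?thesis
    proof cases
      case 3
      then show ?thesis
        using convex_onD[OF powr_convex[OF assms(1)], of "1 - \<alpha>" u v] that by simp
    qed (use shrink[of "1 - \<alpha>" v] shrink[of \<alpha> u] that in auto)
  qed
  have st: "0 < s + t" using assms by simp
  have eq: "1 - s / (s + t) = t / (s + t)" using st by (simp add: field_simps)
  have "(x + y) powr p = ((s + t) * (s / (s + t) * (x / s) + t / (s + t) * (y / t))) powr p"
    using assms st by (simp add: distrib_left)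
  also have "\<dots> = (s + t) powr p * (s / (s + t) * (x / s) + t / (s + t) * (y / t)) powr p"
    using assms st by (simp add: powr_mult)
  also have "\<dots> \<le> (s + t) powr p * (s / (s + t) * (x / s) powr p + t / (s + t) * (y / t) powr p)"
    using pos[of "s / (s + t)" "x / s" "y / t"] assms st
    by (intro mult_left_mono) (auto simp: eq)
  finally show ?thesis
    using assms by (simp add: powr_divide)
qed

lemma powr_le_imp:
  fixes A r p :: real
  assumes "1 \<le> p" "0 \<le> r" "0 \<le> A" "A \<le> r powr p"
  shows "A powr (1 / p) \<le> r"
proof -
  have "A powr (1 / p) \<le> (r powr p) powr (1 / p)"
    using assms by (intro powr_mono2) auto
  then show ?thesis using assms by (simp add: powr_powr)
qed

lemma less_imp_powr_less:
  fixes A s p :: real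
  assumes "1 \<le> p" "0 \<le> A" "A powr (1 / p) < s"
  shows "A < s powr p"
proof -
  have "(A powr (1 / p)) powr p < s powr p"
    using assms by (intro powr_less_mono2) auto
  then show ?thesis using assms by (simp add: powr_powr)
qed

lemma powr_sum_bound:
  fixes A B s t p :: real
  assumes "1 \<le> p" "0 \<le> A" "0 \<le> B" "A powr (1 / p) < s" "B powr (1 / p) < t"
  shows "(s + t) powr p * (s / (s + t) * (A / s powr p) + t / (s + t) * (B / t powr p))
           \<le> (s + t) powr p"
proof -
  have "0 \<le> A powr (1 / p)" "0 \<le> B powr (1 / p)" by simp_all
  then have pos: "0 < s" "0 < t" using assms by linarith+
  have "A / s powr p \<le> 1" "B / t powr p \<le> 1"
    using less_imp_powr_less[of p A s] less_imp_powr_less[of p B t] assms pos by auto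
  then have "s / (s + t) * (A / s powr p) \<le> s / (s + t)" "t / (s + t) * (B / t powr p) \<le> t / (s + t)"
    using mult_left_mono[of "A / s powr p" 1 "s / (s + t)"]
      mult_left_mono[of "B / t powr p" 1 "t / (s + t)"] pos by (auto simp del: times_divide_times_eq)
  moreover have "s / (s + t) + t / (s + t) = 1"
    using pos by (simp flip: add_divide_distrib)
  ultimately have "s / (s + t) * (A / s powr p) + t / (s + t) * (B / t powr p) \<le> 1" by linarith
  then show ?thesis using mult_left_mono[of _ 1 "(s + t) powr p"] by simp
qed

lemma le_add_if_less:
  fixes x A B :: real
  assumes "\<And>s t. A < s \<Longrightarrow> B < t \<Longrightarrow> x \<le> s + t"
  shows "x \<le> A + B"
proof (rule field_le_epsilon)
  fix e :: real assume "0 < e"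
  then show "x \<le> A + B + e" using assms[of "A + e / 2" "B + e / 2"] by simp
qed

lemma Lp_norm_nonneg: "0 \<le> Lp_norm M p f"
  by (simp add: Lp_norm_def)

lemma Lp_norm_minus_commute: "Lp_norm M p (\<lambda>x. f x - g x) = Lp_norm M p (\<lambda>x. g x - f x)"
  by (simp add: Lp_norm_def norm_minus_commute)

lemma Lp_norm_cong_AE:
  assumes "f \<in> borel_measurable M" "g \<in> borel_measurable M" "AE x in M. f x = g x"
  shows "Lp_norm M p f = Lp_norm M p g"
proof -
  have "(\<integral>x. norm (f x) powr p \<partial>M) = (\<integral>x. norm (g x) powr p \<partial>M)"
    using assms by (intro integral_cong_AE) auto
  then show ?thesis by (simp add: Lp_norm_def)
qed

lemma Lp_norm_eq_0_iff:
  assumes "f \<in> Lp_fun M p"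
  shows "Lp_norm M p f = 0 \<longleftrightarrow> (AE x in M. f x = 0)"
  using assms integral_nonneg_eq_0_iff_AE[of M "\<lambda>x. norm (f x) powr p"]
  by (simp add: Lp_norm_def Lp_fun_def)

lemma Lp_fun_add:
  assumes "1 \<le> p" "f \<in> Lp_fun M p" "g \<in> Lp_fun M p"
  shows "(\<lambda>x. f x + g x) \<in> Lp_fun M p"
proof -
  have meas [measurable]: "f \<in> borel_measurable M" "g \<in> borel_measurable M"
    and int: "integrable M (\<lambda>x. norm (f x) powr p)" "integrable M (\<lambda>x. norm (g x) powr p)"
    using assms by (auto simp: Lp_fun_def)
  have "integrable M (\<lambda>x. norm (f x + g x) powr p)"
  proof (rule Bochner_Integration.integrable_bound)
    show "integrable M (\<lambda>x. 2 powr p * (1 / 2 * (norm (f x) powr p / 1 powr p)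
        + 1 / 2 * (norm (g x) powr p / 1 powr p)))"
      using int by simp
    show "AE x in M. norm (norm (f x + g x) powr p) \<le> norm (2 powr p *
        (1 / 2 * (norm (f x) powr p / 1 powr p) + 1 / 2 * (norm (g x) powr p / 1 powr p)))"
    proof (rule AE_I2)
      fix x
      have "norm (f x + g x) powr p \<le> (norm (f x) + norm (g x)) powr p"
        using assms by (intro powr_mono2) (auto simp: norm_triangle_ineq)
      also have "\<dots> \<le> 2 powr p * (1 / 2 * (norm (f x) powr p / 1 powr p)
          + 1 / 2 * (norm (g x) powr p / 1 powr p))"
        using powr_sum_le[of p 1 1 "norm (f x)" "norm (g x)"] assms by simp
      finally show "norm (norm (f x + g x) powr p) \<le> norm (2 powr p *
          (1 / 2 * (norm (f x) powr p / 1 powr p) + 1 / 2 * (norm (g x) powr p / 1 powr p)))"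
        by simp
    qed
  qed measurable
  then show ?thesis by (simp add: Lp_fun_def)
qed

lemma Lp_fun_uminus: "f \<in> Lp_fun M p \<Longrightarrow> (\<lambda>x. - f x) \<in> Lp_fun M p"
  by (auto simp: Lp_fun_def)

lemma Lp_fun_diff:
  assumes "1 \<le> p" "f \<in> Lp_fun M p" "g \<in> Lp_fun M p"
  shows "(\<lambda>x. f x - g x) \<in> Lp_fun M p"
  using Lp_fun_add[OF assms(1,2) Lp_fun_uminus[OF assms(3)]] by simp

lemma Lp_norm_triangle:
  assumes "1 \<le> p" "f \<in> Lp_fun M p" "g \<in> Lp_fun M p"
  shows "Lp_norm M p (\<lambda>x. f x + g x) \<le> Lp_norm M p f + Lp_norm M p g"
proof (rule le_add_if_less)
  fix s t assume st: "Lp_norm M p f < s" "Lp_norm M p g < t"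
  then have pos: "0 < s" "0 < t"
    using Lp_norm_nonneg[of M p f] Lp_norm_nonneg[of M p g] by linarith+
  have int: "integrable M (\<lambda>x. norm (f x) powr p)" "integrable M (\<lambda>x. norm (g x) powr p)"
    using assms by (auto simp: Lp_fun_def)
  have "(\<integral>x. norm (f x + g x) powr p \<partial>M) \<le>
      (\<integral>x. (s + t) powr p * (s / (s + t) * (norm (f x) powr p / s powr p)
        + t / (s + t) * (norm (g x) powr p / t powr p)) \<partial>M)"
  proof (rule integral_mono)
    show "integrable M (\<lambda>x. norm (f x + g x) powr p)"
      using Lp_fun_add[OF assms] by (simp add: Lp_fun_def)
    show "integrable M (\<lambda>x. (s + t) powr p * (s / (s + t) * (norm (f x) powr p / s powr p)
        + t / (s + t) * (norm (g x) powr p / t powr p)))"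
      using int by simp
    fix x
    have "norm (f x + g x) powr p \<le> (norm (f x) + norm (g x)) powr p"
      using assms by (intro powr_mono2) (auto simp: norm_triangle_ineq)
    also have "\<dots> \<le> (s + t) powr p * (s / (s + t) * (norm (f x) powr p / s powr p)
        + t / (s + t) * (norm (g x) powr p / t powr p))"
      using assms pos by (intro powr_sum_le) auto
    finally show "norm (f x + g x) powr p \<le> \<dots>" .
  qed
  also have "\<dots> = (s + t) powr p * (s / (s + t) * ((\<integral>x. norm (f x) powr p \<partial>M) / s powr p)
        + t / (s + t) * ((\<integral>x. norm (g x) powr p \<partial>M) / t powr p))"
    using int by simp
  also have "\<dots> \<le> (s + t) powr p"
    using st assms by (intro powr_sum_bound) (auto simp: Lp_norm_def)
  finally show "Lp_norm M p (\<lambda>x. f x + g x) \<le> s + t"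
    unfolding Lp_norm_def using assms pos by (intro powr_le_imp) auto
qed

lemma equiv_Lp_eq: "equiv (Lp_fun M p) (Lp_eq M p)"
proof (rule equivI)
  show "Lp_eq M p \<subseteq> Lp_fun M p \<times> Lp_fun M p" by (auto simp: Lp_eq_def)
  show "refl_on (Lp_fun M p) (Lp_eq M p)" by (auto simp: Lp_eq_def refl_on_def)
  show "sym (Lp_eq M p)" by (auto simp: Lp_eq_def sym_def eq_commute)
  show "trans (Lp_eq M p)"
  proof (rule transI)
    fix f g h assume fgh: "(f, g) \<in> Lp_eq M p" "(g, h) \<in> Lp_eq M p"
    then have "AE x in M. f x = g x" "AE x in M. g x = h x" by (auto simp: Lp_eq_def)
    then have "AE x in M. f x = h x" by eventually_elim simp
    then show "(f, h) \<in> Lp_eq M p" using fgh by (simp add: Lp_eq_def)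
  qed
qed

lemma Lp_space_some:
  assumes "F \<in> Lp_space M p"
  shows "(SOME f. f \<in> F) \<in> F" "F \<subseteq> Lp_fun M p"
    "\<And>f. f \<in> F \<Longrightarrow> F = Lp_eq M p `` {f}"
proof -
  show "(SOME f. f \<in> F) \<in> F"
    using assms in_quotient_imp_non_empty[OF equiv_Lp_eq, of F M p]
    by (auto simp: Lp_space_def some_in_eq)
  show "F \<subseteq> Lp_fun M p"
    using assms in_quotient_imp_subset[OF equiv_Lp_eq, of F M p] by (auto simp: Lp_space_def)
  show "F = Lp_eq M p `` {f}" if "f \<in> F" for f
  proof -
    obtain g where g: "F = Lp_eq M p `` {g}"
      using assms unfolding Lp_space_def by (rule quotientE)
    then show ?thesis using that equiv_class_eq[OF equiv_Lp_eq, of g f M p] by simp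
  qed
qed

lemma Lp_space_AE:
  assumes "F \<in> Lp_space M p" "f \<in> F" "g \<in> F"
  shows "AE x in M. f x = g x"
  using Lp_space_some(3)[OF assms(1,2)] assms(3) by (auto simp: Lp_eq_def)

lemma Lp_dist_class:
  assumes "F \<in> Lp_space M p" "G \<in> Lp_space M p" "f \<in> F" "g \<in> G"
  shows "Lp_dist M p F G = Lp_norm M p (\<lambda>x. f x - g x)"
  unfolding Lp_dist_def
proof (rule Lp_norm_cong_AE)
  let ?f = "SOME f. f \<in> F" and ?g = "SOME g. g \<in> G"
  have mem: "?f \<in> F" "?g \<in> G" using assms Lp_space_some(1) by auto
  have "?f \<in> Lp_fun M p" "?g \<in> Lp_fun M p" "f \<in> Lp_fun M p" "g \<in> Lp_fun M p"
    using mem assms Lp_space_some(2) by blast+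
  then show "(\<lambda>x. ?f x - ?g x) \<in> borel_measurable M" "(\<lambda>x. f x - g x) \<in> borel_measurable M"
    by (auto simp: Lp_fun_def)
  show "AE x in M. ?f x - ?g x = f x - g x"
    using Lp_space_AE[OF assms(1) mem(1) assms(3)] Lp_space_AE[OF assms(2) mem(2) assms(4)]
    by eventually_elim simp
qed

lemma Metric_space_Lp:
  assumes "1 \<le> p"
  shows "Metric_space (Lp_space M p) (Lp_dist M p)"
proof
  fix F G :: "('a \<Rightarrow> complex) set"
  show "0 \<le> Lp_dist M p F G" by (simp add: Lp_dist_def Lp_norm_nonneg)
  show "Lp_dist M p F G = Lp_dist M p G F" 
    unfolding Lp_dist_def by (rule Lp_norm_minus_commute)
next
  fix F G assume FG: "F \<in> Lp_space M p" "G \<in> Lp_space M p"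
  let ?f = "SOME f. f \<in> F" and ?g = "SOME g. g \<in> G"
  have mem: "?f \<in> F" "?g \<in> G" using FG Lp_space_some(1) by auto
  have Lp: "?f \<in> Lp_fun M p" "?g \<in> Lp_fun M p"
    using mem FG Lp_space_some(2) by blast+
  have "Lp_dist M p F G = 0 \<longleftrightarrow> (AE x in M. ?f x = ?g x)"
    unfolding Lp_dist_def using Lp_norm_eq_0_iff[OF Lp_fun_diff[OF assms Lp]] by simp
  also have "\<dots> \<longleftrightarrow> (?f, ?g) \<in> Lp_eq M p" using Lp by (simp add: Lp_eq_def)
  also have "\<dots> \<longleftrightarrow> F = G"
    using quotient_eq_iff[OF equiv_Lp_eq, of F M p G ?f ?g] FG mem by (simp add: Lp_space_def)
  finally show "Lp_dist M p F G = 0 \<longleftrightarrow> F = G" .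
next
  fix F G H assume "F \<in> Lp_space M p" "G \<in> Lp_space M p" "H \<in> Lp_space M p"
  then have mem: "(SOME f. f \<in> F) \<in> Lp_fun M p" "(SOME f. f \<in> G) \<in> Lp_fun M p"
      "(SOME f. f \<in> H) \<in> Lp_fun M p"
    using Lp_space_some(1,2) by blast+
  show "Lp_dist M p F H \<le> Lp_dist M p F G + Lp_dist M p G H"
    using Lp_norm_triangle[OF assms Lp_fun_diff[OF assms mem(1,2)] Lp_fun_diff[OF assms mem(2,3)]]
    by (simp add: Lp_dist_def)
qed

lemma lp_summable_iff:
  "(\<lambda>k. norm (u k) powr p) summable_on UNIV \<longleftrightarrow> u \<in> Lp_fun (count_space UNIV) p"
  using abs_summable_equivalent[of "\<lambda>k. norm (u k) powr p" UNIV]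
  by (simp add: Lp_fun_def Infinite_Set_Sum.abs_summable_on_def)

lemma lp_norm_eq:
  assumes "u \<in> Lp_fun (count_space UNIV) p"
  shows "lp_norm p u = Lp_norm (count_space UNIV) p u"
  using infsetsum_infsum[of "\<lambda>k. norm (u k) powr p" UNIV] assms
  by (simp add: lp_norm_def Lp_norm_def Lp_fun_def Infinite_Set_Sum.abs_summable_on_def
      infsetsum_def)

lemma l1lp_D:
  assumes "c \<in> l1lp p"
  shows "c 0 k = 0" "0 < j \<Longrightarrow> c j \<in> Lp_fun (count_space UNIV) p"
    "(\<lambda>j. lp_norm p (c j)) summable_on {0<..}"
  using assms by (auto simp: l1lp_def lp_summable_iff)

lemma lp_norm_nonneg: "0 \<le> lp_norm p u"
  by (simp add: lp_norm_def)

lemma l1lp_add: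
  assumes "1 \<le> p" "c \<in> l1lp p" "e \<in> l1lp p"
  shows "(\<lambda>j k. c j k + e j k) \<in> l1lp p"
    and "l1lp_norm p (\<lambda>j k. c j k + e j k) \<le> l1lp_norm p c + l1lp_norm p e"
proof -
  have add: "(\<lambda>k. c j k + e j k) \<in> Lp_fun (count_space UNIV) p"
    and le: "lp_norm p (\<lambda>k. c j k + e j k) \<le> lp_norm p (c j) + lp_norm p (e j)" if "0 < j" for j
    using Lp_fun_add[OF assms(1) l1lp_D(2)[OF assms(2)] l1lp_D(2)[OF assms(3)]]
      Lp_norm_triangle[OF assms(1) l1lp_D(2)[OF assms(2)] l1lp_D(2)[OF assms(3)]] that
    by (auto simp: lp_norm_eq l1lp_D(2)[OF assms(2)] l1lp_D(2)[OF assms(3)])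
  have sum: "(\<lambda>j. lp_norm p (c j) + lp_norm p (e j)) summable_on {0<..}"
    by (intro summable_on_add l1lp_D(3) assms)
  have sum': "(\<lambda>j. lp_norm p (\<lambda>k. c j k + e j k)) summable_on {0<..}"
    by (rule summable_on_comparison_test[OF sum]) (auto simp: le lp_norm_nonneg)
  then show "(\<lambda>j k. c j k + e j k) \<in> l1lp p"
    using add l1lp_D(1)[OF assms(2)] l1lp_D(1)[OF assms(3)] by (auto simp: l1lp_def lp_summable_iff)
  have "l1lp_norm p (\<lambda>j k. c j k + e j k) \<le> (\<Sum>\<^sub>\<infinity>j\<in>{0<..}. lp_norm p (c j) + lp_norm p (e j))"
    unfolding l1lp_norm_def by (intro infsum_mono sum sum') (auto simp: le)
  also have "\<dots> = l1lp_norm p c + l1lp_norm p e"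
    unfolding l1lp_norm_def by (intro infsum_add l1lp_D(3) assms)
  finally show "l1lp_norm p (\<lambda>j k. c j k + e j k) \<le> l1lp_norm p c + l1lp_norm p e" .
qed

lemma l1lp_diff:
  assumes "1 \<le> p" "c \<in> l1lp p" "e \<in> l1lp p"
  shows "(\<lambda>j k. c j k - e j k) \<in> l1lp p"
proof -
  have "(\<lambda>j k. - e j k) \<in> l1lp p"
    using assms(3) by (simp add: l1lp_def lp_norm_def fun_eq_iff)
  then show ?thesis using l1lp_add(1)[OF assms(1,2), of "\<lambda>j k. - e j k"] by simp
qed

lemma l1lp_norm_eq_0_iff:
  assumes "1 \<le> p" "c \<in> l1lp p"
  shows "l1lp_norm p c = 0 \<longleftrightarrow> c = (\<lambda>j k. 0)"
proof
  assume "l1lp_norm p c = 0"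
  then have "lp_norm p (c j) = 0" if "0 < j" for j
    using nonneg_infsum_le_0D[OF _ l1lp_D(3)[OF assms(2)], of j] that
    by (simp add: l1lp_norm_def lp_norm_nonneg)
  then have "c j k = 0" if "0 < j" for j k
    using Lp_norm_eq_0_iff[OF l1lp_D(2)[OF assms(2) that]] that
    by (simp add: lp_norm_eq[OF l1lp_D(2)[OF assms(2)]] AE_count_space)
  then show "c = (\<lambda>j k. 0)"
    using l1lp_D(1)[OF assms(2)] by (metis ext not_gr_zero)
qed (simp add: l1lp_norm_def lp_norm_def)

lemma Metric_space_l1lp:
  assumes "1 \<le> p"
  shows "Metric_space (l1lp p) (l1lp_dist p)"
proof
  fix c e :: "nat \<Rightarrow> 'a \<Rightarrow> complex"
  show "0 \<le> l1lp_dist p c e"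
    by (simp add: l1lp_dist_def l1lp_norm_def infsum_nonneg lp_norm_nonneg)
  show "l1lp_dist p c e = l1lp_dist p e c"
    by (simp add: l1lp_dist_def l1lp_norm_def lp_norm_def norm_minus_commute)
next
  fix c e :: "nat \<Rightarrow> 'a \<Rightarrow> complex" assume "c \<in> l1lp p" "e \<in> l1lp p"
  then show "l1lp_dist p c e = 0 \<longleftrightarrow> c = e"
    using l1lp_norm_eq_0_iff[OF assms l1lp_diff[OF assms]] by (simp add: l1lp_dist_def fun_eq_iff)
next
  fix c e g :: "nat \<Rightarrow> 'a \<Rightarrow> complex" assume "c \<in> l1lp p" "e \<in> l1lp p" "g \<in> l1lp p"
  then show "l1lp_dist p c g \<le> l1lp_dist p c e + l1lp_dist p e g"
    using l1lp_add(2)[OF assms l1lp_diff[OF assms] l1lp_diff[OF assms], of c e e g]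
    by (simp add: l1lp_dist_def)
qed

end

theory Submission
  imports Defs
begin

text \<open>Replacing \<open>\<psi>\<close> by \<open>\<psi> \<circ> b\<close> and \<open>a\<^sub>j\<close> by \<open>A\<^sub>j = b\<^sup>-\<^sup>1 a\<^sub>j\<close> turns the lattice into \<open>\<int>\<^sup>d\<close>. Jensen's inequality bounds
  \<open>S\<close> on each level by a constant multiple of the \<open>\<ell>\<^sup>p\<close> norm. Given \<open>f\<close>, take as coefficients on level
  \<open>j\<close> the normalised averages of \<open>f\<close> over the cells \<open>A\<^sub>j\<^sup>-\<^sup>1(k + [0,1)\<^sup>d)\<close>; their \<open>\<ell>\<^sup>p\<close> norm is at most
  \<open>|det b|\<^bsup>1/q\<^esup> \<parallel>f\<parallel>\<^sub>p\<close>. For large \<open>j\<close> they synthesise approximately \<open>f(x) P\<psi>(a\<^sub>j x)\<close>, where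
  \<open>P\<psi>\<close> is periodic with mean \<open>1\<close>. So the error \<open>f(x) (P\<psi>(a\<^sub>j x) - 1)\<close> tends to zero weakly, though in
  general not in norm.
  Averaging over finitely many, sufficiently sparse levels makes it small in norm without enlarging
  the norm of the coefficients. Iterating on the residuals, with pairwise disjoint sets of levels,
  represents \<open>f\<close> exactly; openness follows by linearity.\<close>

section \<open>Linear changes of variables\<close>

text \<open>Weak convergence has to become norm smallness for every \<open>p\<close>, including
  \<open>p = 1\<close>, while orthogonality lives in L2 only. Therefore \<open>f\<close> is replaced
  by a continuous function of compact support and \<open>\<psi>\<close> by a truncation
  \<open>\<eta>\<close> with bounded lattice sums; the oscillating error is then uniformly bounded
  on a fixed ball, where L2 smallness controls the Lp norm. The truncation is cheap because
  \<open>\<psi>\<close> and \<open>\<psi> - \<eta>\<close> share one periodic majorant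
  \<open>W\<close>: the bound for a level depends on the integral of
  \<open>|\<psi> - \<eta>| W^(p-1)\<close>, which tends to 0 by dominated convergence, the
  dominating integral being finite by local Lp integrability of the periodization. The sharp
  constant survives for two reasons. Averaging spreads the coefficients of one residual over several
  levels with weights of total 1, so a step costs at most \<open>|det b|^(1/q)\<close> times the
  norm of that residual. The first residual is \<open>f\<close> itself, and the later ones are
  prescribed so small that together they cost at most the given \<epsilon>. The operator norm of S
  never enters the coefficient bound.\<close>

lemma measure_shear_cbox:
  fixes a b :: "real^'n"
  assumes mn: "m \<noteq> n"
  shows "measure lebesgue ((\<lambda>x. \<chi> i. if i = m then x$m + x$n else x$i) ` cbox a b)
    = measure lebesgue (cbox a b)"
proof (cases "cbox a b = {}")
  case False
  define f where "f = (\<lambda>x::real^'n. \<chi> i. if i = m then x$m + x$n else x$i)"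
  \<comment> \<open>The shear formula for intervals asks for a nonnegative lower bound in coordinate
    \<open>n\<close>; translating by \<open>v\<close> makes that bound 0.\<close>
  define v :: "real^'n" where "v = axis n (a$n)"
  have box: "cbox a b = (+) v ` cbox (a - v) (b - v)"
    by (simp flip: cbox_translation)
  have f_add: "f (v + x) = f v + f x" for x
    by (simp add: f_def vec_eq_iff)
  have "f ` cbox a b = (+) (f v) ` f ` cbox (a - v) (b - v)"
    unfolding box by (simp add: image_image f_add)
  then have "measure lebesgue (f ` cbox a b) = measure lebesgue (f ` cbox (a - v) (b - v))"
    by (simp add: measure_translation)
  also have "\<dots> = measure lebesgue (cbox (a - v) (b - v))"
    unfolding f_def
    by (rule measure_shear_interval) (use mn False box in \<open>auto simp: v_def\<close>)
  also have "\<dots> = measure lebesgue (cbox a b)"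
    unfolding box by (rule measure_translation[symmetric])
  finally show ?thesis by (simp add: f_def)
qed simp

text \<open>A swap of coordinates carries boxes to boxes and permutes the side lengths. Being its
  own inverse, it yields both inclusions of the image from the single rule
  \<open>mem\<close>.\<close>

lemma measure_swap_cbox:
  fixes a b :: "real^'n"
  shows "measure lebesgue ((\<lambda>x. \<chi> i. x $ Transposition.transpose m n i) ` cbox a b)
    = measure lebesgue (cbox a b)"
proof (cases "cbox a b = {}")
  case False
  define h where "h = (\<lambda>x::real^'n. \<chi> i. x $ Transposition.transpose m n i)"
  have hh: "h (h x) = x" for x by (simp add: h_def vec_eq_iff)
  have mem: "h x \<in> cbox (h c) (h d)" if "x \<in> cbox c d" for x c d
    using that by (simp add: h_def mem_box_cart)
  have eq: "h ` cbox a b = cbox (h a) (h b)"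
  proof
    show "cbox (h a) (h b) \<subseteq> h ` cbox a b"
    proof
      fix x assume "x \<in> cbox (h a) (h b)"
      then have "h x \<in> cbox a b" using mem[of x "h a" "h b"] by (simp add: hh)
      then show "x \<in> h ` cbox a b" using hh[of x] by (metis imageI)
    qed
  qed (use mem in auto)
  moreover have "cbox (h a) (h b) \<noteq> {}" using False eq by auto
  moreover have "(\<Prod>i\<in>UNIV. h b $ i - h a $ i) = (\<Prod>i\<in>UNIV. b $ i - a $ i)"
    using prod.permute[OF permutes_swap_id[of m UNIV n], of "\<lambda>i. b $ i - a $ i"]
    by (simp add: h_def o_def)
  ultimately show ?thesis
    using False unfolding h_def[symmetric] by (simp add: content_cbox_cart)
qed simp

text \<open>In the library, \<open>measure_linear_image\<close> assumes a well-ordered index type.\<close>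

lemma lebesgue_measure_matrix_image:
  fixes A :: "real^'n^'n"
  assumes "S \<in> lmeasurable"
  shows "(*v) A ` S \<in> lmeasurable \<and> measure lebesgue ((*v) A ` S) = \<bar>det A\<bar> * measure lebesgue S"
  using assms
proof (induction A arbitrary: S rule: induct_matrix_elementary_alt)
  case (1 A B)
  have "(*v) (A ** B) ` S = (*v) A ` (*v) B ` S"
    by (simp add: image_image matrix_vector_mul_assoc)
  then show ?case using "1.IH" "1.prems" by (simp add: det_mul abs_mult)
next
  case (2 A i)
  have "(A *v x) $ i = 0" for x
    using 2(1) by (simp add: matrix_vector_mult_def row_def vec_eq_iff)
  then have "negligible ((*v) A ` S)"
    by (intro negligible_subset[OF negligible_standard_hyperplane_cart[of i]]) auto
  moreover have "det A = 0" by (rule det_zero_row(2)[OF 2(1)])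
  ultimately show ?case by (simp add: negligible_imp_measurable negligible_imp_measure0)
next
  case (3 A)
  have "(*v) A = (\<lambda>x. \<chi> k. A$k$k * x$k)"
  proof (intro ext, simp add: vec_eq_iff matrix_vector_mult_def, intro allI)
    fix x :: "real^'n" and i
    show "(\<Sum>j\<in>UNIV. A $ i $ j * x $ j) = A $ i $ i * x $ i"
      by (subst sum.remove[of _ i]) (auto simp: 3(1))
  qed
  then show ?case
    using measurable_stretch[OF 3(2), of "\<lambda>k. A$k$k"] measure_stretch[OF 3(2), of "\<lambda>k. A$k$k"]
    by (simp add: det_diagonal[OF 3(1)])
next
  case (4 m n)
  let ?A = "(\<chi> i j. mat 1 $ i $ Transposition.transpose m n j) :: real^'n^'n"
  have A: "(*v) ?A = (\<lambda>x. \<chi> i. x $ Transposition.transpose m n i)"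
  proof (intro ext, simp add: vec_eq_iff matrix_vector_mult_def mat_def, intro allI)
    fix x :: "real^'n" and i
    have "(\<Sum>j\<in>UNIV. (if i = Transposition.transpose m n j then 1 else 0) * x $ j) =
        (\<Sum>j\<in>UNIV. if j = Transposition.transpose m n i then x $ j else 0)"
      by (intro sum.cong) (auto simp: transpose_involutory)
    then show "(\<Sum>j\<in>UNIV. (if i = Transposition.transpose m n j then 1 else 0) * x $ j) =
        x $ Transposition.transpose m n i" by simp
  qed
  have "\<bar>det ?A\<bar> = 1"
    by (simp add: det_permute_columns permutes_swap_id sign_swap_id abs_mult)
  moreover have "\<And>a b. measure lebesgue ((*v) ?A ` cbox a b) = 1 * measure lebesgue (cbox a b)"
    unfolding A by (simp add: measure_swap_cbox)
  ultimately show ?case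
    using measure_linear_sufficient[OF matrix_vector_mul_linear 4(2), of ?A 1] by simp
next
  case (5 m n)
  let ?A = "(\<chi> i j. of_bool (i = m \<and> j = n \<or> i = j)) :: real^'n^'n"
  have A: "(*v) ?A = (\<lambda>x. \<chi> i. if i = m then x$m + x$n else x$i)"
  proof (intro ext, unfold vec_eq_iff, intro allI)
    fix x :: "real^'n" and i
    have "(?A *v x) $ i = (\<Sum>j\<in>UNIV. of_bool (i = m \<and> j = n \<or> i = j) * x $ j)"
      by (simp add: matrix_vector_mult_def)
    also have "\<dots> = (\<Sum>j\<in>(if i = m then {m, n} else {i}). x $ j)"
      by (intro sum.mono_neutral_cong_right) (auto split: if_splits)
    finally show "(?A *v x) $ i = (\<chi> i. if i = m then x$m + x$n else x$i) $ i"
      using 5(1) by simp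
  qed
  have "?A = (\<chi> k. if k = m then row m (mat 1) + 1 *s row n (mat 1) else row k (mat 1))"
    using 5(1) by (auto simp: vec_eq_iff row_def mat_def)
  then have "det ?A = 1"
    using det_row_operation[OF 5(1), of "mat 1 :: real^'n^'n" 1] by simp
  moreover have "\<And>a b. measure lebesgue ((*v) ?A ` cbox a b) = 1 * measure lebesgue (cbox a b)"
    unfolding A by (simp add: measure_shear_cbox[OF 5(1)])
  ultimately show ?case
    using measure_linear_sufficient[OF matrix_vector_mul_linear 5(2), of ?A 1] by simp
qed

section \<open>Invertible affine maps: images, preimages, substitution in integrals\<close>

lemma matrix_inv_two_sided:
  fixes A :: "'a::semiring_1^'n^'m"
  assumes "invertible A"
  shows "A ** matrix_inv A = mat 1" "matrix_inv A ** A = mat 1"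
  using someI_ex[OF assms[unfolded invertible_def]] by (simp_all add: matrix_inv_def)

text \<open>Intersecting with growing balls reduces to finite measure, where the preceding lemma
  applies; continuity from below then admits sets of infinite measure. Measurability of the image
  comes from differentiability of linear maps and so holds for singular \<open>A\<close>
  too.\<close>

lemma emeasure_lebesgue_matrix_image:
  fixes A :: "real^'n^'n"
  assumes S: "S \<in> sets lebesgue"
  shows "(*v) A ` S \<in> sets lebesgue"
    and "emeasure lebesgue ((*v) A ` S) = ennreal \<bar>det A\<bar> * emeasure lebesgue S"
proof -
  have meas: "(*v) A ` T \<in> sets lebesgue" if "T \<in> sets lebesgue" for T
    using that by (intro differentiable_image_in_sets_lebesgue linear_imp_differentiable_on) auto
  then show "(*v) A ` S \<in> sets lebesgue" using S .
  define T where "T n = S \<inter> cball 0 (real n)" for n :: nat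
  have T: "T n \<in> lmeasurable" for n
    unfolding T_def by (intro bounded_set_imp_lmeasurable) (use S in auto)
  have inc: "incseq T" by (auto simp: T_def incseq_def)
  have UT: "(\<Union>n. T n) = S"
  proof -
    have "\<exists>n. x \<in> T n" if "x \<in> S" for x
      using that real_arch_simple[of "norm x"] by (auto simp: T_def)
    then show ?thesis by (auto simp: T_def)
  qed
  have eq: "emeasure lebesgue ((*v) A ` T n) = ennreal \<bar>det A\<bar> * emeasure lebesgue (T n)" for n
    using lebesgue_measure_matrix_image[OF T[of n], of A] T[of n]
    by (simp add: emeasure_eq_measure2 flip: ennreal_mult)
  have "emeasure lebesgue ((*v) A ` S) = emeasure lebesgue (\<Union>n. (*v) A ` T n)"
    by (simp flip: UT image_UN)
  also have "\<dots> = (SUP n. emeasure lebesgue ((*v) A ` T n))"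
    by (rule SUP_emeasure_incseq[symmetric]) (use inc T meas in \<open>auto simp: incseq_def fmeasurableD\<close>)
  also have "\<dots> = ennreal \<bar>det A\<bar> * (SUP n. emeasure lebesgue (T n))"
    by (simp add: eq SUP_mult_left_ennreal)
  also have "(SUP n. emeasure lebesgue (T n)) = emeasure lebesgue S"
    by (subst SUP_emeasure_incseq) (use inc T UT in \<open>auto simp: fmeasurableD\<close>)
  finally show "emeasure lebesgue ((*v) A ` S) = ennreal \<bar>det A\<bar> * emeasure lebesgue S" .
qed

lemma matrix_inv_mult_vec:
  fixes A :: "real^'n^'n"
  assumes "invertible A"
  shows "matrix_inv A *v (A *v x) = x" "A *v (matrix_inv A *v x) = x"
  using matrix_inv_two_sided[OF assms] by (simp_all add: matrix_vector_mul_assoc)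

lemma det_matrix_inv:
  fixes A :: "real^'n^'n"
  assumes "invertible A"
  shows "det (matrix_inv A) = 1 / det A"
proof -
  have "det A * det (matrix_inv A) = 1"
    using matrix_inv_two_sided[OF assms] by (simp flip: det_mul)
  then show ?thesis using assms by (simp add: invertible_det_nz field_simps)
qed

text \<open>Measurability and measure are known for images, so preimages are rewritten as images
  under the inverse map.\<close>

lemma affine_vimage:
  fixes A :: "real^'n^'n"
  assumes "invertible A"
  shows "(\<lambda>x. A *v x + t) -` S = (*v) (matrix_inv A) ` ((+) (- t) ` S)"
proof (rule set_eqI)
  fix x
  have "x \<in> (*v) (matrix_inv A) ` ((+) (- t) ` S) \<longleftrightarrow> (\<exists>s\<in>S. x = matrix_inv A *v (- t + s))"
    by blast
  also have "\<dots> \<longleftrightarrow> (\<exists>s\<in>S. A *v x + t = s)"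
  proof (intro bex_cong refl)
    fix s
    have "x = matrix_inv A *v (- t + s) \<longleftrightarrow> A *v x = - t + s"
      using matrix_inv_mult_vec[OF assms] by metis
    also have "\<dots> \<longleftrightarrow> A *v x + t = s" by (auto simp: algebra_simps)
    finally show "x = matrix_inv A *v (- t + s) \<longleftrightarrow> A *v x + t = s" .
  qed
  finally show "x \<in> (\<lambda>x. A *v x + t) -` S \<longleftrightarrow> x \<in> (*v) (matrix_inv A) ` ((+) (- t) ` S)"
    by simp
qed

text \<open>Continuity only settles Borel sets. On the completed \<sigma>-algebra, null sets must
  pull back to measurable sets, which may fail for a singular \<open>A\<close>; hence the detour
  through images.\<close>

lemma measurable_affine:
  fixes A :: "real^'n^'n"
  assumes "invertible A"
  shows "(\<lambda>x. A *v x + t) \<in> lebesgue \<rightarrow>\<^sub>M lebesgue"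
proof (rule measurableI)
  fix S :: "(real^'n) set" assume "S \<in> sets lebesgue"
  then show "(\<lambda>x. A *v x + t) -` S \<inter> space lebesgue \<in> sets lebesgue"
    using emeasure_lebesgue_matrix_image(1)[OF lebesgue_sets_translation, of S "matrix_inv A" "- t"]
    by (simp only: affine_vimage[OF assms] space_completion space_lborel space_borel UNIV_I Int_UNIV_right)
qed simp

text \<open>Stated for measures, so that the substitution rules for the nonnegative and for the
  Bochner integral are both instances.\<close>

lemma distr_affine:
  fixes A :: "real^'n^'n"
  assumes "invertible A"
  shows "distr lebesgue lebesgue (\<lambda>x. A *v x + t) = density lebesgue (\<lambda>_. ennreal (1 / \<bar>det A\<bar>))"
proof (rule measure_eqI)
  fix S :: "(real^'n) set" assume "S \<in> sets (distr lebesgue lebesgue (\<lambda>x. A *v x + t))"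
  then have S: "S \<in> sets lebesgue" by simp
  have tr: "(+) (- t) ` S \<in> sets lebesgue"
    by (rule lebesgue_sets_translation[OF S])
  have "emeasure lebesgue ((+) (- t) ` S) = emeasure lebesgue S"
    using emeasure_lebesgue_affine[of 1 "- t" S] by simp
  moreover have "emeasure (distr lebesgue lebesgue (\<lambda>x. A *v x + t)) S =
      emeasure lebesgue ((\<lambda>x. A *v x + t) -` S)"
    using S measurable_affine[OF assms] by (subst emeasure_distr) auto
  moreover have "\<dots> = ennreal (1 / \<bar>det A\<bar>) * emeasure lebesgue ((+) (- t) ` S)"
    unfolding affine_vimage[OF assms] emeasure_lebesgue_matrix_image(2)[OF tr] det_matrix_inv[OF assms]
    by simp
  ultimately show "emeasure (distr lebesgue lebesgue (\<lambda>x. A *v x + t)) S =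
      emeasure (density lebesgue (\<lambda>_. ennreal (1 / \<bar>det A\<bar>))) S"
    using S by (simp add: emeasure_density_const)
qed simp

lemma nn_integral_affine:
  fixes A :: "real^'n^'n"
  assumes "invertible A" "f \<in> borel_measurable lebesgue"
  shows "(\<integral>\<^sup>+x. f (A *v x + t) \<partial>lebesgue) = ennreal (1 / \<bar>det A\<bar>) * (\<integral>\<^sup>+x. f x \<partial>lebesgue)"
proof -
  have "(\<integral>\<^sup>+x. f (A *v x + t) \<partial>lebesgue) = (\<integral>\<^sup>+x. f x \<partial>distr lebesgue lebesgue (\<lambda>x. A *v x + t))"
    using assms measurable_affine[OF assms(1)] by (subst nn_integral_distr) auto
  then show ?thesis
    using assms by (simp add: distr_affine nn_integral_density nn_integral_cmult)
qed

lemma borel_measurable_affine: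
  fixes A :: "real^'n^'n"
  assumes "invertible A" "f \<in> borel_measurable lebesgue"
  shows "(\<lambda>x. f (A *v x + t)) \<in> borel_measurable lebesgue"
  using measurable_compose[OF measurable_affine[OF assms(1)] assms(2)] .

text \<open>The set where \<open>P\<close> holds need not be measurable; a measurable null set that
  covers the exceptional points is pulled back instead.\<close>

lemma AE_affine:
  fixes A :: "real^'n^'n"
  assumes A: "invertible A" and P: "AE x in lebesgue. P x"
  shows "AE x in lebesgue. P (A *v x + t)"
proof -
  from AE_E[OF P] obtain N where "{x \<in> space lebesgue. \<not> P x} \<subseteq> N" "emeasure lebesgue N = 0"
    "N \<in> sets lebesgue" .
  then have N: "N \<in> null_sets lebesgue" "{x. \<not> P x} \<subseteq> N" by auto
  have "(\<lambda>x. A *v x + t) -` N \<in> null_sets lebesgue"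
  proof
    have tr: "(+) (- t) ` N \<in> sets lebesgue" using N by (intro lebesgue_sets_translation) auto
    show "(\<lambda>x. A *v x + t) -` N \<in> sets lebesgue"
      unfolding affine_vimage[OF A] by (rule emeasure_lebesgue_matrix_image(1)[OF tr])
    have "emeasure lebesgue ((+) (- t) ` N) = 0"
      using emeasure_lebesgue_affine[of 1 "- t" N] null_setsD1[OF N(1)] by simp
    then show "emeasure lebesgue ((\<lambda>x. A *v x + t) -` N) = 0"
      unfolding affine_vimage[OF A] by (subst emeasure_lebesgue_matrix_image(2)[OF tr]) simp
  qed
  then show ?thesis
    by (rule AE_I') (use N in auto)
qed

lemma integral_affine:
  fixes A :: "real^'n^'n" and f :: "real^'n \<Rightarrow> 'b::{banach, second_countable_topology}"
  assumes "invertible A" "f \<in> borel_measurable lebesgue"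
  shows "(\<integral>x. f (A *v x + t) \<partial>lebesgue) = (1 / \<bar>det A\<bar>) *\<^sub>R (\<integral>x. f x \<partial>lebesgue)"
proof -
  have "(\<integral>x. f (A *v x + t) \<partial>lebesgue) = (\<integral>x. f x \<partial>distr lebesgue lebesgue (\<lambda>x. A *v x + t))"
    using assms measurable_affine[OF assms(1)] by (subst integral_distr) auto
  then show ?thesis
    using assms by (simp add: distr_affine integral_density)
qed

lemma integrable_affine:
  fixes A :: "real^'n^'n" and f :: "real^'n \<Rightarrow> 'b::{banach, second_countable_topology}"
  assumes "invertible A" "integrable lebesgue f"
  shows "integrable lebesgue (\<lambda>x. f (A *v x + t))"
  using assms nn_integral_affine[OF assms(1), of "\<lambda>x. norm (f x)" t]
  by (auto simp: integrable_iff_bounded borel_measurable_affine ennreal_mult_less_top)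

section \<open>Lattice tilings and sums over the lattice\<close>

definition ivec :: "int^'n \<Rightarrow> real^'n" where
  "ivec k = (\<chi> i. real_of_int (k $ i))"

definition vfloor :: "real^'n \<Rightarrow> int^'n" where
  "vfloor x = (\<chi> i. \<lfloor>x $ i\<rfloor>)"

text \<open>Half-open, so that the integer translates are disjoint and cover every point, with no
  boundary set to discard.\<close>

definition ucube :: "(real^'n) set" where
  "ucube = {x. \<forall>i. 0 \<le> x $ i \<and> x $ i < 1}"

lemma lattice_point_ivec: "lattice_point b k = b *v ivec k"
  by (simp add: lattice_point_def ivec_def)

lemma diff_ivec_in_ucube_iff: "x - ivec k \<in> ucube \<longleftrightarrow> k = vfloor x"
proof -
  have "0 \<le> x $ i - real_of_int (k $ i) \<and> x $ i - real_of_int (k $ i) < 1 \<longleftrightarrow> k $ i = \<lfloor>x $ i\<rfloor>" for i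
    by linarith
  then show ?thesis by (simp add: ucube_def ivec_def vfloor_def vec_eq_iff)
qed

lemma vfloor_add_ivec: "x \<in> ucube \<Longrightarrow> vfloor (x + ivec k) = k"
  using diff_ivec_in_ucube_iff[of "x + ivec k" k] by simp

lemma ivec_add: "ivec (k + l) = ivec k + ivec l"
  by (simp add: ivec_def vec_eq_iff)

lemma ivec_uminus: "ivec (- k) = - ivec k"
  by (simp add: ivec_def vec_eq_iff)

lemma ivec_0 [simp]: "ivec 0 = 0"
  by (simp add: ivec_def vec_eq_iff)

text \<open>Each coordinate is a fractional part. The crude comparison with the l1 norm is enough,
  since only uniformity in \<open>x\<close> is used later.\<close>

lemma norm_diff_ivec_vfloor: "norm (x - ivec (vfloor x) :: real^'n) \<le> real CARD('n)"
proof -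
  have "norm (x - ivec (vfloor x)) \<le> (\<Sum>i\<in>UNIV. \<bar>(x - ivec (vfloor x)) $ i\<bar>)"
    by (rule norm_le_l1_cart)
  also have "\<dots> \<le> (\<Sum>i\<in>(UNIV :: 'n set). 1)"
    by (intro sum_mono) (simp add: ivec_def vfloor_def; linarith)
  finally show ?thesis by simp
qed

lemma norm_ucube_le:
  assumes "s \<in> ucube"
  shows "norm (s :: real^'n) \<le> real CARD('n)"
proof -
  have "vfloor s = 0" using vfloor_add_ivec[OF assms, of 0] by simp
  then show ?thesis using norm_diff_ivec_vfloor[of s] by simp
qed

lemma ucube_borel [measurable]: "ucube \<in> sets borel"
proof -
  have "ucube = (\<Inter>i. {x :: real^'n. 0 \<le> x $ i} \<inter> {x. x $ i < 1})"
    by (auto simp: ucube_def)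
  also have "\<dots> \<in> sets borel"
    by (intro sets.countable_INT'' sets.Int) auto
  finally show ?thesis .
qed

lemma ucube_lebesgue [measurable]: "ucube \<in> sets lebesgue"
  using ucube_borel by (simp add: sets_completionI_sets)

lemma emeasure_ucube: "emeasure lebesgue (ucube :: (real^'n) set) = 1"
proof (rule antisym)
  have "emeasure lebesgue (box 0 1 :: (real^'n) set) \<le> emeasure lebesgue (ucube :: (real^'n) set)"
    by (intro emeasure_mono) (auto simp: ucube_def mem_box_cart less_imp_le)
  moreover have "emeasure lebesgue (ucube :: (real^'n) set) \<le> emeasure lebesgue (cbox 0 1 :: (real^'n) set)"
    by (intro emeasure_mono) (auto simp: ucube_def mem_box_cart less_imp_le)
  moreover have "(\<Prod>b\<in>Basis. (1 :: real^'n) \<bullet> b) = 1" "\<And>b. b \<in> Basis \<Longrightarrow> (0 :: real^'n) \<bullet> b \<le> 1 \<bullet> b"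
    by (auto simp: Basis_vec_def inner_axis intro!: prod.neutral)
  ultimately show "1 \<le> emeasure lebesgue (ucube :: (real^'n) set)"
      "emeasure lebesgue (ucube :: (real^'n) set) \<le> 1"
    by (simp_all add: emeasure_lborel_box_eq emeasure_lborel_cbox_eq)
qed

section \<open>Infinite sums as integrals over counting measure, and Fubini\<close>

lemma sigma_finite_lebesgue: "sigma_finite_measure lebesgue"
proof
  have "(\<Union>n. cball 0 (real n)) = (UNIV :: 'a set)"
    using real_arch_simple by auto
  then show "\<exists>A :: 'a set set. countable A \<and> A \<subseteq> sets lebesgue \<and> \<Union> A = space lebesgue \<and>
      (\<forall>a\<in>A. emeasure lebesgue a \<noteq> \<infinity>)"
    by (intro exI[of _ "range (\<lambda>n. cball 0 (real n))"])
      (use emeasure_lborel_cball_finite in \<open>auto simp: less_top[symmetric] less_imp_neq\<close>)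
qed

text \<open>Unordered summability is absolute for each real coordinate, and the finitely many
  coordinates together dominate the norm.\<close>

lemma summable_on_iff_abs_summable_on_euclidean:
  fixes f :: "'k \<Rightarrow> 'b::euclidean_space"
  shows "f summable_on A \<longleftrightarrow> (\<lambda>k. norm (f k)) summable_on A"
proof
  assume f: "f summable_on A"
  have comp: "(\<lambda>k. \<bar>f k \<bullet> b\<bar>) summable_on A" for b
    using summable_on_bounded_linear[OF bounded_linear_inner_left f, of b]
      summable_on_iff_abs_summable_on_real[of "\<lambda>k. f k \<bullet> b" A] by (simp add: o_def)
  have "(\<lambda>k. \<Sum>b\<in>B. \<bar>f k \<bullet> b\<bar>) summable_on A" if "finite B" for B
    using that by (induction B rule: finite_induct) (auto intro: summable_on_add comp)
  then have "(\<lambda>k. \<Sum>b\<in>Basis. \<bar>f k \<bullet> b\<bar>) summable_on A" by simp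
  then show "(\<lambda>k. norm (f k)) summable_on A"
    by (rule summable_on_comparison_test) (auto simp: norm_le_l1)
qed (rule abs_summable_summable)

lemma summable_on_iff_integrable:
  fixes f :: "'k \<Rightarrow> 'b::euclidean_space"
  shows "f summable_on UNIV \<longleftrightarrow> integrable (count_space UNIV) f"
  using summable_on_iff_abs_summable_on_euclidean[of f UNIV] abs_summable_equivalent[of f UNIV]
    Infinite_Set_Sum.abs_summable_on_def[of f UNIV] by blast

text \<open>No summability is assumed: where it fails, both sides take the default value 0.\<close>

lemma infsum_eq_integral:
  fixes f :: "'k \<Rightarrow> 'b::euclidean_space"
  shows "(\<Sum>\<^sub>\<infinity>k. f k) = (\<integral>k. f k \<partial>count_space UNIV)"
proof (cases "integrable (count_space UNIV) f")
  case True
  then show ?thesis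
    using infsetsum_infsum[of f UNIV] by (simp add: Infinite_Set_Sum.abs_summable_on_def infsetsum_def)
next
  case False
  then show ?thesis
    using infsum_not_exists[of f UNIV]
    by (simp add: summable_on_iff_integrable not_integrable_integral_eq)
qed

lemma summable_on_iff_nn_integral:
  fixes f :: "'k \<Rightarrow> 'b::euclidean_space"
  shows "f summable_on UNIV \<longleftrightarrow> (\<integral>\<^sup>+k. norm (f k) \<partial>count_space UNIV) < \<infinity>"
  by (simp add: summable_on_iff_integrable integrable_iff_bounded)

lemma nn_integral_count_space_infsum:
  fixes f :: "'k \<Rightarrow> real"
  assumes "f summable_on UNIV" "\<And>k. 0 \<le> f k"
  shows "(\<integral>\<^sup>+k. ennreal (f k) \<partial>count_space UNIV) = ennreal (\<Sum>\<^sub>\<infinity>k. f k)"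
proof -
  have "integrable (count_space UNIV) f"
    using assms summable_on_iff_nn_integral[of f] by (simp add: integrable_iff_bounded)
  then show ?thesis
    using assms by (simp add: nn_integral_eq_integral infsum_eq_integral)
qed

lemma measurable_count_space_pair:
  fixes f :: "'k::countable \<Rightarrow> 'a \<Rightarrow> 'b"
  assumes "\<And>k. f k \<in> M \<rightarrow>\<^sub>M N"
  shows "(\<lambda>(x, k). f k x) \<in> M \<Otimes>\<^sub>M count_space UNIV \<rightarrow>\<^sub>M N"
  by (subst measurable_pair_swap_iff, intro measurable_pair_measure_countable1)
    (use assms in auto)

text \<open>Read as a parameter integral over counting measure, the sum is measurable as a whole;
  points of divergence, where its value is 0, need no separate treatment.\<close>

lemma borel_measurable_infsum:
  fixes f :: "'k::countable \<Rightarrow> 'a \<Rightarrow> 'b::euclidean_space"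
  assumes "\<And>k. f k \<in> borel_measurable M"
  shows "(\<lambda>x. \<Sum>\<^sub>\<infinity>k. f k x) \<in> borel_measurable M"
proof -
  have "(\<lambda>(x, k). f k x) \<in> borel_measurable (M \<Otimes>\<^sub>M count_space UNIV)"
    by (rule measurable_count_space_pair[OF assms])
  then show ?thesis
    unfolding infsum_eq_integral
    by (intro sigma_finite_measure.borel_measurable_lebesgue_integral
        sigma_finite_measure_count_space_countable) (auto simp: case_prod_beta')
qed

lemma nn_integral_count_space_swap:
  fixes f :: "'k::countable \<Rightarrow> 'a \<Rightarrow> ennreal"
  assumes "sigma_finite_measure M" "\<And>k. f k \<in> borel_measurable M"
  shows "(\<integral>\<^sup>+x. \<integral>\<^sup>+k. f k x \<partial>count_space UNIV \<partial>M) = (\<integral>\<^sup>+k. \<integral>\<^sup>+x. f k x \<partial>M \<partial>count_space UNIV)"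
proof -
  interpret pair_sigma_finite M "count_space (UNIV :: 'k set)"
    using assms(1) by (intro pair_sigma_finite.intro sigma_finite_measure_count_space_countable) auto
  show ?thesis
    using Fubini'[of "\<lambda>x k. f k x"] measurable_count_space_pair[of f, OF assms(2)] by simp
qed

lemma integral_infsum:
  fixes f :: "'k::countable \<Rightarrow> 'a \<Rightarrow> 'b::euclidean_space"
  assumes M: "sigma_finite_measure M" and f: "\<And>k. f k \<in> borel_measurable M"
    and fin: "(\<integral>\<^sup>+k. \<integral>\<^sup>+x. norm (f k x) \<partial>M \<partial>count_space UNIV) < \<infinity>"
  shows "(\<integral>x. (\<Sum>\<^sub>\<infinity>k. f k x) \<partial>M) = (\<Sum>\<^sub>\<infinity>k. \<integral>x. f k x \<partial>M)"
proof -
  interpret pair_sigma_finite M "count_space (UNIV :: 'k set)"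
    using M by (intro pair_sigma_finite.intro sigma_finite_measure_count_space_countable) auto
  have meas: "(\<lambda>(x, k). f k x) \<in> borel_measurable (M \<Otimes>\<^sub>M count_space UNIV)"
    by (rule measurable_count_space_pair[OF f])
  have "(\<integral>\<^sup>+z. norm (case z of (x, k) \<Rightarrow> f k x) \<partial>(M \<Otimes>\<^sub>M count_space UNIV)) =
      (\<integral>\<^sup>+x. \<integral>\<^sup>+k. norm (f k x) \<partial>count_space UNIV \<partial>M)"
    using M2.nn_integral_fst[of "\<lambda>z. ennreal (norm (case z of (x, k) \<Rightarrow> f k x))" M] meas by simp
  also have "\<dots> = (\<integral>\<^sup>+k. \<integral>\<^sup>+x. norm (f k x) \<partial>M \<partial>count_space UNIV)"
    by (rule nn_integral_count_space_swap[OF M]) (use f in measurable)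
  finally have int: "integrable (M \<Otimes>\<^sub>M count_space UNIV) (\<lambda>(x, k). f k x)"
    using meas fin by (simp add: integrable_iff_bounded)
  show "(\<integral>x. (\<Sum>\<^sub>\<infinity>k. f k x) \<partial>M) = (\<Sum>\<^sub>\<infinity>k. \<integral>x. f k x \<partial>M)"
    using Fubini_integral[OF int] by (simp add: infsum_eq_integral)
qed

section \<open>Cutting integrals into unit cells\<close>

lemma invertible_mat_1: "invertible (mat 1 :: real^'n^'n)"
  by (simp add: invertible_det_nz)

lemmas nn_integral_translate = nn_integral_affine[OF invertible_mat_1, simplified]
lemmas borel_measurable_translate = borel_measurable_affine[OF invertible_mat_1, simplified]
lemmas integral_translate = integral_affine[OF invertible_mat_1, simplified]

text \<open>A partition of unity: the only nonzero term is the one at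
  \<open>k = vfloor x\<close>.\<close>

lemma infsum_ucube_indicator:
  fixes c :: "'b::euclidean_space"
  shows "(\<lambda>k. indicator ucube (x - ivec k) *\<^sub>R c) summable_on UNIV"
    and "(\<Sum>\<^sub>\<infinity>k. indicator ucube (x - ivec k) *\<^sub>R c) = c"
proof -
  have "((\<lambda>k. indicator ucube (x - ivec k) *\<^sub>R c) has_sum (\<Sum>k\<in>{vfloor x}. indicator ucube (x - ivec k) *\<^sub>R c)) UNIV"
    by (intro has_sum_finite_neutralI[where B="{vfloor x}"]) (auto simp: diff_ivec_in_ucube_iff indicator_def)
  then have "((\<lambda>k. indicator ucube (x - ivec k) *\<^sub>R c) has_sum c) UNIV"
    by (simp add: diff_ivec_in_ucube_iff)
  then show "(\<lambda>k. indicator ucube (x - ivec k) *\<^sub>R c) summable_on UNIV"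
    "(\<Sum>\<^sub>\<infinity>k. indicator ucube (x - ivec k) *\<^sub>R c) = c"
    by (auto simp: summable_on_def infsumI)
qed

lemma nn_integral_ucube_indicator:
  "(\<integral>\<^sup>+k. indicator ucube (x - ivec k) * c \<partial>count_space UNIV) = c"
proof -
  have "(\<integral>\<^sup>+k. indicator ucube (x - ivec k) * c \<partial>count_space UNIV) =
      (\<integral>\<^sup>+k. c * indicator {vfloor x} k \<partial>count_space UNIV)"
    by (intro nn_integral_cong) (auto simp: diff_ivec_in_ucube_iff indicator_def)
  then show ?thesis by (simp add: nn_integral_cmult_indicator)
qed

text \<open>Insert the partition of unity, exchange sum and integral, and translate every cell back
  to the origin.\<close>

lemma nn_integral_tiling:
  fixes F :: "real^'n \<Rightarrow> ennreal"
  assumes [measurable]: "F \<in> borel_measurable lebesgue"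
  shows "(\<integral>\<^sup>+x. F x \<partial>lebesgue) =
      (\<integral>\<^sup>+k. \<integral>\<^sup>+x. indicator ucube x * F (x + ivec k) \<partial>lebesgue \<partial>count_space UNIV)"
proof -
  have meas: "(\<lambda>x. indicator ucube (x - ivec k) * F x) \<in> borel_measurable lebesgue" for k
    using borel_measurable_translate[of "indicator ucube :: real^'n \<Rightarrow> ennreal" "- ivec k"] by simp
  have "(\<integral>\<^sup>+x. F x \<partial>lebesgue) =
      (\<integral>\<^sup>+x. \<integral>\<^sup>+k. indicator ucube (x - ivec k) * F x \<partial>count_space UNIV \<partial>lebesgue)"
    by (simp add: nn_integral_ucube_indicator)
  also have "\<dots> = (\<integral>\<^sup>+k. \<integral>\<^sup>+x. indicator ucube (x - ivec k) * F x \<partial>lebesgue \<partial>count_space UNIV)"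
    by (rule nn_integral_count_space_swap[OF sigma_finite_lebesgue meas])
  also have "\<dots> = (\<integral>\<^sup>+k. \<integral>\<^sup>+x. indicator ucube x * F (x + ivec k) \<partial>lebesgue \<partial>count_space UNIV)"
  proof (rule nn_integral_cong)
    fix k :: "int^'n"
    show "(\<integral>\<^sup>+x. indicator ucube (x - ivec k) * F x \<partial>lebesgue) =
        (\<integral>\<^sup>+x. indicator ucube x * F (x + ivec k) \<partial>lebesgue)"
      using nn_integral_translate[OF meas[of k], of "ivec k"] by simp
  qed
  finally show ?thesis .
qed

text \<open>Both orders of sum and integral are recorded. The sum outside suits integrands with a
  factor that is constant on cells; the sum inside exhibits the integral as the mean of a
  periodization.\<close>

lemma integral_tiling:
  fixes F :: "real^'n \<Rightarrow> 'b::euclidean_space"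
  assumes F: "integrable lebesgue F"
  shows "(\<integral>x. F x \<partial>lebesgue) = (\<Sum>\<^sub>\<infinity>k. \<integral>x. indicator ucube x *\<^sub>R F (x + ivec k) \<partial>lebesgue)"
    and "(\<integral>x. F x \<partial>lebesgue) = (\<integral>x. indicator ucube x *\<^sub>R (\<Sum>\<^sub>\<infinity>k. F (x + ivec k)) \<partial>lebesgue)"
proof -
  have [measurable]: "F \<in> borel_measurable lebesgue" using F by simp
  have meas: "(\<lambda>x. indicator ucube (x - ivec k) *\<^sub>R F x) \<in> borel_measurable lebesgue" for k
    using borel_measurable_translate[of "indicator ucube :: real^'n \<Rightarrow> real" "- ivec k"] by simp
  have meas': "(\<lambda>x. indicator ucube x *\<^sub>R F (x + ivec k)) \<in> borel_measurable lebesgue" for k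
    using borel_measurable_translate[of F "ivec k"] by simp
  have fin: "(\<integral>\<^sup>+x. norm (F x) \<partial>lebesgue) < \<infinity>" using F by (simp add: integrable_iff_bounded)
  have norm_ind: "ennreal (norm (indicator A x *\<^sub>R c)) = indicator A x * ennreal (norm c)"
    for A :: "(real^'n) set" and x and c :: 'b
    by (auto simp: indicator_def)
  have "(\<integral>\<^sup>+k. \<integral>\<^sup>+x. norm (indicator ucube (x - ivec k) *\<^sub>R F x) \<partial>lebesgue \<partial>count_space UNIV) =
      (\<integral>\<^sup>+x. \<integral>\<^sup>+k. norm (indicator ucube (x - ivec k) *\<^sub>R F x) \<partial>count_space UNIV \<partial>lebesgue)"
    by (rule nn_integral_count_space_swap[OF sigma_finite_lebesgue, symmetric])
      (use meas in measurable)
  also have "\<dots> = (\<integral>\<^sup>+x. norm (F x) \<partial>lebesgue)"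
    unfolding norm_ind nn_integral_ucube_indicator ..
  finally have fin1: "(\<integral>\<^sup>+k. \<integral>\<^sup>+x. norm (indicator ucube (x - ivec k) *\<^sub>R F x) \<partial>lebesgue \<partial>count_space UNIV) < \<infinity>"
    using fin by simp
  have fin2: "(\<integral>\<^sup>+k. \<integral>\<^sup>+x. norm (indicator ucube x *\<^sub>R F (x + ivec k)) \<partial>lebesgue \<partial>count_space UNIV) < \<infinity>"
    using fin nn_integral_tiling[of "\<lambda>x. norm (F x)"] unfolding norm_ind by simp
  have "(\<integral>x. F x \<partial>lebesgue) = (\<integral>x. (\<Sum>\<^sub>\<infinity>k. indicator ucube (x - ivec k) *\<^sub>R F x) \<partial>lebesgue)"
    by (simp add: infsum_ucube_indicator)
  also have "\<dots> = (\<Sum>\<^sub>\<infinity>k. \<integral>x. indicator ucube (x - ivec k) *\<^sub>R F x \<partial>lebesgue)"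
    by (rule integral_infsum[OF sigma_finite_lebesgue meas fin1])
  also have "\<dots> = (\<Sum>\<^sub>\<infinity>k. \<integral>x. indicator ucube x *\<^sub>R F (x + ivec k) \<partial>lebesgue)"
  proof (rule infsum_cong)
    fix k :: "int^'n"
    show "(\<integral>x. indicator ucube (x - ivec k) *\<^sub>R F x \<partial>lebesgue) =
        (\<integral>x. indicator ucube x *\<^sub>R F (x + ivec k) \<partial>lebesgue)"
      using integral_translate[OF meas[of k], of "ivec k"] by simp
  qed
  finally show *: "(\<integral>x. F x \<partial>lebesgue) = (\<Sum>\<^sub>\<infinity>k. \<integral>x. indicator ucube x *\<^sub>R F (x + ivec k) \<partial>lebesgue)" .
  have "\<dots> = (\<integral>x. (\<Sum>\<^sub>\<infinity>k. indicator ucube x *\<^sub>R F (x + ivec k)) \<partial>lebesgue)"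
    by (rule integral_infsum[OF sigma_finite_lebesgue meas' fin2, symmetric])
  also have "\<dots> = (\<integral>x. indicator ucube x *\<^sub>R (\<Sum>\<^sub>\<infinity>k. F (x + ivec k)) \<partial>lebesgue)"
    by (intro Bochner_Integration.integral_cong refl) (auto simp: indicator_def)
  finally show "(\<integral>x. F x \<partial>lebesgue) = (\<integral>x. indicator ucube x *\<^sub>R (\<Sum>\<^sub>\<infinity>k. F (x + ivec k)) \<partial>lebesgue)"
    using * by simp
qed

section \<open>Estimates for lattice sums\<close>

text \<open>A convex function lies above its tangents. The point \<open>x = 0\<close> is outside the
  open half-line of the convexity statement; there the left side is
  \<open>(1 - p) * s powr p\<close>, which is not positive.\<close>

lemma powr_above_tangent:
  fixes s x p :: real
  assumes "1 \<le> p" "0 < s" "0 \<le> x"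
  shows "s powr p + p * s powr (p - 1) * (x - s) \<le> x powr p"
proof (cases "x = 0")
  case True
  have "s powr (p - 1) * s = s powr p"
    using assms by (simp add: powr_diff)
  then have "s powr p + p * s powr (p - 1) * (x - s) = (1 - p) * s powr p"
    using True by (simp add: algebra_simps)
  also have "\<dots> \<le> 0" using assms by (intro mult_nonpos_nonneg) auto
  finally show ?thesis using True by simp
next
  case False
  have "p * s powr (p - 1) * (x - s) \<le> x powr p - s powr p"
  proof (rule convex_on_imp_above_tangent[OF powr_convex[OF assms(1)]])
    show "((\<lambda>x. x powr p) has_real_derivative p * s powr (p - 1)) (at s within {0<..})"
      using assms by (auto intro!: derivative_eq_intros)
  qed (use assms False in \<open>auto simp: interior_open connected_Ioi\<close>)
  then show ?thesis by simp
qed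

text \<open>Integrating the tangent inequality at the weighted mean \<open>s = I / m\<close> against
  \<open>w\<close> makes the linear terms cancel. The weight is not normalised, whence the power
  \<open>p - 1\<close> of its mass.\<close>

lemma
  fixes u w :: "'a \<Rightarrow> real"
  assumes p: "1 \<le> p" and w: "integrable M w" "\<And>x. 0 \<le> w x"
    and u: "u \<in> borel_measurable M" "\<And>x. 0 \<le> u x"
    and uw: "integrable M (\<lambda>x. u x powr p * w x)"
  shows weighted_integrable: "integrable M (\<lambda>x. u x * w x)"
    and weighted_jensen: "(\<integral>x. u x * w x \<partial>M) powr p \<le>
      (\<integral>x. w x \<partial>M) powr (p - 1) * (\<integral>x. u x powr p * w x \<partial>M)"
proof -
  note [measurable] = u(1) borel_measurable_integrable[OF w(1)]
  have le: "u x \<le> 1 + u x powr p" for x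
  proof (cases "u x \<le> 1")
    case True
    then show ?thesis using powr_ge_zero[of "u x" p] by linarith
  next
    case False
    then have "u x powr 1 \<le> u x powr p" using p by (intro powr_mono) auto
    then show ?thesis using u(2)[of x] by simp
  qed
  show int: "integrable M (\<lambda>x. u x * w x)"
  proof (rule Bochner_Integration.integrable_bound)
    show "integrable M (\<lambda>x. w x + u x powr p * w x)" using w uw by simp
    show "AE x in M. norm (u x * w x) \<le> norm (w x + u x powr p * w x)"
      using mult_right_mono[OF le w(2)] w(2) u(2) by (intro AE_I2) (simp add: distrib_right)
  qed measurable
  define m I where "m = (\<integral>x. w x \<partial>M)" and "I = (\<integral>x. u x * w x \<partial>M)"
  have nonneg: "0 \<le> m" "0 \<le> I" unfolding m_def I_def using w u by (auto intro!: integral_nonneg)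
  have rhs: "0 \<le> m powr (p - 1) * (\<integral>x. u x powr p * w x \<partial>M)"
    using w by (auto intro!: integral_nonneg mult_nonneg_nonneg)
  have "I powr p \<le> m powr (p - 1) * (\<integral>x. u x powr p * w x \<partial>M)"
  proof (cases "I = 0 \<or> m = 0")
    case True
    \<comment> \<open>The mean \<open>I / m\<close> is meaningless for zero mass, but then
      \<open>w\<close> vanishes almost everywhere and the left side is 0 as well.\<close>
    have "I = 0" if "m = 0"
    proof -
      have "AE x in M. w x = 0"
        using that w by (simp add: m_def integral_nonneg_eq_0_iff_AE)
      then have "(\<integral>x. u x * w x \<partial>M) = (\<integral>x. 0 \<partial>M)" by (intro integral_cong_AE) auto
      then show ?thesis by (simp add: I_def)
    qed
    then show ?thesis using True rhs by auto
  next
    case False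
    define s where "s = I / m"
    have pos: "0 < m" "0 < I" "0 < s" using False nonneg by (auto simp: s_def)
    have "(\<integral>x. (s powr p - p * s powr (p - 1) * s) * w x + p * s powr (p - 1) * (u x * w x) \<partial>M)
        \<le> (\<integral>x. u x powr p * w x \<partial>M)"
    proof (rule integral_mono)
      fix x
      show "(s powr p - p * s powr (p - 1) * s) * w x + p * s powr (p - 1) * (u x * w x) \<le> u x powr p * w x"
        using mult_right_mono[OF powr_above_tangent[OF p pos(3) u(2)] w(2)]
        by (simp add: algebra_simps)
    qed (use w int uw in auto)
    also have "(\<integral>x. (s powr p - p * s powr (p - 1) * s) * w x + p * s powr (p - 1) * (u x * w x) \<partial>M)
        = (s powr p - p * s powr (p - 1) * s) * m + p * s powr (p - 1) * I"
      using w int by (simp add: m_def I_def)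
    also have "\<dots> = s powr p * m" using pos by (simp add: s_def algebra_simps)
    finally have "m powr (p - 1) * (s powr p * m) \<le> m powr (p - 1) * (\<integral>x. u x powr p * w x \<partial>M)"
      by (intro mult_left_mono) auto
    moreover have "m powr (p - 1) * m = m powr p" using pos by (simp add: powr_diff)
    then have "m powr (p - 1) * (s powr p * m) = m powr p * s powr p"
      by (metis mult.assoc mult.commute)
    then have "m powr (p - 1) * (s powr p * m) = I powr p"
      using pos by (simp add: s_def powr_divide)
    ultimately show ?thesis by simp
  qed
  then show "(\<integral>x. u x * w x \<partial>M) powr p \<le>
      (\<integral>x. w x \<partial>M) powr (p - 1) * (\<integral>x. u x powr p * w x \<partial>M)"
    by (simp add: m_def I_def)
qed

lemma Lp_fun_iff_nn_integral:
  "f \<in> Lp_fun M p \<longleftrightarrow> f \<in> borel_measurable M \<and> (\<integral>\<^sup>+x. ennreal (norm (f x) powr p) \<partial>M) < \<infinity>"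
  by (auto simp: Lp_fun_def integrable_iff_bounded)

lemma nn_integral_Lp_norm:
  assumes "1 \<le> p" "f \<in> Lp_fun M p"
  shows "(\<integral>\<^sup>+x. ennreal (norm (f x) powr p) \<partial>M) = ennreal (Lp_norm M p f powr p)"
  using assms by (simp add: Lp_fun_def Lp_norm_def nn_integral_eq_integral powr_powr)

lemma Lp_norm_leI:
  assumes "1 \<le> p" "0 \<le> r" "f \<in> borel_measurable M"
    and "(\<integral>\<^sup>+x. ennreal (norm (f x) powr p) \<partial>M) \<le> ennreal (r powr p)"
  shows "f \<in> Lp_fun M p" "Lp_norm M p f \<le> r"
proof -
  show f: "f \<in> Lp_fun M p"
    using assms order.strict_trans1[OF assms(4)] by (simp add: Lp_fun_iff_nn_integral)
  then have "Lp_norm M p f powr p \<le> r powr p"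
    using assms nn_integral_Lp_norm[of p f M] by simp
  then have "(Lp_norm M p f powr p) powr (1 / p) \<le> r"
    using assms by (intro powr_le_imp) auto
  then show "Lp_norm M p f \<le> r"
    using assms by (simp add: powr_powr Lp_norm_nonneg)
qed

text \<open>By Jensen the \<open>p\<close>-th power of \<open>\<Sum>\<^sub>k c\<^sub>k w(x - k)\<close> is at most \<open>\<Sum>\<^sub>k c\<^sub>k\<^sup>p w(x - k) W(x)\<^sup>p\<^sup>-\<^sup>1\<close>, and periodicity
  makes the integral of each summand the same multiple of \<open>c\<^sub>k\<^sup>p\<close>.\<close>

lemma
  fixes w W :: "real^'n \<Rightarrow> real" and c :: "int^'n \<Rightarrow> real"
  assumes p: "1 \<le> p"
    and w: "w \<in> borel_measurable lebesgue" "\<And>x. 0 \<le> w x"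
    and W: "W \<in> borel_measurable lebesgue" "\<And>x k. W (x + ivec k) = W x"
    and wW: "AE x in lebesgue. (\<lambda>k. w (x - ivec k)) summable_on UNIV \<and> (\<Sum>\<^sub>\<infinity>k. w (x - ivec k)) \<le> W x"
    and c: "(\<lambda>k. c k powr p) summable_on UNIV" "\<And>k. 0 \<le> c k"
    and fin: "(\<integral>\<^sup>+x. w x * W x powr (p - 1) \<partial>lebesgue) < \<infinity>"
  shows lattice_sum_summable: "AE x in lebesgue. (\<lambda>k. c k * w (x - ivec k)) summable_on UNIV"
    and lattice_sum_bound: "(\<integral>\<^sup>+x. ennreal ((\<Sum>\<^sub>\<infinity>k. c k * w (x - ivec k)) powr p) \<partial>lebesgue) \<le>
      ennreal (\<Sum>\<^sub>\<infinity>k. c k powr p) * (\<integral>\<^sup>+x. w x * W x powr (p - 1) \<partial>lebesgue)"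
proof -
  define N where "N = (\<integral>\<^sup>+x. w x * W x powr (p - 1) \<partial>lebesgue)"
  define F where "F k x = ennreal (c k powr p * (w (x - ivec k) * W x powr (p - 1)))" for k x
  have w_shift: "(\<lambda>x. w (x - ivec k)) \<in> borel_measurable lebesgue" for k
    using borel_measurable_translate[OF w(1), of "- ivec k"] by simp
  have F_meas: "F k \<in> borel_measurable lebesgue" for k
    unfolding F_def using W(1) w_shift by measurable
  have W_shift: "W (x - ivec k) = W x" for x k
    using W(2)[of x "- k"] by (simp add: ivec_uminus)
  have F_int: "(\<integral>\<^sup>+x. F k x \<partial>lebesgue) = ennreal (c k powr p) * N" for k
  proof -
    have meas: "(\<lambda>x. ennreal (w x * W x powr (p - 1))) \<in> borel_measurable lebesgue"
      using w(1) W(1) by measurable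
    have "(\<integral>\<^sup>+x. F k x \<partial>lebesgue) =
        (\<integral>\<^sup>+x. ennreal (c k powr p) * ennreal (w (x - ivec k) * W (x - ivec k) powr (p - 1)) \<partial>lebesgue)"
      unfolding F_def W_shift using w(2) by (simp add: ennreal_mult)
    also have "\<dots> = ennreal (c k powr p) *
        (\<integral>\<^sup>+x. ennreal (w (x - ivec k) * W (x - ivec k) powr (p - 1)) \<partial>lebesgue)"
      using borel_measurable_translate[OF meas, of "- ivec k"] by (subst nn_integral_cmult) auto
    also have "(\<integral>\<^sup>+x. ennreal (w (x - ivec k) * W (x - ivec k) powr (p - 1)) \<partial>lebesgue) = N"
      using nn_integral_translate[OF meas, of "- ivec k"] by (simp add: N_def)
    finally show ?thesis .
  qed
  have total: "(\<integral>\<^sup>+x. \<integral>\<^sup>+k. F k x \<partial>count_space UNIV \<partial>lebesgue) = ennreal (\<Sum>\<^sub>\<infinity>k. c k powr p) * N"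
    unfolding nn_integral_count_space_swap[of lebesgue F, OF sigma_finite_lebesgue F_meas] F_int
    using nn_integral_count_space_infsum[OF c(1)] by (simp add: nn_integral_multc)
  have "(\<lambda>x. \<integral>\<^sup>+k. F k x \<partial>count_space UNIV) \<in> borel_measurable lebesgue"
    using sigma_finite_measure.borel_measurable_nn_integral[of "count_space UNIV" "\<lambda>x k. F k x" lebesgue]
      measurable_count_space_pair[of F, OF F_meas]
    by (simp add: sigma_finite_measure_count_space_countable)
  \<comment> \<open>Finiteness of the total integral gives, at almost every point, the weighted
    summability of the p-th powers that Jensen requires.\<close>
  then have AE_fin: "AE x in lebesgue. (\<integral>\<^sup>+k. F k x \<partial>count_space UNIV) \<noteq> \<infinity>"
    by (rule nn_integral_PInf_AE)
      (use fin total in \<open>auto simp: N_def ennreal_mult_eq_top_iff less_top[symmetric]\<close>)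
  have AE_both: "AE x in lebesgue. (\<lambda>k. c k * w (x - ivec k)) summable_on UNIV \<and>
      ennreal ((\<Sum>\<^sub>\<infinity>k. c k * w (x - ivec k)) powr p) \<le> (\<integral>\<^sup>+k. F k x \<partial>count_space UNIV)"
    using AE_fin wW
  proof eventually_elim
    case (elim x)
    let ?w = "\<lambda>k. w (x - ivec k)"
    have int_w: "integrable (count_space UNIV) ?w"
      using elim(2) summable_on_iff_nn_integral[of ?w] w(2) by (simp add: integrable_iff_bounded)
    have sum_w: "(\<Sum>\<^sub>\<infinity>k. ?w k) \<le> W x" "0 \<le> (\<Sum>\<^sub>\<infinity>k. ?w k)"
      using elim(2) w(2) by (auto intro: infsum_nonneg)
    \<comment> \<open>Where \<open>W x = 0\<close>, the factor \<open>W x powr (p - 1)\<close>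
      annihilates \<open>F\<close> (also for \<open>p = 1\<close>, as \<open>0 powr 0 = 0\<close>),
      so finiteness of its sum carries no information. But there every \<open>w (x - ivec k)\<close>
      vanishes, being a nonnegative term of a sum bounded by \<open>W x\<close>.\<close>
    show ?case
    proof (cases "W x = 0")
      case True
      then have "?w k = 0" for k
        using nonneg_infsum_le_0D[of ?w UNIV k] sum_w elim(2) w(2) by simp
      then show ?thesis by simp
    next
      case False
      then have pos: "0 < W x" using sum_w by simp
      have eq: "(\<integral>\<^sup>+k. F k x \<partial>count_space UNIV) =
          (\<integral>\<^sup>+k. ennreal (c k powr p * ?w k) \<partial>count_space UNIV) * ennreal (W x powr (p - 1))"
        unfolding F_def using w(2) by (simp add: ennreal_mult nn_integral_multc flip: mult.assoc)
      have int_cw: "integrable (count_space UNIV) (\<lambda>k. c k powr p * ?w k)"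
        using elim(1) pos w(2) unfolding eq
        by (auto simp: integrable_iff_bounded ennreal_mult_eq_top_iff less_top[symmetric])
      note jensen = weighted_integrable[OF p int_w w(2) _ c(2) int_cw]
        weighted_jensen[OF p int_w w(2) _ c(2) int_cw]
      have "(\<Sum>\<^sub>\<infinity>k. c k * ?w k) powr p \<le> (\<Sum>\<^sub>\<infinity>k. ?w k) powr (p - 1) * (\<Sum>\<^sub>\<infinity>k. c k powr p * ?w k)"
        using jensen(2) by (simp add: infsum_eq_integral)
      also have "\<dots> \<le> W x powr (p - 1) * (\<Sum>\<^sub>\<infinity>k. c k powr p * ?w k)"
        using sum_w p w(2) by (intro mult_right_mono powr_mono2 infsum_nonneg) auto
      finally have "ennreal ((\<Sum>\<^sub>\<infinity>k. c k * ?w k) powr p) \<le> (\<integral>\<^sup>+k. F k x \<partial>count_space UNIV)"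
        unfolding eq using int_cw w(2)
        by (simp add: nn_integral_eq_integral infsum_eq_integral mult.commute flip: ennreal_mult)
      moreover have "(\<lambda>k. c k * ?w k) summable_on UNIV"
        using jensen(1) by (simp add: summable_on_iff_nn_integral integrable_iff_bounded)
      ultimately show ?thesis by simp
    qed
  qed
  then show "AE x in lebesgue. (\<lambda>k. c k * w (x - ivec k)) summable_on UNIV"
    by eventually_elim simp
  have "(\<integral>\<^sup>+x. ennreal ((\<Sum>\<^sub>\<infinity>k. c k * w (x - ivec k)) powr p) \<partial>lebesgue) \<le>
      (\<integral>\<^sup>+x. \<integral>\<^sup>+k. F k x \<partial>count_space UNIV \<partial>lebesgue)"
    using AE_both by (intro nn_integral_mono_AE) (auto elim: eventually_mono)
  then show "(\<integral>\<^sup>+x. ennreal ((\<Sum>\<^sub>\<infinity>k. c k * w (x - ivec k)) powr p) \<partial>lebesgue) \<le>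
      ennreal (\<Sum>\<^sub>\<infinity>k. c k powr p) * (\<integral>\<^sup>+x. w x * W x powr (p - 1) \<partial>lebesgue)"
    by (simp add: total N_def)
qed

section \<open>Completeness of \<open>L\<^sup>p\<close>\<close>

text \<open>The majorant bounds p-th powers and takes extended values, so a supremum of partial sums
  can serve as \<open>w\<close> before it is known to be finite almost everywhere.\<close>

lemma Lp_dominated_convergence:
  fixes u :: "nat \<Rightarrow> 'a \<Rightarrow> complex" and w :: "'a \<Rightarrow> ennreal"
  assumes p: "1 \<le> p" and u: "\<And>n. u n \<in> borel_measurable M"
    and w: "w \<in> borel_measurable M" "(\<integral>\<^sup>+x. w x \<partial>M) < \<infinity>"
    and le: "\<And>n. AE x in M. ennreal (norm (u n x) powr p) \<le> w x"
    and lim: "AE x in M. (\<lambda>n. u n x) \<longlonglongrightarrow> 0"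
  shows "u n \<in> Lp_fun M p" and "(\<lambda>n. Lp_norm M p (u n)) \<longlonglongrightarrow> 0"
proof -
  show "u n \<in> Lp_fun M p"
    using u order.strict_trans1[OF nn_integral_mono_AE[OF le] w(2)] by (simp add: Lp_fun_iff_nn_integral)
  have lim0: "(\<lambda>n. \<integral>\<^sup>+x. ennreal (norm (u n x) powr p) \<partial>M) \<longlonglongrightarrow> (\<integral>\<^sup>+x. 0 \<partial>M)"
  proof (rule nn_integral_dominated_convergence[where w=w])
    show "AE x in M. (\<lambda>n. ennreal (norm (u n x) powr p)) \<longlonglongrightarrow> 0"
      using lim
    proof eventually_elim
      case (elim x)
      have "(\<lambda>n. norm (u n x) powr p) \<longlonglongrightarrow> 0 powr p"
        using p tendsto_norm[OF elim] by (intro tendsto_powr') auto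
      then show ?case using p tendsto_ennrealI[of "\<lambda>n. norm (u n x) powr p" 0 sequentially] by simp
    qed
  qed (use u w le in auto)
  have "(\<lambda>n. enn2real (\<integral>\<^sup>+x. ennreal (norm (u n x) powr p) \<partial>M)) \<longlonglongrightarrow> enn2real 0"
    using lim0 by (intro tendsto_enn2real) auto
  then have "(\<lambda>n. \<integral>x. norm (u n x) powr p \<partial>M) \<longlonglongrightarrow> 0"
    using u by (subst integral_eq_nn_integral) auto
  then have "(\<lambda>n. (\<integral>x. norm (u n x) powr p \<partial>M) powr (1 / p)) \<longlonglongrightarrow> 0 powr (1 / p)"
    using p by (intro tendsto_powr') auto
  then show "(\<lambda>n. Lp_norm M p (u n)) \<longlonglongrightarrow> 0"
    using p by (simp add: Lp_norm_def)
qed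

lemma Lp_norm_cmult:
  assumes "1 \<le> p"
  shows "Lp_norm M p (\<lambda>x. z * f x) = norm z * Lp_norm M p f"
  using assms by (simp add: Lp_norm_def norm_mult powr_mult powr_powr)

lemma Lp_fun_cmult: "f \<in> Lp_fun M p \<Longrightarrow> (\<lambda>x. z * f x) \<in> Lp_fun M p"
  by (auto simp: Lp_fun_def norm_mult powr_mult)

lemma Lp_fun_zero [simp]: "(\<lambda>x. 0) \<in> Lp_fun M p"
  by (simp add: Lp_fun_def)

lemma Lp_norm_zero [simp]: "Lp_norm M p (\<lambda>x. 0) = 0"
  by (simp add: Lp_norm_def)

lemma
  assumes p: "1 \<le> p" and "finite J" "\<And>j. j \<in> J \<Longrightarrow> F j \<in> Lp_fun M p"
  shows Lp_fun_sum: "(\<lambda>x. \<Sum>j\<in>J. F j x) \<in> Lp_fun M p"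
    and Lp_norm_sum_le: "Lp_norm M p (\<lambda>x. \<Sum>j\<in>J. F j x) \<le> (\<Sum>j\<in>J. Lp_norm M p (F j))"
proof -
  have "(\<lambda>x. \<Sum>j\<in>J. F j x) \<in> Lp_fun M p \<and>
      Lp_norm M p (\<lambda>x. \<Sum>j\<in>J. F j x) \<le> (\<Sum>j\<in>J. Lp_norm M p (F j))"
    using assms(2,3)
  proof (induction J rule: finite_induct)
    case (insert j J)
    then have "F j \<in> Lp_fun M p" "(\<lambda>x. \<Sum>j\<in>J. F j x) \<in> Lp_fun M p"
      "Lp_norm M p (\<lambda>x. \<Sum>j\<in>J. F j x) \<le> (\<Sum>j\<in>J. Lp_norm M p (F j))" by auto
    then show ?case
      using insert.hyps Lp_fun_add[OF p] Lp_norm_triangle[OF p, of "F j" M "\<lambda>x. \<Sum>j\<in>J. F j x"] by auto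
  qed simp
  then show "(\<lambda>x. \<Sum>j\<in>J. F j x) \<in> Lp_fun M p"
    "Lp_norm M p (\<lambda>x. \<Sum>j\<in>J. F j x) \<le> (\<Sum>j\<in>J. Lp_norm M p (F j))" by auto
qed

lemma sum_le_infsum_nonneg:
  fixes g :: "nat \<Rightarrow> real"
  assumes "g summable_on A" "finite J" "J \<subseteq> A" "\<And>j. 0 \<le> g j"
  shows "(\<Sum>j\<in>J. g j) \<le> (\<Sum>\<^sub>\<infinity>j\<in>A. g j)"
  using assms by (intro finite_sum_le_infsum) auto

text \<open>The Riesz-Fischer argument: the p-th powers of the partial sums \<open>G n\<close> of
  the norms increase to \<open>H\<close>, whose integral is finite by the triangle inequality and
  monotone convergence. So the series converges absolutely almost everywhere, and \<open>H\<close>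
  dominates the p-th powers of all its tails.\<close>

lemma Lp_series_converges:
  fixes F :: "nat \<Rightarrow> 'a \<Rightarrow> complex"
  assumes p: "1 \<le> p" and F: "\<And>j. 0 < j \<Longrightarrow> F j \<in> Lp_fun M p"
    and sum: "(\<lambda>j. Lp_norm M p (F j)) summable_on {0<..}"
  obtains f where "f \<in> Lp_fun M p" "(\<lambda>n. Lp_norm M p (\<lambda>x. f x - (\<Sum>j=1..n. F j x))) \<longlonglongrightarrow> 0"
proof -
  define S where "S = (\<Sum>\<^sub>\<infinity>j\<in>{0<..}. Lp_norm M p (F j))"
  define G where "G n x = (\<Sum>j=1..n. norm (F j x))" for n x
  define H where "H x = (SUP n. ennreal (G n x powr p))" for x
  have [measurable]: "F j \<in> borel_measurable M" if "0 < j" for j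
    using F[OF that] by (simp add: Lp_fun_def)
  have Fm: "F (Suc j) \<in> borel_measurable M" for j by simp
  have G_meas [measurable]: "G n \<in> borel_measurable M" for n
    unfolding G_def by measurable
  have G_nonneg: "0 \<le> G n x" for n x by (simp add: G_def sum_nonneg)
  have G_mono: "G m x \<le> G n x" if "m \<le> n" for m n x
    unfolding G_def using that by (intro sum_mono2) auto
  have G_int: "(\<integral>\<^sup>+x. ennreal (G n x powr p) \<partial>M) \<le> ennreal (S powr p)" for n
  proof -
    \<comment> \<open>\<open>Lp_norm\<close> takes complex-valued functions, so the pointwise norms
      are embedded into the complex numbers before the triangle inequality is applied.\<close>
    define Fn where "Fn j x = complex_of_real (norm (F j x))" for j x
    have Fn: "Fn j \<in> Lp_fun M p" "Lp_norm M p (Fn j) = Lp_norm M p (F j)" if "0 < j" for j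
      using F[OF that] by (auto simp: Fn_def[abs_def] Lp_fun_def Lp_norm_def)
    have L: "(\<lambda>x. \<Sum>j=1..n. Fn j x) \<in> Lp_fun M p"
      by (intro Lp_fun_sum[OF p] Fn) auto
    have "Lp_norm M p (\<lambda>x. \<Sum>j=1..n. Fn j x) \<le> (\<Sum>j=1..n. Lp_norm M p (Fn j))"
      by (intro Lp_norm_sum_le[OF p] Fn) auto
    also have "\<dots> = (\<Sum>j=1..n. Lp_norm M p (F j))" by (intro sum.cong) (auto simp: Fn)
    also have "\<dots> \<le> S" unfolding S_def
      by (intro sum_le_infsum_nonneg[OF sum]) (auto simp: Lp_norm_nonneg)
    finally have "Lp_norm M p (\<lambda>x. \<Sum>j=1..n. Fn j x) powr p \<le> S powr p"
      using p by (intro powr_mono2) (auto simp: Lp_norm_nonneg)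
    moreover have "norm (\<Sum>j=1..n. Fn j x) = G n x" for x
      unfolding Fn_def of_real_sum[symmetric] norm_of_real using G_nonneg[of n x] by (simp add: G_def)
    ultimately show ?thesis
      using nn_integral_Lp_norm[OF p L] by (simp add: ennreal_leI)
  qed
  have H_meas [measurable]: "H \<in> borel_measurable M" unfolding H_def by measurable
  have "(\<integral>\<^sup>+x. H x \<partial>M) = (SUP n. \<integral>\<^sup>+x. ennreal (G n x powr p) \<partial>M)"
    unfolding H_def
    by (rule nn_integral_monotone_convergence_SUP)
      (use G_mono G_nonneg p in \<open>auto simp: incseq_def le_fun_def intro!: ennreal_leI powr_mono2\<close>)
  also have "\<dots> \<le> ennreal (S powr p)" using G_int by (intro SUP_least)
  also have "\<dots> < \<infinity>" by simp
  finally have H_int: "(\<integral>\<^sup>+x. H x \<partial>M) < \<infinity>" .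
  have AE_H: "AE x in M. H x \<noteq> \<infinity>"
    using H_int by (intro nn_integral_PInf_AE) auto
  have key: "summable (\<lambda>j. norm (F (Suc j) x))"
    "ennreal ((\<Sum>j. norm (F (Suc j) x)) powr p) \<le> H x" if Hx: "H x \<noteq> \<infinity>" for x
  proof -
    have G_Suc: "G n x = (\<Sum>j<n. norm (F (Suc j) x))" for n
      unfolding G_def by (rule sum.reindex_bij_witness[of _ Suc "\<lambda>j. j - 1"]) auto
    obtain r where r: "H x = ennreal r" "0 \<le> r" using Hx by (cases "H x") auto
    have le: "G n x powr p \<le> r" for n
    proof -
      have "ennreal (G n x powr p) \<le> H x" unfolding H_def by (intro SUP_upper) auto
      then show ?thesis using r by simp
    qed
    have "G n x \<le> r powr (1 / p)" for n
      using powr_mono2[OF _ _ le[of n], of "1 / p"] p G_nonneg[of n x] by (simp add: powr_powr)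
    then have "(\<Sum>j\<le>n. norm (F (Suc j) x)) \<le> r powr (1 / p)" for n
      unfolding G_Suc lessThan_Suc_atMost[symmetric] .
    then show s: "summable (\<lambda>j. norm (F (Suc j) x))"
      by (intro bounded_imp_summable[of _ "r powr (1 / p)"]) auto
    have "(\<lambda>n. G n x powr p) \<longlonglongrightarrow> (\<Sum>j. norm (F (Suc j) x)) powr p"
      unfolding G_Suc using p summable_LIMSEQ[OF s] by (intro tendsto_powr') (auto intro!: always_eventually sum_nonneg)
    then have "(\<Sum>j. norm (F (Suc j) x)) powr p \<le> r"
      by (rule LIMSEQ_le_const2) (use le in auto)
    then show "ennreal ((\<Sum>j. norm (F (Suc j) x)) powr p) \<le> H x" using r by (simp add: ennreal_leI)
  qed
  define f where "f x = (\<Sum>j. F (Suc j) x)" for x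
  have f_meas: "f \<in> borel_measurable M" unfolding f_def by (rule borel_measurable_suminf[OF Fm])
  define u where "u n x = f x - (\<Sum>j=1..n. F j x)" for n x
  have u_meas: "u n \<in> borel_measurable M" for n
    unfolding u_def using f_meas by (intro borel_measurable_diff borel_measurable_sum) auto
  have u_eq: "u n x = f x - (\<Sum>j<n. F (Suc j) x)" for n x
    unfolding u_def by (auto intro!: sum.reindex_bij_witness[of _ Suc "\<lambda>j. j - 1"])
  have u_le: "AE x in M. ennreal (norm (u n x) powr p) \<le> H x" for n
    using AE_H
  proof eventually_elim
    case (elim x)
    note s = key(1)[OF elim]
    have s': "summable (\<lambda>j. norm (F (Suc (j + n)) x))"
      using summable_ignore_initial_segment[OF s, of n] by simp
    have "u n x = (\<Sum>j. F (Suc (j + n)) x)"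
      using suminf_minus_initial_segment[OF summable_norm_cancel[OF s], of n] by (simp add: u_eq f_def)
    then have "norm (u n x) \<le> (\<Sum>j. norm (F (Suc (j + n)) x))"
      using summable_norm[OF s'] by simp
    also have "\<dots> \<le> (\<Sum>j. norm (F (Suc j) x))"
      using suminf_split_initial_segment[OF s, of n] by (simp add: sum_nonneg)
    finally have "norm (u n x) powr p \<le> (\<Sum>j. norm (F (Suc j) x)) powr p"
      using p by (intro powr_mono2) auto
    then show ?case using key(2)[OF elim] by (meson ennreal_leI order_trans)
  qed
  have u_lim: "AE x in M. (\<lambda>n. u n x) \<longlonglongrightarrow> 0"
    using AE_H
  proof eventually_elim
    case (elim x)
    have "(\<lambda>n. f x - (\<Sum>j<n. F (Suc j) x)) \<longlonglongrightarrow> f x - f x"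
      unfolding f_def by (intro tendsto_diff tendsto_const summable_LIMSEQ summable_norm_cancel[OF key(1)[OF elim]])
    then show ?case by (simp add: u_eq)
  qed
  note dom = Lp_dominated_convergence[OF p u_meas H_meas H_int u_le u_lim]
  show thesis
  proof
    show "f \<in> Lp_fun M p" using dom(1)[of 0] by (simp add: u_def)
    show "(\<lambda>n. Lp_norm M p (\<lambda>x. f x - (\<Sum>j=1..n. F j x))) \<longlonglongrightarrow> 0" using dom(2) by (simp add: u_def)
  qed
qed

section \<open>The synthesis operator\<close>

lemma wavelet_ivec:
  assumes "invertible b"
  shows "wavelet p a b \<eta> j k x =
    of_real (\<bar>det (a j)\<bar> powr (1 / p)) * \<eta> (b *v ((matrix_inv b ** a j) *v x - ivec k))"
  using matrix_inv_mult_vec[OF assms]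
  by (simp add: wavelet_def lattice_point_ivec matrix_vector_mult_diff_distrib
      matrix_vector_mul_assoc[symmetric])

lemma
  fixes b :: "real^'n^'n"
  assumes "invertible b" "invertible A"
  shows invertible_matrix_inv_mult: "invertible (matrix_inv b ** A)"
    and det_matrix_inv_mult: "det (matrix_inv b ** A) = det A / det b"
  using assms by (auto simp: invertible_det_nz det_mul det_matrix_inv)

lemma wavelet_measurable:
  assumes "invertible (a j)" "\<eta> \<in> borel_measurable lebesgue"
  shows "wavelet p a b \<eta> j k \<in> borel_measurable lebesgue"
  using borel_measurable_affine[OF assms, of "- lattice_point b k"]
  by (simp add: wavelet_def[abs_def])

lemma synthesis_level_measurable:
  assumes "invertible (a j)" "\<eta> \<in> borel_measurable lebesgue"
  shows "synthesis_level p a b \<eta> c j \<in> borel_measurable lebesgue"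
  unfolding synthesis_level_def[abs_def]
  using wavelet_measurable[of a j \<eta>, OF assms] by (intro borel_measurable_infsum) simp

text \<open>The factor \<open>|det b|\<close> normalises \<open>D\<close> to be a bound for the synthesis operator on every level.\<close>

definition has_periodic_majorant ::
    "real \<Rightarrow> real^'n^'n \<Rightarrow> (real^'n \<Rightarrow> real) \<Rightarrow> (real^'n \<Rightarrow> complex) \<Rightarrow> real \<Rightarrow> bool" where
  "has_periodic_majorant p b W \<eta> D \<longleftrightarrow>
     \<eta> \<in> borel_measurable lebesgue \<and> W \<in> borel_measurable lebesgue \<and> (\<forall>x k. W (x + ivec k) = W x) \<and>
     (AE x in lebesgue. (\<lambda>k. norm (\<eta> (b *v (x - ivec k)))) summable_on UNIV \<and>
        (\<Sum>\<^sub>\<infinity>k. norm (\<eta> (b *v (x - ivec k)))) \<le> W x) \<and>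
     0 \<le> D \<and>
     (\<integral>\<^sup>+x. norm (\<eta> (b *v x)) * W x powr (p - 1) \<partial>lebesgue) \<le> ennreal (D powr p / \<bar>det b\<bar>)"

text \<open>The substitution \<open>y = A *v x\<close> contributes \<open>1 / |det A|\<close>, and
  the wavelet normalisation contributes \<open>|det (a j)|\<close>. Their product is
  \<open>|det b|\<close>, which cancels the denominator in the majorant condition; this is why the
  same \<open>D\<close> works on every level.\<close>

lemma
  fixes a :: "nat \<Rightarrow> real^'n^'n" and b :: "real^'n^'n"
  assumes p: "1 \<le> p" and aj: "invertible (a j)" and b: "invertible b"
    and maj: "has_periodic_majorant p b W \<eta> D"
    and c: "c j \<in> Lp_fun (count_space UNIV) p"
  shows synthesis_level_summable:
      "AE x in lebesgue. (\<lambda>k. norm (c j k * wavelet p a b \<eta> j k x)) summable_on UNIV"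
    and synthesis_level_Lp: "synthesis_level p a b \<eta> c j \<in> Lp_fun lebesgue p"
    and synthesis_level_norm_le:
      "Lp_norm lebesgue p (synthesis_level p a b \<eta> c j) \<le> D * lp_norm p (c j)"
proof -
  define w where "w x = norm (\<eta> (b *v x))" for x
  define A where "A = matrix_inv b ** a j"
  define \<alpha> where "\<alpha> = \<bar>det (a j)\<bar> powr (1 / p)"
  define L where "L y = (\<Sum>\<^sub>\<infinity>k. norm (c j k) * w (y - ivec k))" for y
  note maj' = maj[unfolded has_periodic_majorant_def]
  have A: "invertible A" unfolding A_def by (rule invertible_matrix_inv_mult[OF b aj])
  have wm: "w \<in> borel_measurable lebesgue"
    using borel_measurable_affine[OF b, of \<eta> 0] maj' by (simp add: w_def[abs_def])
  have w0: "0 \<le> w x" for x by (simp add: w_def)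
  have Wm: "W \<in> borel_measurable lebesgue" and Wp: "\<And>x k. W (x + ivec k) = W x"
    and wW: "AE x in lebesgue. (\<lambda>k. w (x - ivec k)) summable_on UNIV \<and> (\<Sum>\<^sub>\<infinity>k. w (x - ivec k)) \<le> W x"
    and D: "0 \<le> D" and le: "(\<integral>\<^sup>+x. w x * W x powr (p - 1) \<partial>lebesgue) \<le> ennreal (D powr p / \<bar>det b\<bar>)"
    using maj' by (auto simp: w_def)
  have fin: "(\<integral>\<^sup>+x. w x * W x powr (p - 1) \<partial>lebesgue) < \<infinity>"
    using order.strict_trans1[OF le] by simp
  have cs: "(\<lambda>k. norm (c j k) powr p) summable_on UNIV" using c by (simp add: lp_summable_iff)
  note bound = lattice_sum_summable[OF p wm w0 Wm Wp wW cs norm_ge_zero fin]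
    lattice_sum_bound[OF p wm w0 Wm Wp wW cs norm_ge_zero fin]
  have norm_wavelet: "norm (c j k * wavelet p a b \<eta> j k x) = \<alpha> * (norm (c j k) * w (A *v x - ivec k))" for k x
    unfolding wavelet_ivec[OF b] by (simp add: norm_mult w_def A_def \<alpha>_def)
  have AE_sum: "AE x in lebesgue. (\<lambda>k. norm (c j k) * w (A *v x - ivec k)) summable_on UNIV"
    using AE_affine[OF A bound(1), of 0] by simp
  then show "AE x in lebesgue. (\<lambda>k. norm (c j k * wavelet p a b \<eta> j k x)) summable_on UNIV"
    unfolding norm_wavelet by eventually_elim (rule summable_on_cmult_right)
  have AE_le: "AE x in lebesgue. norm (synthesis_level p a b \<eta> c j x) \<le> \<alpha> * L (A *v x)"
    using AE_sum
  proof eventually_elim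
    case (elim x)
    have "(\<lambda>k. norm (c j k * wavelet p a b \<eta> j k x)) summable_on UNIV"
      unfolding norm_wavelet using elim by (rule summable_on_cmult_right)
    then have "norm (synthesis_level p a b \<eta> c j x) \<le> (\<Sum>\<^sub>\<infinity>k. norm (c j k * wavelet p a b \<eta> j k x))"
      unfolding synthesis_level_def by (rule norm_infsum_bound)
    also have "\<dots> = \<alpha> * L (A *v x)"
      unfolding norm_wavelet L_def using elim by (simp add: infsum_cmult_right)
    finally show ?case .
  qed
  have L0: "0 \<le> L y" for y unfolding L_def by (intro infsum_nonneg mult_nonneg_nonneg w0) auto
  have "(\<lambda>y. norm (c j k) * w (y - ivec k)) \<in> borel_measurable lebesgue" for k
    using borel_measurable_translate[OF wm, of "- ivec k"] by simp
  then have Lm: "L \<in> borel_measurable lebesgue"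
    unfolding L_def[abs_def] by (rule borel_measurable_infsum)
  have Lpm: "(\<lambda>y. ennreal (L y powr p)) \<in> borel_measurable lebesgue" using Lm by measurable
  have det: "ennreal \<bar>det (a j)\<bar> * ennreal (1 / \<bar>det A\<bar>) = ennreal \<bar>det b\<bar>"
    using aj b by (simp add: A_def det_matrix_inv_mult[OF b aj] invertible_det_nz flip: ennreal_mult)
  have alpha: "\<alpha> powr p = \<bar>det (a j)\<bar>" using p by (simp add: \<alpha>_def powr_powr)
  have "(\<integral>\<^sup>+x. ennreal (norm (synthesis_level p a b \<eta> c j x) powr p) \<partial>lebesgue)
      \<le> (\<integral>\<^sup>+x. ennreal \<bar>det (a j)\<bar> * ennreal (L (A *v x) powr p) \<partial>lebesgue)"
  proof (rule nn_integral_mono_AE)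
    show "AE x in lebesgue. ennreal (norm (synthesis_level p a b \<eta> c j x) powr p)
        \<le> ennreal \<bar>det (a j)\<bar> * ennreal (L (A *v x) powr p)"
      using AE_le
    proof eventually_elim
      case (elim x)
      have "norm (synthesis_level p a b \<eta> c j x) powr p \<le> (\<alpha> * L (A *v x)) powr p"
        using p elim by (intro powr_mono2) auto
      also have "\<dots> = \<bar>det (a j)\<bar> * L (A *v x) powr p"
        using L0 by (simp add: powr_mult alpha \<alpha>_def[symmetric])
      finally show ?case by (simp add: ennreal_leI flip: ennreal_mult)
    qed
  qed
  also have "\<dots> = ennreal \<bar>det (a j)\<bar> * (\<integral>\<^sup>+x. ennreal (L (A *v x) powr p) \<partial>lebesgue)"
    using borel_measurable_affine[OF A Lpm, of 0] by (intro nn_integral_cmult) simp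
  also have "(\<integral>\<^sup>+x. ennreal (L (A *v x) powr p) \<partial>lebesgue) =
      ennreal (1 / \<bar>det A\<bar>) * (\<integral>\<^sup>+x. ennreal (L x powr p) \<partial>lebesgue)"
    using nn_integral_affine[OF A Lpm, of 0] by simp
  also have "ennreal \<bar>det (a j)\<bar> * (ennreal (1 / \<bar>det A\<bar>) * (\<integral>\<^sup>+x. ennreal (L x powr p) \<partial>lebesgue))
      = ennreal \<bar>det b\<bar> * (\<integral>\<^sup>+x. ennreal (L x powr p) \<partial>lebesgue)"
    by (simp only: det flip: mult.assoc)
  also have "\<dots> \<le> ennreal \<bar>det b\<bar> * (ennreal (\<Sum>\<^sub>\<infinity>k. norm (c j k) powr p) * ennreal (D powr p / \<bar>det b\<bar>))"
    unfolding L_def by (intro mult_left_mono order_trans[OF bound(2) mult_left_mono[OF le]]) auto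
  also have "\<dots> = ennreal ((\<Sum>\<^sub>\<infinity>k. norm (c j k) powr p) * D powr p)"
    using b by (simp add: invertible_det_nz infsum_nonneg flip: ennreal_mult)
  also have "(\<Sum>\<^sub>\<infinity>k. norm (c j k) powr p) = lp_norm p (c j) powr p"
    using p by (simp add: lp_norm_def powr_powr infsum_nonneg)
  also have "\<dots> * D powr p = (D * lp_norm p (c j)) powr p"
    using D lp_norm_nonneg[of p "c j"] by (simp add: powr_mult)
  finally have main: "(\<integral>\<^sup>+x. ennreal (norm (synthesis_level p a b \<eta> c j x) powr p) \<partial>lebesgue)
      \<le> ennreal ((D * lp_norm p (c j)) powr p)" .
  have nonneg: "0 \<le> D * lp_norm p (c j)" using D lp_norm_nonneg[of p "c j"] by simp
  have meas: "synthesis_level p a b \<eta> c j \<in> borel_measurable lebesgue"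
    using maj' by (intro synthesis_level_measurable[where a=a and j=j, OF aj]) auto
  show "synthesis_level p a b \<eta> c j \<in> Lp_fun lebesgue p"
    "Lp_norm lebesgue p (synthesis_level p a b \<eta> c j) \<le> D * lp_norm p (c j)"
    using Lp_norm_leI[OF p nonneg meas main] by auto
qed

lemma synthesis_level_add_cmult:
  assumes "(\<lambda>k. norm (c j k * wavelet p a b \<eta> j k x)) summable_on UNIV"
    and "(\<lambda>k. norm (e j k * wavelet p a b \<eta> j k x)) summable_on UNIV"
  shows "synthesis_level p a b \<eta> (\<lambda>j k. c j k + z * e j k) j x =
    synthesis_level p a b \<eta> c j x + z * synthesis_level p a b \<eta> e j x"
  using infsum_add[OF abs_summable_summable[OF assms(1)]
      summable_on_cmult_right[OF abs_summable_summable[OF assms(2)], of z]]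
    infsum_cmult_right[OF abs_summable_summable[OF assms(2)], of z]
  by (simp add: synthesis_level_def distrib_right mult.assoc)

lemma synthesis_exists:
  fixes a :: "nat \<Rightarrow> real^'n^'n" and b :: "real^'n^'n"
  assumes p: "1 \<le> p" and a: "\<And>j. 0 < j \<Longrightarrow> invertible (a j)" and b: "invertible b"
    and maj: "has_periodic_majorant p b W \<psi> D"
    and c: "c \<in> l1lp p"
  obtains f where "synthesis_sums p a b \<psi> c f"
proof -
  have level: "AE x in lebesgue. (\<lambda>k. norm (c j k * wavelet p a b \<psi> j k x)) summable_on UNIV"
    "synthesis_level p a b \<psi> c j \<in> Lp_fun lebesgue p"
    "Lp_norm lebesgue p (synthesis_level p a b \<psi> c j) \<le> D * lp_norm p (c j)" if "0 < j" for j
    using synthesis_level_summable[where a=a and c=c and j=j, OF p a[OF that] b maj l1lp_D(2)[OF c that]]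
      synthesis_level_Lp[where a=a and c=c and j=j, OF p a[OF that] b maj l1lp_D(2)[OF c that]]
      synthesis_level_norm_le[where a=a and c=c and j=j, OF p a[OF that] b maj l1lp_D(2)[OF c that]] by auto
  have sum: "(\<lambda>j. Lp_norm lebesgue p (synthesis_level p a b \<psi> c j)) summable_on {0<..}"
  proof (rule summable_on_comparison_test)
    show "(\<lambda>j. D * lp_norm p (c j)) summable_on {0<..}"
      by (intro summable_on_cmult_right l1lp_D(3)[OF c])
  qed (use level in \<open>auto simp: Lp_norm_nonneg\<close>)
  obtain f where "f \<in> Lp_fun lebesgue p"
    "(\<lambda>n. Lp_norm lebesgue p (\<lambda>x. f x - (\<Sum>j=1..n. synthesis_level p a b \<psi> c j x))) \<longlonglongrightarrow> 0"
    using Lp_series_converges[OF p level(2) sum] by blast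
  then have "synthesis_sums p a b \<psi> c f"
    using sum level by (simp add: synthesis_sums_def)
  then show thesis by (rule that)
qed

text \<open>Two norm limits of the same partial sums differ on a null set only, and a change on a
  null set preserves being a limit. Hence the set of all limits is precisely one class.\<close>

lemma synthesis_in_Lp_space:
  assumes p: "1 \<le> p" and f: "synthesis_sums p a b \<psi> c f"
  shows "synthesis p a b \<psi> c \<in> Lp_space lebesgue p"
    and "synthesis p a b \<psi> c = Lp_eq lebesgue p `` {f}"
proof -
  have fL: "f \<in> Lp_fun lebesgue p" using f by (simp add: synthesis_sums_def)
  define s where "s n x = (\<Sum>j=1..n. synthesis_level p a b \<psi> c j x)" for n x
  have sL: "s n \<in> Lp_fun lebesgue p" for n
    unfolding s_def using f by (intro Lp_fun_sum[OF p]) (auto simp: synthesis_sums_def)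
  have iff: "synthesis_sums p a b \<psi> c g \<longleftrightarrow>
      g \<in> Lp_fun lebesgue p \<and> (\<lambda>n. Lp_norm lebesgue p (\<lambda>x. g x - s n x)) \<longlonglongrightarrow> 0" for g
    using f by (auto simp: synthesis_sums_def s_def)
  show eq: "synthesis p a b \<psi> c = Lp_eq lebesgue p `` {f}"
  proof (intro set_eqI iffI)
    fix g assume "g \<in> synthesis p a b \<psi> c"
    then have g: "g \<in> Lp_fun lebesgue p" "(\<lambda>n. Lp_norm lebesgue p (\<lambda>x. g x - s n x)) \<longlonglongrightarrow> 0"
      using iff by (auto simp: synthesis_def)
    have f': "(\<lambda>n. Lp_norm lebesgue p (\<lambda>x. f x - s n x)) \<longlonglongrightarrow> 0" using f iff by blast
    have "Lp_norm lebesgue p (\<lambda>x. f x - g x) \<le>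
        Lp_norm lebesgue p (\<lambda>x. f x - s n x) + Lp_norm lebesgue p (\<lambda>x. g x - s n x)" for n
      using Lp_norm_triangle[OF p Lp_fun_diff[OF p fL sL[of n]] Lp_fun_diff[OF p sL[of n] g(1)]]
      by (simp add: Lp_norm_minus_commute[of _ _ "s n" g])
    then have "Lp_norm lebesgue p (\<lambda>x. f x - g x) \<le> 0 + 0"
      by (intro LIMSEQ_le_const[OF tendsto_add[OF f' g(2)]]) auto
    then have "Lp_norm lebesgue p (\<lambda>x. f x - g x) = 0" by (simp add: Lp_norm_nonneg antisym)
    then show "g \<in> Lp_eq lebesgue p `` {f}"
      using Lp_norm_eq_0_iff[OF Lp_fun_diff[OF p fL g(1)]] fL g(1) by (simp add: Lp_eq_def)
  next
    fix g assume "g \<in> Lp_eq lebesgue p `` {f}"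
    then have g: "g \<in> Lp_fun lebesgue p" "AE x in lebesgue. f x = g x" by (auto simp: Lp_eq_def)
    have "Lp_norm lebesgue p (\<lambda>x. g x - s n x) = Lp_norm lebesgue p (\<lambda>x. f x - s n x)" for n
      using g fL sL[of n] by (intro Lp_norm_cong_AE) (auto simp: Lp_fun_def)
    then show "g \<in> synthesis p a b \<psi> c" using f g(1) iff by (simp add: synthesis_def)
  qed
  show "synthesis p a b \<psi> c \<in> Lp_space lebesgue p"
    unfolding eq Lp_space_def using fL by (rule quotientI)
qed

text \<open>Additivity of a level holds only where both series over \<open>k\<close> converge
  absolutely, since elsewhere \<open>infsum\<close> defaults to 0. The argument therefore runs
  through almost everywhere equalities, level by level and then for finitely many levels at
  once.\<close>

lemma synthesis_sums_add:
  assumes p: "1 \<le> p" and f: "synthesis_sums p a b \<psi> c f" and g: "synthesis_sums p a b \<psi> e g"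
    and m: "\<And>j. 0 < j \<Longrightarrow> synthesis_level p a b \<psi> (\<lambda>j k. c j k + e j k) j \<in> borel_measurable lebesgue"
  shows "synthesis_sums p a b \<psi> (\<lambda>j k. c j k + e j k) (\<lambda>x. f x + g x)"
proof -
  let ?ce = "\<lambda>j k. c j k + e j k"
  let ?C = "synthesis_level p a b \<psi> c" and ?E = "synthesis_level p a b \<psi> e"
    and ?S = "synthesis_level p a b \<psi> ?ce"
  note f' = f[unfolded synthesis_sums_def] and g' = g[unfolded synthesis_sums_def]
  have CL: "?C j \<in> Lp_fun lebesgue p" and EL: "?E j \<in> Lp_fun lebesgue p"
    and cs: "AE x in lebesgue. (\<lambda>k. norm (c j k * wavelet p a b \<psi> j k x)) summable_on UNIV"
    and es: "AE x in lebesgue. (\<lambda>k. norm (e j k * wavelet p a b \<psi> j k x)) summable_on UNIV"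
    if "0 < j" for j
    using f' g' that by auto
  have eq: "AE x in lebesgue. ?S j x = ?C j x + ?E j x" if "0 < j" for j
    using cs[OF that] es[OF that]
    by eventually_elim (use synthesis_level_add_cmult[of c j p a b \<psi> _ e 1] in simp)
  have abs: "AE x in lebesgue. (\<lambda>k. norm (?ce j k * wavelet p a b \<psi> j k x)) summable_on UNIV"
    if "0 < j" for j
    using cs[OF that] es[OF that]
  proof eventually_elim
    case (elim x)
    show ?case
      by (rule summable_on_comparison_test[OF summable_on_add[OF elim]])
        (auto simp: distrib_right norm_triangle_ineq)
  qed
  have add: "(\<lambda>x. ?C j x + ?E j x) \<in> Lp_fun lebesgue p" if "0 < j" for j
    using Lp_fun_add[OF p CL EL] that by simp
  have norm_eq: "Lp_norm lebesgue p (?S j) = Lp_norm lebesgue p (\<lambda>x. ?C j x + ?E j x)" if "0 < j" for j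
    using m[OF that] eq[OF that] add[OF that] by (intro Lp_norm_cong_AE) (auto simp: Lp_fun_def)
  have SL: "?S j \<in> Lp_fun lebesgue p" if "0 < j" for j
  proof -
    have "(\<integral>\<^sup>+x. ennreal (norm (?S j x) powr p) \<partial>lebesgue) =
        (\<integral>\<^sup>+x. ennreal (norm (?C j x + ?E j x) powr p) \<partial>lebesgue)"
      using eq[OF that] by (intro nn_integral_cong_AE) auto
    then show ?thesis using add[OF that] m[OF that] by (simp add: Lp_fun_iff_nn_integral)
  qed
  have sum: "(\<lambda>j. Lp_norm lebesgue p (?S j)) summable_on {0<..}"
  proof (rule summable_on_comparison_test)
    show "(\<lambda>j. Lp_norm lebesgue p (?C j) + Lp_norm lebesgue p (?E j)) summable_on {0<..}"
      using f' g' by (intro summable_on_add) auto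
  qed (use norm_eq Lp_norm_triangle[OF p CL EL] in \<open>auto simp: Lp_norm_nonneg\<close>)
  define s where "s n x = (\<Sum>j=1..n. ?C j x)" for n x
  define t where "t n x = (\<Sum>j=1..n. ?E j x)" for n x
  have sL: "s n \<in> Lp_fun lebesgue p" and tL: "t n \<in> Lp_fun lebesgue p" for n
    unfolding s_def t_def using CL EL by (auto intro!: Lp_fun_sum[OF p])
  have fL: "f \<in> Lp_fun lebesgue p" and gL: "g \<in> Lp_fun lebesgue p" using f' g' by auto
  have le: "Lp_norm lebesgue p (\<lambda>x. f x + g x - (\<Sum>j=1..n. ?S j x)) \<le>
      Lp_norm lebesgue p (\<lambda>x. f x - s n x) + Lp_norm lebesgue p (\<lambda>x. g x - t n x)" for n
  proof -
    have "AE x in lebesgue. \<forall>j\<in>{1..n}. ?S j x = ?C j x + ?E j x"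
      using eq by (intro AE_finite_allI) auto
    then have "AE x in lebesgue. f x + g x - (\<Sum>j=1..n. ?S j x) = (f x - s n x) + (g x - t n x)"
      by eventually_elim (simp add: s_def t_def sum.distrib)
    moreover have "(\<lambda>x. f x + g x - (\<Sum>j=1..n. ?S j x)) \<in> borel_measurable lebesgue"
      using fL gL m by (auto simp: Lp_fun_def intro!: borel_measurable_sum)
    moreover have "(\<lambda>x. (f x - s n x) + (g x - t n x)) \<in> borel_measurable lebesgue"
      using fL gL sL[of n] tL[of n] by (auto simp: Lp_fun_def)
    ultimately have "Lp_norm lebesgue p (\<lambda>x. f x + g x - (\<Sum>j=1..n. ?S j x)) =
        Lp_norm lebesgue p (\<lambda>x. (f x - s n x) + (g x - t n x))"
      by (intro Lp_norm_cong_AE)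
    also have "\<dots> \<le> Lp_norm lebesgue p (\<lambda>x. f x - s n x) + Lp_norm lebesgue p (\<lambda>x. g x - t n x)"
      by (rule Lp_norm_triangle[OF p Lp_fun_diff[OF p fL sL] Lp_fun_diff[OF p gL tL]])
    finally show ?thesis .
  qed
  have "(\<lambda>n. Lp_norm lebesgue p (\<lambda>x. f x - s n x) + Lp_norm lebesgue p (\<lambda>x. g x - t n x)) \<longlonglongrightarrow> 0"
    using f' g' unfolding s_def t_def by (intro tendsto_add_zero) auto
  then have "(\<lambda>n. Lp_norm lebesgue p (\<lambda>x. f x + g x - (\<Sum>j=1..n. ?S j x))) \<longlonglongrightarrow> 0"
    by (rule Lim_null_comparison[rotated])
      (use le in \<open>auto simp: Lp_norm_nonneg\<close>)
  then show ?thesis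
    using SL sum abs Lp_fun_add[OF p fL gL] by (simp add: synthesis_sums_def)
qed

section \<open>Density and weak convergence\<close>

lemma Lp_dense_bounded:
  fixes f :: "'a::euclidean_space \<Rightarrow> complex"
  assumes p: "1 \<le> p" and f: "f \<in> Lp_fun lebesgue p" and d: "0 < d"
  obtains h n where "h \<in> Lp_fun lebesgue p" "Lp_norm lebesgue p (\<lambda>x. f x - h x) < d"
    "\<And>x. norm (h x) \<le> real n" "\<And>x. real n < norm x \<Longrightarrow> h x = 0"
proof -
  define h where "h n x = (if norm x \<le> real n \<and> norm (f x) \<le> real n then f x else 0)" for n x
  have fm [measurable]: "f \<in> borel_measurable lebesgue" using f by (simp add: Lp_fun_def)
  have [measurable]: "(\<lambda>x::'a. norm x) \<in> borel_measurable lebesgue"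
    by (intro measurable_completion) simp
  have hm: "h n \<in> borel_measurable lebesgue" for n
    unfolding h_def[abs_def] by measurable
  define u where "u n x = f x - h n x" for n x
  have um: "u n \<in> borel_measurable lebesgue" for n
    unfolding u_def[abs_def] using hm by measurable
  have wm: "(\<lambda>x. ennreal (norm (f x) powr p)) \<in> borel_measurable lebesgue" by measurable
  have wf: "(\<integral>\<^sup>+x. ennreal (norm (f x) powr p) \<partial>lebesgue) < \<infinity>"
    using f by (simp add: Lp_fun_iff_nn_integral)
  have le: "AE x in lebesgue. ennreal (norm (u n x) powr p) \<le> ennreal (norm (f x) powr p)" for n
    using p by (intro AE_I2 ennreal_leI powr_mono2) (auto simp: u_def h_def)
  have lim: "AE x in lebesgue. (\<lambda>n. u n x) \<longlonglongrightarrow> 0"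
  proof (rule AE_I2)
    fix x
    obtain N :: nat where N: "max (norm x) (norm (f x)) \<le> real N" using real_arch_simple by blast
    have "u n x = 0" if "N \<le> n" for n
      using N that of_nat_mono[OF that, where 'a=real] by (simp add: u_def h_def)
    then show "(\<lambda>n. u n x) \<longlonglongrightarrow> 0"
      by (intro tendsto_eventually) (auto simp: eventually_sequentially)
  qed
  note dom = Lp_dominated_convergence[OF p um wm wf le lim]
  obtain n where n: "Lp_norm lebesgue p (u n) < d"
    using order_tendstoD(2)[OF dom(2) d] by (auto simp: eventually_sequentially)
  have "(\<lambda>x. f x - u n x) \<in> Lp_fun lebesgue p" by (rule Lp_fun_diff[OF p f dom(1)])
  then have "h n \<in> Lp_fun lebesgue p" by (simp add: u_def)
  then show thesis
    using that[of "h n" n] n by (auto simp: u_def[abs_def] h_def)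
qed

text \<open>Continuous functions converging almost everywhere to a bounded \<open>h\<close> need not
  be uniformly bounded or compactly supported. Projecting their values onto the ball
  \<open>K\<close> and multiplying by the cutoff \<open>\<kappa>\<close> repairs both without
  changing the limit: \<open>h\<close> has values in \<open>K\<close>, and \<open>\<kappa>\<close>
  is 1 wherever \<open>h\<close> can be nonzero. The result has a common integrable
  majorant.\<close>

lemma Lp_dense_continuous:
  fixes f :: "'a::euclidean_space \<Rightarrow> complex"
  assumes p: "1 \<le> p" and f: "f \<in> Lp_fun lebesgue p" and d: "0 < d"
  obtains g R where "g \<in> Lp_fun lebesgue p" "Lp_norm lebesgue p (\<lambda>x. f x - g x) < d"
    "continuous_on UNIV g" "\<And>x. R < norm x \<Longrightarrow> g x = 0"
proof -
  obtain h n where h: "h \<in> Lp_fun lebesgue p" "Lp_norm lebesgue p (\<lambda>x. f x - h x) < d / 2"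
    and h_le: "\<And>x. norm (h x) \<le> real n" and h_0: "\<And>x. real n < norm x \<Longrightarrow> h x = 0"
    using Lp_dense_bounded[OF p f, of "d / 2"] d by auto
  have hm: "h \<in> borel_measurable lebesgue" using h by (simp add: Lp_fun_def)
  then have "h measurable_on UNIV"
    using measurable_on_iff_borel_measurable[of UNIV h] by simp
  then obtain N g where N: "negligible N" and g: "\<And>m. continuous_on UNIV (g m)"
    and g_lim: "\<And>x. x \<notin> N \<Longrightarrow> (\<lambda>m. g m x) \<longlonglongrightarrow> h x"
    by (auto simp: measurable_on_def)
  define K where "K = cball (0::complex) (real n)"
  have K: "closed K" "convex K" "K \<noteq> {}" by (auto simp: K_def)
  define \<kappa> where "\<kappa> x = max 0 (min 1 (real n + 1 - norm x))" for x :: 'a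
  define v where "v m x = complex_of_real (\<kappa> x) * closest_point K (g m x)" for m x
  have cp: "norm (closest_point K z) \<le> real n" for z
    using closest_point_in_set[OF K(1,3), of z] by (simp add: K_def)
  have \<kappa>: "0 \<le> \<kappa> x" "\<kappa> x \<le> 1" for x by (auto simp: \<kappa>_def)
  have v_le: "norm (v m x) \<le> real n" for m x
    using mult_mono[OF \<kappa>(2)[of x] cp[of "g m x"]] \<kappa>(1)[of x] by (simp add: v_def norm_mult)
  have v_0: "v m x = 0" if "real n + 1 < norm x" for m x
    using that by (simp add: v_def \<kappa>_def)
  have v_cont: "continuous_on UNIV (v m)" for m
    unfolding v_def[abs_def] \<kappa>_def
    by (intro continuous_intros continuous_on_compose2[OF continuous_on_closest_point[OF K(2,1,3), of UNIV] g]) auto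
  have vm: "v m \<in> borel_measurable lebesgue" for m
    using borel_measurable_continuous_onI[OF v_cont[of m]] by (intro measurable_completion) simp
  define u where "u m x = h x - v m x" for m x
  have um: "u m \<in> borel_measurable lebesgue" for m
    unfolding u_def[abs_def] using hm vm by measurable
  define w :: "'a \<Rightarrow> ennreal" where "w x = ennreal ((2 * real n) powr p) * indicator (cball 0 (real n + 1)) x" for x
  have wm: "w \<in> borel_measurable lebesgue"
    unfolding w_def[abs_def]
    by (intro borel_measurable_times_ennreal borel_measurable_const borel_measurable_indicator) simp
  have wf: "(\<integral>\<^sup>+x. w x \<partial>lebesgue) < \<infinity>"
    unfolding w_def using emeasure_lborel_cball_finite[of "0::'a" "real n + 1"]
    by (simp add: nn_integral_cmult_indicator ennreal_mult_less_top)
  have le: "AE x in lebesgue. ennreal (norm (u m x) powr p) \<le> w x" for m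
  proof (rule AE_I2)
    fix x
    show "ennreal (norm (u m x) powr p) \<le> w x"
    proof (cases "norm x \<le> real n + 1")
      case True
      have "norm (u m x) \<le> norm (h x) + norm (v m x)" unfolding u_def by (rule norm_triangle_ineq4)
      also have "\<dots> \<le> 2 * real n" using h_le[of x] v_le[of m x] by simp
      finally have "norm (u m x) powr p \<le> (2 * real n) powr p"
        using p by (intro powr_mono2) auto
      then show ?thesis using True by (simp add: w_def ennreal_leI)
    next
      case False
      then show ?thesis using h_0[of x] v_0[of x m] by (simp add: u_def)
    qed
  qed
  have lim_N: "(\<lambda>m. u m x) \<longlonglongrightarrow> 0" if x: "x \<notin> N" for x
  proof -
    have "h x \<in> K" using h_le[of x] by (simp add: K_def)
    then have "(\<lambda>m. closest_point K (g m x)) \<longlonglongrightarrow> h x"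
      using isCont_tendsto_compose[OF _ g_lim[OF x], of "closest_point K"]
        continuous_at_closest_point[OF K(2,1,3)] by (simp add: closest_point_self)
    then have "(\<lambda>m. h x - complex_of_real (\<kappa> x) * closest_point K (g m x)) \<longlonglongrightarrow>
        h x - complex_of_real (\<kappa> x) * h x"
      by (intro tendsto_intros)
    moreover have "complex_of_real (\<kappa> x) * h x = h x"
      using h_0[of x] by (cases "norm x \<le> real n") (auto simp: \<kappa>_def)
    ultimately show ?thesis by (simp add: u_def v_def)
  qed
  have "AE x in lebesgue. x \<notin> N"
    using N by (simp add: negligible_iff_null_sets AE_not_in)
  then have lim: "AE x in lebesgue. (\<lambda>m. u m x) \<longlonglongrightarrow> 0"
    by eventually_elim (rule lim_N)
  note dom = Lp_dominated_convergence[OF p um wm wf le lim]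
  obtain m where m: "Lp_norm lebesgue p (u m) < d / 2"
    using order_tendstoD(2)[OF dom(2), of "d / 2"] d by (auto simp: eventually_sequentially)
  have vL: "v m \<in> Lp_fun lebesgue p"
    using Lp_fun_diff[OF p h(1) dom(1)[of m]] by (simp add: u_def)
  have "Lp_norm lebesgue p (\<lambda>x. f x - v m x) \<le>
      Lp_norm lebesgue p (\<lambda>x. f x - h x) + Lp_norm lebesgue p (u m)"
    using Lp_norm_triangle[OF p Lp_fun_diff[OF p f h(1)] dom(1)[of m]] by (simp add: u_def[abs_def])
  then have "Lp_norm lebesgue p (\<lambda>x. f x - v m x) < d" using m h(2) by simp
  then show thesis
    using that[OF vL _ v_cont[of m], of "real n + 1"] v_0 by blast
qed

text \<open>Uniform continuity is available on the ball of radius \<open>R + 1\<close>. The cap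
  \<open>d \<le> 1\<close> handles the rest: if one of two such close points leaves that ball, both
  lie where \<open>h\<close> vanishes.\<close>

lemma compact_support_uniformly_continuous:
  fixes h :: "'a::euclidean_space \<Rightarrow> 'b::real_normed_vector"
  assumes h: "continuous_on UNIV h" "\<And>x. R < norm x \<Longrightarrow> h x = 0" and e: "0 < e"
  obtains d where "0 < d" "d \<le> 1" "\<And>x y. norm (x - y) < d \<Longrightarrow> norm (h x - h y) < e"
proof -
  have "uniformly_continuous_on (cball 0 (R + 1)) h"
    by (intro compact_uniformly_continuous continuous_on_subset[OF h(1)]) auto
  then obtain d where d: "0 < d"
    "\<And>x y. x \<in> cball 0 (R + 1) \<Longrightarrow> y \<in> cball 0 (R + 1) \<Longrightarrow> dist y x < d \<Longrightarrow> dist (h y) (h x) < e"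
    using e unfolding uniformly_continuous_on_def by metis
  have "norm (h x - h y) < e" if xy: "norm (x - y) < min d 1" for x y
  proof (cases "norm x \<le> R + 1 \<and> norm y \<le> R + 1")
    case True
    then show ?thesis using d(2)[of y x] xy by (simp add: dist_norm)
  next
    case False
    have "norm x \<le> norm y + norm (x - y)" "norm y \<le> norm x + norm (x - y)"
      using norm_triangle_sub[of x y] norm_triangle_sub[of y x] by (simp_all add: norm_minus_commute)
    then have "R < norm x" "R < norm y" using False xy by auto
    then show ?thesis using h(2) e by simp
  qed
  then show thesis using that[of "min d 1"] d(1) by auto
qed

text \<open>The inverse dilation shrinks a distance of at most \<open>r\<close> in dilated
  coordinates to at most its operator norm times \<open>r\<close>, uniformly in the point. The
  second conclusion, distance below 1, serves to confine errors to a slightly larger ball. Dividing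
  by \<open>r + 1\<close> avoids the case \<open>r = 0\<close>.\<close>

lemma sampling_uniform:
  fixes A :: "nat \<Rightarrow> real^'n^'n" and h :: "real^'n \<Rightarrow> 'b::real_normed_vector"
  assumes A: "\<And>j. 0 < j \<Longrightarrow> invertible (A j)"
    and lim: "(\<lambda>j. onorm (\<lambda>x. matrix_inv (A j) *v x)) \<longlonglongrightarrow> 0"
    and h: "continuous_on UNIV h" "\<And>x. R < norm x \<Longrightarrow> h x = 0" and e: "0 < e" and r: "0 \<le> r"
  shows "eventually (\<lambda>j. 0 < j \<and> (\<forall>x y. norm (A j *v x - y) \<le> r \<longrightarrow>
    norm (h x - h (matrix_inv (A j) *v y)) < e \<and> norm (x - matrix_inv (A j) *v y) < 1)) sequentially"
proof -
  obtain d where d: "0 < d" "d \<le> 1" "\<And>x y. norm (x - y) < d \<Longrightarrow> norm (h x - h y) < e"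
    using compact_support_uniformly_continuous[OF h e] by blast
  have "eventually (\<lambda>j. onorm (\<lambda>x. matrix_inv (A j) *v x) < d / (r + 1)) sequentially"
    using d r by (intro order_tendstoD(2)[OF lim]) auto
  then show ?thesis
    using eventually_gt_at_top[of 0]
  proof eventually_elim
    case (elim j)
    have "norm (x - matrix_inv (A j) *v y) < d" if xy: "norm (A j *v x - y) \<le> r" for x y
    proof -
      have "x - matrix_inv (A j) *v y = matrix_inv (A j) *v (A j *v x - y)"
        by (simp add: matrix_vector_mult_diff_distrib matrix_inv_mult_vec[OF A[OF elim(2)]])
      then have "norm (x - matrix_inv (A j) *v y) \<le>
          onorm (\<lambda>x. matrix_inv (A j) *v x) * norm (A j *v x - y)"
        using onorm[OF matrix_vector_mul_bounded_linear[of "matrix_inv (A j)"]] by simp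
      also have "\<dots> \<le> onorm (\<lambda>x. matrix_inv (A j) *v x) * (r + 1)"
        using xy onorm_pos_le[OF matrix_vector_mul_bounded_linear[of "matrix_inv (A j)"]]
        by (intro mult_left_mono) auto
      also have "\<dots> < d" using elim(1) r by (simp add: field_simps)
      finally show ?thesis .
    qed
    then show ?case using d elim(2) by force
  qed
qed

lemma measurable_vfloor: "vfloor \<in> borel \<rightarrow>\<^sub>M count_space UNIV"
proof (intro measurable_count_space_eq2_countable[THEN iffD2] conjI ballI)
  fix k :: "int^'n"
  have "vfloor -` {k} = {x. x - ivec k \<in> ucube}"
    by (auto simp: diff_ivec_in_ucube_iff)
  also have "\<dots> = (\<lambda>x. x - ivec k) -` ucube \<inter> space borel" by auto
  also have "\<dots> \<in> sets borel" by (intro measurable_sets[OF _ ucube_borel]) simp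
  finally show "vfloor -` {k} \<inter> space borel \<in> sets borel" by simp
qed simp

text \<open>On the cell of index \<open>k\<close> the first factor is the constant
  \<open>H k\<close>, and the periodic second factor has mean 0 over every cell.\<close>

lemma integral_vfloor_mult_eq_0:
  fixes g :: "real^'n \<Rightarrow> complex" and H :: "int^'n \<Rightarrow> complex"
  assumes int: "integrable lebesgue (\<lambda>y. H (vfloor y) * g y)"
    and g: "\<And>x k. g (x + ivec k) = g x" "(\<integral>x. indicator ucube x *\<^sub>R g x \<partial>lebesgue) = 0"
  shows "(\<integral>y. H (vfloor y) * g y \<partial>lebesgue) = 0"
proof -
  have "(\<integral>y. H (vfloor y) * g y \<partial>lebesgue) =
      (\<Sum>\<^sub>\<infinity>k. \<integral>x. indicator ucube x *\<^sub>R (H (vfloor (x + ivec k)) * g (x + ivec k)) \<partial>lebesgue)"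
    by (rule integral_tiling(1)[OF int])
  also have "\<dots> = (\<Sum>\<^sub>\<infinity>k. H k * (\<integral>x. indicator ucube x *\<^sub>R g x \<partial>lebesgue))"
  proof (rule infsum_cong)
    fix k :: "int^'n"
    have "(\<integral>x. indicator ucube x *\<^sub>R (H (vfloor (x + ivec k)) * g (x + ivec k)) \<partial>lebesgue) =
        (\<integral>x. H k * (indicator ucube x *\<^sub>R g x) \<partial>lebesgue)"
      by (intro Bochner_Integration.integral_cong refl)
        (auto simp: indicator_def vfloor_add_ivec g(1))
    also have "\<dots> = H k * (\<integral>x. indicator ucube x *\<^sub>R g x \<partial>lebesgue)"
      by (rule integral_mult_right_zero)
    finally show "(\<integral>x. indicator ucube x *\<^sub>R (H (vfloor (x + ivec k)) * g (x + ivec k)) \<partial>lebesgue) =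
        H k * (\<integral>x. indicator ucube x *\<^sub>R g x \<partial>lebesgue)" .
  qed
  finally show ?thesis by (simp add: g(2))
qed

lemma integrable_mult_bounded:
  fixes f g :: "'a \<Rightarrow> complex"
  assumes f: "integrable M f" and g: "g \<in> borel_measurable M" "\<And>x. norm (g x) \<le> C"
  shows "integrable M (\<lambda>x. f x * g x)"
proof (rule Bochner_Integration.integrable_bound)
  show "integrable M (\<lambda>x. norm (f x) * C)" using f by simp
  show "(\<lambda>x. f x * g x) \<in> borel_measurable M" using f g(1) by measurable
  have "norm (f x) * norm (g x) \<le> norm (norm (f x) * C)" for x
    by (rule order_trans[OF mult_left_mono[OF g(2)]]) auto
  then show "AE x in M. norm (f x * g x) \<le> norm (norm (f x) * C)" by (simp add: norm_mult)
qed

text \<open>On each cell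
  \<open>A\<^sub>j\<^sup>-\<^sup>1(k + [0,1)\<^sup>n)\<close> the factor \<open>g(A\<^sub>j x)\<close> is orthogonal to constants, and \<open>h\<close> is almost constant there.\<close>

lemma weak_convergence_oscillating:
  fixes A :: "nat \<Rightarrow> real^'n^'n" and g h :: "real^'n \<Rightarrow> complex"
  assumes A: "\<And>j. 0 < j \<Longrightarrow> invertible (A j)"
    and lim: "(\<lambda>j. onorm (\<lambda>x. matrix_inv (A j) *v x)) \<longlonglongrightarrow> 0"
    and g: "g \<in> borel_measurable lebesgue" "\<And>x. norm (g x) \<le> M" "\<And>x k. g (x + ivec k) = g x"
      "(\<integral>x. indicator ucube x *\<^sub>R g x \<partial>lebesgue) = 0"
    and h: "integrable lebesgue h"
  shows "(\<lambda>j. \<integral>x. h x * g (A j *v x) \<partial>lebesgue) \<longlonglongrightarrow> 0"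
proof (rule LIMSEQ_I)
  fix e :: real assume e: "0 < e"
  have M0: "0 \<le> M" using g(2)[of 0] norm_ge_zero[of "g 0"] by linarith
  \<comment> \<open>Two error terms will arise, each at most \<open>M * d\<close>; the
    \<open>+ 1\<close> guards against division by zero and makes their sum strictly smaller than
    \<open>e\<close>.\<close>
  define d where "d = e / (2 * (M + 1))"
  have d: "0 < d" using e M0 by (simp add: d_def)
  have hL: "h \<in> Lp_fun lebesgue 1" using h by (simp add: Lp_fun_def)
  obtain h0 R where h0: "h0 \<in> Lp_fun lebesgue 1" "Lp_norm lebesgue 1 (\<lambda>x. h x - h0 x) < d"
    "continuous_on UNIV h0" and h0_0: "\<And>x. R < norm x \<Longrightarrow> h0 x = 0"
    using Lp_dense_continuous[OF order_refl hL d] by blast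
  have h0i: "integrable lebesgue h0" using h0(1) integrable_norm_iff[of h0 lebesgue] by (simp add: Lp_fun_def)
  define V where "V = measure lebesgue (cball (0::real^'n) (R + 1))"
  \<comment> \<open>A pointwise error \<open>e'\<close> on a ball of measure \<open>V\<close>
    integrates to at most \<open>d\<close>.\<close>
  define e' where "e' = d / (V + 1)"
  have e': "0 < e'" "0 \<le> V" using d by (simp_all add: e'_def V_def add_nonneg_pos)
  have ev: "eventually (\<lambda>j. 0 < j \<and> (\<forall>x y. norm (A j *v x - y) \<le> real CARD('n) \<longrightarrow>
    norm (h0 x - h0 (matrix_inv (A j) *v y)) < e' \<and> norm (x - matrix_inv (A j) *v y) < 1)) sequentially"
    by (rule sampling_uniform[OF A lim h0(3) h0_0 e'(1)]) auto
  have "eventually (\<lambda>j. norm (\<integral>x. h x * g (A j *v x) \<partial>lebesgue) < e) sequentially"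
    using ev
  proof eventually_elim
    case (elim j)
    then have j: "0 < j" by simp
    note Aj = A[OF j]
    \<comment> \<open>\<open>h0\<close> frozen at the corner of the dilated cell that contains
      \<open>x\<close>: constant on cells, hence orthogonal to the oscillating factor.\<close>
    define hj where "hj x = h0 (matrix_inv (A j) *v ivec (vfloor (A j *v x)))" for x
    have gm: "(\<lambda>x. g (A j *v x)) \<in> borel_measurable lebesgue"
      using borel_measurable_affine[OF Aj g(1), of 0] by simp
    have close: "norm (h0 x - hj x) < e'" "norm (x - matrix_inv (A j) *v ivec (vfloor (A j *v x))) < 1" for x
      using elim norm_diff_ivec_vfloor[of "A j *v x"] by (auto simp: hj_def)
    have diff0: "h0 x - hj x = 0" if "R + 1 < norm x" for x
    proof -
      let ?y = "matrix_inv (A j) *v ivec (vfloor (A j *v x))"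
      have "norm x \<le> norm ?y + norm (x - ?y)" using norm_triangle_sub[of x ?y] by simp
      then have "R < norm ?y" "R < norm x" using close(2)[of x] that by linarith+
      then show ?thesis by (simp add: hj_def h0_0)
    qed
    have Hm: "(\<lambda>y. h0 (matrix_inv (A j) *v ivec (vfloor y))) \<in> borel_measurable lebesgue"
      using measurable_compose[OF measurable_vfloor, of "\<lambda>k. h0 (matrix_inv (A j) *v ivec k)" borel]
      by (intro measurable_completion) simp
    have hjm: "hj \<in> borel_measurable lebesgue"
      using borel_measurable_affine[OF Aj Hm, of 0] by (simp add: hj_def[abs_def])
    have bnd: "norm ((h0 x - hj x) * g (A j *v x)) \<le> e' * M * indicator (cball 0 (R + 1)) x" for x
    proof (cases "norm x \<le> R + 1")
      case True
      have "norm (h0 x - hj x) * norm (g (A j *v x)) \<le> e' * M"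
        using close(1)[of x] g(2) e' by (intro mult_mono) auto
      then show ?thesis using True by (simp add: norm_mult)
    next
      case False
      then show ?thesis using diff0[of x] by simp
    qed
    have ind: "integrable lebesgue (\<lambda>x::real^'n. e' * M * indicator (cball 0 (R + 1)) x)"
      using emeasure_lborel_cball_finite[of "0::real^'n" "R + 1"]
      by (intro integrable_mult_right integrable_real_indicator) auto
    have int1: "integrable lebesgue (\<lambda>x. (h0 x - hj x) * g (A j *v x))"
    proof (rule Bochner_Integration.integrable_bound[OF ind])
      show "(\<lambda>x. (h0 x - hj x) * g (A j *v x)) \<in> borel_measurable lebesgue"
        using hjm gm borel_measurable_integrable[OF h0i] by measurable
    qed (use bnd in \<open>auto intro!: AE_I2 order_trans[OF bnd]\<close>)
    note mult_g = integrable_mult_bounded[OF _ gm g(2)]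
    have int2: "integrable lebesgue (\<lambda>x. (h x - h0 x) * g (A j *v x))"
      and int3: "integrable lebesgue (\<lambda>x. h x * g (A j *v x))"
      by (intro mult_g Bochner_Integration.integrable_diff h h0i)+
    have int4: "integrable lebesgue (\<lambda>x. hj x * g (A j *v x))"
      using Bochner_Integration.integrable_diff[OF int3 Bochner_Integration.integrable_add[OF int1 int2]]
      by (simp add: algebra_simps)
    have zero: "(\<integral>x. hj x * g (A j *v x) \<partial>lebesgue) = 0"
    proof -
      let ?F = "\<lambda>y. h0 (matrix_inv (A j) *v ivec (vfloor y)) * g y"
      have Fm: "?F \<in> borel_measurable lebesgue" using Hm g(1) by measurable
      have inv: "invertible (matrix_inv (A j))"
        using Aj by (simp add: invertible_det_nz det_matrix_inv)
      have "integrable lebesgue ?F"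
        using integrable_affine[OF inv int4, of 0]
        by (simp add: hj_def matrix_inv_mult_vec[OF Aj])
      then have "(\<integral>y. ?F y \<partial>lebesgue) = 0"
        by (rule integral_vfloor_mult_eq_0[OF _ g(3,4)])
      then show ?thesis using integral_affine[OF Aj Fm, of 0] by (simp add: hj_def)
    qed
    have "(\<integral>x. h x * g (A j *v x) \<partial>lebesgue) =
        (\<integral>x. (h x - h0 x) * g (A j *v x) + ((h0 x - hj x) * g (A j *v x) + hj x * g (A j *v x)) \<partial>lebesgue)"
      by (simp add: algebra_simps)
    also have "\<dots> = (\<integral>x. (h x - h0 x) * g (A j *v x) \<partial>lebesgue) + (\<integral>x. (h0 x - hj x) * g (A j *v x) \<partial>lebesgue)"
      using int1 int2 int4 zero
      by (subst Bochner_Integration.integral_add) (auto intro: Bochner_Integration.integrable_add)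
    finally have "norm (\<integral>x. h x * g (A j *v x) \<partial>lebesgue) \<le>
        norm (\<integral>x. (h x - h0 x) * g (A j *v x) \<partial>lebesgue) + norm (\<integral>x. (h0 x - hj x) * g (A j *v x) \<partial>lebesgue)"
      by (simp add: norm_triangle_ineq)
    moreover have "norm (\<integral>x. (h x - h0 x) * g (A j *v x) \<partial>lebesgue) \<le> (\<integral>x. M * norm (h x - h0 x) \<partial>lebesgue)"
    proof (rule Bochner_Integration.integral_norm_bound_integral[OF int2])
      fix x
      show "norm ((h x - h0 x) * g (A j *v x)) \<le> M * norm (h x - h0 x)"
        by (subst norm_mult, subst mult.commute, rule mult_right_mono[OF g(2) norm_ge_zero])
    qed (use h h0i in simp)
    moreover have "(\<integral>x. M * norm (h x - h0 x) \<partial>lebesgue) \<le> M * d"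
    proof -
      have "(\<integral>x. norm (h x - h0 x) \<partial>lebesgue) \<le> d" using h0(2) by (simp add: Lp_norm_def)
      then show ?thesis using M0 by (simp add: mult_left_mono)
    qed
    moreover have "norm (\<integral>x. (h0 x - hj x) * g (A j *v x) \<partial>lebesgue) \<le>
        (\<integral>x. e' * M * indicator (cball (0::real^'n) (R + 1)) x \<partial>lebesgue)"
      by (intro Bochner_Integration.integral_norm_bound_integral int1 ind bnd)
    moreover have "(\<integral>x. e' * M * indicator (cball (0::real^'n) (R + 1)) x \<partial>lebesgue) \<le> d * M"
    proof -
      have "(\<integral>x. e' * M * indicator (cball (0::real^'n) (R + 1)) x \<partial>lebesgue) = (e' * V) * M"
        by (simp add: V_def)
      also have "e' * V \<le> d" using e' d by (simp add: e'_def field_simps)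
      finally show ?thesis using M0 by (simp add: mult_right_mono)
    qed
    moreover have "2 * (M + 1) * d = e" using M0 by (simp add: d_def)
    then have "M * d + d * M < e" using d by (simp add: algebra_simps)
    ultimately show ?case by linarith
  qed
  then show "\<exists>no. \<forall>n\<ge>no. norm ((\<integral>x. h x * g (A n *v x) \<partial>lebesgue) - 0) < e"
    by (simp add: eventually_sequentially)
qed

section \<open>Analysis by cell averages\<close>

text \<open>Averages over cells, rather than point samples, make the bound \<open>analysis_norm_le\<close> hold exactly
  and for every \<open>f\<close> in \<open>L\<^sup>p\<close>.\<close>

definition cell_mean :: "real^'n^'n \<Rightarrow> (real^'n \<Rightarrow> complex) \<Rightarrow> int^'n \<Rightarrow> complex" where
  "cell_mean A f k = (\<integral>s. indicator ucube s *\<^sub>R f (matrix_inv A *v (s + ivec k)) \<partial>lebesgue)"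

text \<open>The power of \<open>|det (a j)|\<close> undoes the normalisation of the wavelets, and
  \<open>|det b|\<close> completes the lattice sum of the generator to its periodization, whose mean
  is the integral of the generator.\<close>

definition analysis :: "real \<Rightarrow> (nat \<Rightarrow> real^'n^'n) \<Rightarrow> real^'n^'n \<Rightarrow> (real^'n \<Rightarrow> complex) \<Rightarrow>
    nat \<Rightarrow> int^'n \<Rightarrow> complex" where
  "analysis p a b f j k =
     of_real (\<bar>det b\<bar> * \<bar>det (a j)\<bar> powr (- (1 / p))) * cell_mean (matrix_inv b ** a j) f k"

lemma invertible_matrix_inv: "invertible A \<Longrightarrow> invertible (matrix_inv (A :: real^'n^'n))"
  by (simp add: invertible_det_nz det_matrix_inv)

lemma content_ucube [simp]: "measure lborel (ucube :: (real^'n) set) = 1"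
  using emeasure_ucube by (simp add: measure_def)

lemma integral_ucube: "(\<integral>s. indicator ucube s \<partial>(lebesgue :: (real^'n) measure)) = (1::real)"
  by simp

lemma integrable_ucube: "integrable lebesgue (indicator ucube :: real^'n \<Rightarrow> real)"
  by (intro integrable_real_indicator) (simp_all add: emeasure_ucube)

text \<open>Jensen on the unit cell, which has mass 1, bounds each mean by the share of its cell in
  the integral of the p-th power; by tiling the shares add up to the whole, and the substitution
  accounts for \<open>|det A|\<close>.\<close>

lemma
  fixes A :: "real^'n^'n"
  assumes p: "1 \<le> p" and A: "invertible A" and f: "f \<in> Lp_fun lebesgue p"
  shows cell_integrable: "integrable lebesgue (\<lambda>s. indicator ucube s *\<^sub>R f (matrix_inv A *v (s + ivec k)))"
    and cell_mean_sum_le: "(\<integral>\<^sup>+k. ennreal (norm (cell_mean A f k) powr p) \<partial>count_space UNIV) \<le>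
      ennreal (\<bar>det A\<bar> * Lp_norm lebesgue p f powr p)"
proof -
  note iA = invertible_matrix_inv[OF A]
  have fm: "f \<in> borel_measurable lebesgue" using f by (simp add: Lp_fun_def)
  define F where "F y = ennreal (norm (f (matrix_inv A *v y)) powr p)" for y
  have fA: "(\<lambda>y. f (matrix_inv A *v y)) \<in> borel_measurable lebesgue"
    using borel_measurable_affine[OF iA fm, of 0] by simp
  have Fm: "F \<in> borel_measurable lebesgue" unfolding F_def[abs_def] using fA by measurable
  have det: "1 / \<bar>det (matrix_inv A)\<bar> = \<bar>det A\<bar>"
    using A by (simp add: det_matrix_inv)
  have "(\<lambda>x. ennreal (norm (f x) powr p)) \<in> borel_measurable lebesgue" using fm by measurable
  from nn_integral_affine[OF iA this, of 0]
  have F_int: "(\<integral>\<^sup>+y. F y \<partial>lebesgue) = ennreal (\<bar>det A\<bar> * Lp_norm lebesgue p f powr p)"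
    unfolding F_def by (simp add: det nn_integral_Lp_norm[OF p f] ennreal_mult)
  have tile: "(\<integral>\<^sup>+y. F y \<partial>lebesgue) =
      (\<integral>\<^sup>+k. \<integral>\<^sup>+s. indicator ucube s * F (s + ivec k) \<partial>lebesgue \<partial>count_space UNIV)"
    by (rule nn_integral_tiling[OF Fm])
  have cell: "integrable lebesgue (\<lambda>s. indicator ucube s *\<^sub>R f (matrix_inv A *v (s + ivec k))) \<and>
    ennreal (norm (cell_mean A f k) powr p) \<le> (\<integral>\<^sup>+s. indicator ucube s * F (s + ivec k) \<partial>lebesgue)" for k
  proof -
    define u where "u s = norm (f (matrix_inv A *v (s + ivec k)))" for s
    have fs: "(\<lambda>s. f (matrix_inv A *v (s + ivec k))) \<in> borel_measurable lebesgue"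
      using borel_measurable_translate[OF fA, of "ivec k"] by simp
    then have um: "u \<in> borel_measurable lebesgue" unfolding u_def[abs_def] by measurable
    have uF: "ennreal (u s powr p * indicator ucube s) = indicator ucube s * F (s + ivec k)" for s
      by (simp add: u_def F_def indicator_def)
    have "(\<integral>\<^sup>+s. indicator ucube s * F (s + ivec k) \<partial>lebesgue) \<le> (\<integral>\<^sup>+s. F (s + ivec k) \<partial>lebesgue)"
      by (intro nn_integral_mono) (auto simp: indicator_def)
    also have "\<dots> = (\<integral>\<^sup>+y. F y \<partial>lebesgue)" using nn_integral_translate[OF Fm] by simp
    also have "\<dots> < \<infinity>" by (simp add: F_int)
    finally have "(\<integral>\<^sup>+s. ennreal (u s powr p * indicator ucube s) \<partial>lebesgue) < \<infinity>"
      unfolding uF .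
    then have ui: "integrable lebesgue (\<lambda>s. u s powr p * indicator ucube s)"
      using um by (simp add: integrable_iff_bounded)
    note jensen = weighted_integrable[OF p integrable_ucube indicator_pos_le um _ ui]
      weighted_jensen[OF p integrable_ucube indicator_pos_le um _ ui]
    have u0: "0 \<le> u s" for s by (simp add: u_def)
    have int: "integrable lebesgue (\<lambda>s. indicator ucube s *\<^sub>R f (matrix_inv A *v (s + ivec k)))"
      by (rule Bochner_Integration.integrable_bound[OF jensen(1)])
        (use fs u0 in \<open>auto simp: u_def intro!: AE_I2\<close>)
    have "norm (cell_mean A f k) \<le> (\<integral>s. u s * indicator ucube s \<partial>lebesgue)"
      unfolding cell_mean_def
      by (rule Bochner_Integration.integral_norm_bound_integral[OF int jensen(1)]) (auto simp: u_def)
    then have "norm (cell_mean A f k) powr p \<le> (\<integral>s. u s * indicator ucube s \<partial>lebesgue) powr p"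
      using p by (intro powr_mono2) auto
    also have "\<dots> \<le> (\<integral>s. u s powr p * indicator ucube s \<partial>lebesgue)"
      using jensen(2) u0 by (simp add: integral_ucube)
    finally have "ennreal (norm (cell_mean A f k) powr p) \<le> ennreal (\<integral>s. u s powr p * indicator ucube s \<partial>lebesgue)"
      by (rule ennreal_leI)
    also have "\<dots> = (\<integral>\<^sup>+s. ennreal (u s powr p * indicator ucube s) \<partial>lebesgue)"
      by (rule nn_integral_eq_integral[OF ui, symmetric]) simp
    finally show ?thesis using int unfolding uF by simp
  qed
  then show "integrable lebesgue (\<lambda>s. indicator ucube s *\<^sub>R f (matrix_inv A *v (s + ivec k)))"
    by blast
  have "(\<integral>\<^sup>+k. ennreal (norm (cell_mean A f k) powr p) \<partial>count_space UNIV) \<le> (\<integral>\<^sup>+y. F y \<partial>lebesgue)"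
    unfolding tile by (intro nn_integral_mono) (use cell in auto)
  then show "(\<integral>\<^sup>+k. ennreal (norm (cell_mean A f k) powr p) \<partial>count_space UNIV) \<le>
      ennreal (\<bar>det A\<bar> * Lp_norm lebesgue p f powr p)" by (simp add: F_int)
qed

text \<open>Origin of the constant in the theorem: \<open>|det b|^p / |det (a j)|\<close> from the
  normalisation times \<open>|det A| = |det (a j)| / |det b|\<close> from the cells gives
  \<open>|det b|^(p-1)\<close>, whose p-th root no longer depends on \<open>j\<close>.\<close>

lemma
  fixes a :: "nat \<Rightarrow> real^'n^'n" and b :: "real^'n^'n"
  assumes p: "1 \<le> p" and aj: "invertible (a j)" and b: "invertible b" and f: "f \<in> Lp_fun lebesgue p"
  shows analysis_Lp: "analysis p a b f j \<in> Lp_fun (count_space UNIV) p"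
    and analysis_norm_le: "lp_norm p (analysis p a b f j) \<le> \<bar>det b\<bar> powr (1 - 1 / p) * Lp_norm lebesgue p f"
proof -
  define A where "A = matrix_inv b ** a j"
  define \<beta> where "\<beta> = \<bar>det b\<bar> * \<bar>det (a j)\<bar> powr (- (1 / p))"
  have A: "invertible A" unfolding A_def by (rule invertible_matrix_inv_mult[OF b aj])
  have nz: "det b \<noteq> 0" "det (a j) \<noteq> 0" using b aj by (auto simp: invertible_det_nz)
  have \<beta>0: "0 \<le> \<beta>" by (simp add: \<beta>_def)
  have \<beta>p: "\<beta> powr p = \<bar>det b\<bar> powr p / \<bar>det (a j)\<bar>"
    using p nz by (simp add: \<beta>_def powr_mult powr_powr powr_minus_divide powr_divide)
  have eq: "norm (analysis p a b f j k) powr p = \<beta> powr p * norm (cell_mean A f k) powr p" for k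
    using \<beta>0 by (simp add: analysis_def A_def \<beta>_def[symmetric] norm_mult powr_mult)
  have "(\<integral>\<^sup>+k. ennreal (norm (analysis p a b f j k) powr p) \<partial>count_space UNIV) =
      ennreal (\<beta> powr p) * (\<integral>\<^sup>+k. ennreal (norm (cell_mean A f k) powr p) \<partial>count_space UNIV)"
    by (simp add: eq ennreal_mult nn_integral_cmult)
  also have "\<dots> \<le> ennreal (\<beta> powr p) * ennreal (\<bar>det A\<bar> * Lp_norm lebesgue p f powr p)"
    by (intro mult_left_mono cell_mean_sum_le[OF p A f]) simp
  also have "\<dots> = ennreal (\<bar>det b\<bar> powr p / \<bar>det b\<bar> * Lp_norm lebesgue p f powr p)"
    using nz by (simp add: \<beta>p A_def det_matrix_inv_mult[OF b aj] flip: ennreal_mult)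
  also have "\<bar>det b\<bar> powr p / \<bar>det b\<bar> = (\<bar>det b\<bar> powr (1 - 1 / p)) powr p"
    using nz p by (simp add: powr_powr powr_diff powr_divide)
  also have "\<dots> * Lp_norm lebesgue p f powr p = (\<bar>det b\<bar> powr (1 - 1 / p) * Lp_norm lebesgue p f) powr p"
    by (simp add: powr_mult Lp_norm_nonneg)
  finally have main: "(\<integral>\<^sup>+k. ennreal (norm (analysis p a b f j k) powr p) \<partial>count_space UNIV) \<le>
      ennreal ((\<bar>det b\<bar> powr (1 - 1 / p) * Lp_norm lebesgue p f) powr p)" .
  have nonneg: "0 \<le> \<bar>det b\<bar> powr (1 - 1 / p) * Lp_norm lebesgue p f" by (simp add: Lp_norm_nonneg)
  show *: "analysis p a b f j \<in> Lp_fun (count_space UNIV) p"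
    using Lp_norm_leI(1)[OF p nonneg _ main] by simp
  show "lp_norm p (analysis p a b f j) \<le> \<bar>det b\<bar> powr (1 - 1 / p) * Lp_norm lebesgue p f"
    using Lp_norm_leI(2)[OF p nonneg _ main] by (simp add: lp_norm_eq[OF *])
qed

lemma
  fixes a :: "nat \<Rightarrow> real^'n^'n" and b :: "real^'n^'n"
  assumes p: "1 \<le> p" and aj: "invertible (a j)" and b: "invertible b"
    and maj: "has_periodic_majorant p b W \<eta> D" and f: "f \<in> Lp_fun lebesgue p"
  shows synthesis_analysis_summable:
      "AE x in lebesgue. (\<lambda>k. norm (analysis p a b f j k * wavelet p a b \<eta> j k x)) summable_on UNIV"
    and synthesis_analysis_Lp: "synthesis_level p a b \<eta> (analysis p a b f) j \<in> Lp_fun lebesgue p"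
    and synthesis_analysis_norm_le:
      "Lp_norm lebesgue p (synthesis_level p a b \<eta> (analysis p a b f) j) \<le>
        D * (\<bar>det b\<bar> powr (1 - 1 / p) * Lp_norm lebesgue p f)"
proof -
  note an = analysis_Lp[where a=a and j=j, OF p aj b f]
  show "AE x in lebesgue. (\<lambda>k. norm (analysis p a b f j k * wavelet p a b \<eta> j k x)) summable_on UNIV"
    by (rule synthesis_level_summable[where a=a and j=j and c="analysis p a b f", OF p aj b maj an])
  show "synthesis_level p a b \<eta> (analysis p a b f) j \<in> Lp_fun lebesgue p"
    by (rule synthesis_level_Lp[where a=a and j=j and c="analysis p a b f", OF p aj b maj an])
  have "Lp_norm lebesgue p (synthesis_level p a b \<eta> (analysis p a b f) j) \<le> D * lp_norm p (analysis p a b f j)"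
    by (rule synthesis_level_norm_le[where a=a and j=j and c="analysis p a b f", OF p aj b maj an])
  also have "\<dots> \<le> D * (\<bar>det b\<bar> powr (1 - 1 / p) * Lp_norm lebesgue p f)"
    using maj by (intro mult_left_mono analysis_norm_le[where a=a and j=j, OF p aj b f])
      (simp add: has_periodic_majorant_def)
  finally show "Lp_norm lebesgue p (synthesis_level p a b \<eta> (analysis p a b f) j) \<le>
        D * (\<bar>det b\<bar> powr (1 - 1 / p) * Lp_norm lebesgue p f)" .
qed

lemma analysis_add:
  fixes a :: "nat \<Rightarrow> real^'n^'n" and b :: "real^'n^'n"
  assumes p: "1 \<le> p" and aj: "invertible (a j)" and b: "invertible b"
    and f: "f \<in> Lp_fun lebesgue p" and g: "g \<in> Lp_fun lebesgue p"
  shows "analysis p a b (\<lambda>x. f x + g x) j k = analysis p a b f j k + analysis p a b g j k"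
proof -
  note A = invertible_matrix_inv_mult[OF b aj]
  show ?thesis
    using cell_integrable[OF p A f, of k] cell_integrable[OF p A g, of k]
    by (simp add: analysis_def cell_mean_def scaleR_add_right distrib_left)
qed

text \<open>Since the generator has bounded support, only indices \<open>k\<close> within distance
  \<open>M\<close> of the dilated point contribute, and their cells stay within
  \<open>M + CARD('n)\<close> of it. There the cell means are uniformly close to \<open>f x\<close>,
  so \<open>f x\<close> can be pulled out of the lattice sum. One \<open>M\<close> serves both as
  bound for the lattice sums and as support radius.\<close>

lemma analysis_synthesis_uniform:
  fixes a :: "nat \<Rightarrow> real^'n^'n" and b :: "real^'n^'n"
  assumes p: "1 \<le> p" and a: "\<And>j. 0 < j \<Longrightarrow> invertible (a j)" and b: "invertible b"
    and lim: "(\<lambda>j. onorm (\<lambda>x. matrix_inv (matrix_inv b ** a j) *v x)) \<longlonglongrightarrow> 0"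
    and f: "f \<in> Lp_fun lebesgue p" "continuous_on UNIV f" "\<And>x. R < norm x \<Longrightarrow> f x = 0"
    and \<eta>: "\<And>y. (\<lambda>k. norm (\<eta> (b *v (y - ivec k)))) summable_on UNIV"
      "\<And>y. (\<Sum>\<^sub>\<infinity>k. norm (\<eta> (b *v (y - ivec k)))) \<le> M" "\<And>y. M < norm y \<Longrightarrow> \<eta> (b *v y) = 0"
    and e: "0 < e"
  shows "eventually (\<lambda>j. 0 < j \<and> (\<forall>x. norm (synthesis_level p a b \<eta> (analysis p a b f) j x -
      f x * (of_real \<bar>det b\<bar> * (\<Sum>\<^sub>\<infinity>k. \<eta> (b *v ((matrix_inv b ** a j) *v x - ivec k)))))
    \<le> e * indicator (cball 0 (R + 1)) x)) sequentially"
proof -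
  have M0: "0 \<le> M"
    using order_trans[OF infsum_nonneg \<eta>(2)] by (metis norm_ge_zero)
  define A where "A j = matrix_inv b ** a j" for j
  have A: "invertible (A j)" if "0 < j" for j
    unfolding A_def by (rule invertible_matrix_inv_mult[OF b a[OF that]])
  define B where "B = \<bar>det b\<bar>"
  have B: "0 < B" using b by (simp add: B_def invertible_det_nz)
  \<comment> \<open>The deviation of the means is multiplied by lattice weights of total at most
    \<open>M\<close> and by \<open>B\<close>; with \<open>M + 1\<close> in the denominator the
    product stays below \<open>e\<close>.\<close>
  define e' where "e' = e / (B * (M + 1))"
  have e': "0 < e'" using e B M0 by (simp add: e'_def)
  have "B * (e' * (M + 1)) = e" using B M0 by (simp add: e'_def)
  moreover have "B * (e' * M) \<le> B * (e' * (M + 1))" using e' B by (intro mult_left_mono) auto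
  ultimately have e'e: "B * (e' * M) \<le> e" by simp
  have ev: "eventually (\<lambda>j. 0 < j \<and> (\<forall>x y. norm (A j *v x - y) \<le> M + real CARD('n) \<longrightarrow>
      norm (f x - f (matrix_inv (A j) *v y)) < e' \<and> norm (x - matrix_inv (A j) *v y) < 1)) sequentially"
    using M0 by (intro sampling_uniform[OF A lim[folded A_def] f(2) f(3) e']) auto
  then show ?thesis
    unfolding A_def[symmetric] B_def[symmetric]
  proof eventually_elim
    case (elim j)
    then have j: "0 < j" by simp
    note Aj = A[OF j]
    have "norm (synthesis_level p a b \<eta> (analysis p a b f) j x -
        f x * (of_real B * (\<Sum>\<^sub>\<infinity>k. \<eta> (b *v (A j *v x - ivec k))))) \<le> e * indicator (cball 0 (R + 1)) x" for x
    proof -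
      define t where "t k = \<eta> (b *v (A j *v x - ivec k))" for k
      define m where "m k = cell_mean (A j) f k" for k
      have ts: "(\<lambda>k. norm (t k)) summable_on UNIV" "(\<Sum>\<^sub>\<infinity>k. norm (t k)) \<le> M"
        using \<eta>(1,2) by (auto simp: t_def)
      have coef: "analysis p a b f j k * wavelet p a b \<eta> j k x = of_real B * (m k * t k)" for k
        using a[OF j] by (simp add: analysis_def wavelet_ivec[OF b] t_def m_def A_def B_def powr_minus
            invertible_det_nz)
      have near: "norm (A j *v x - (s + ivec k)) \<le> M + real CARD('n)" if "t k \<noteq> 0" "s \<in> ucube" for s k
      proof -
        have "norm (A j *v x - ivec k) \<le> M" using that(1) \<eta>(3) by (force simp: t_def)
        moreover have "norm (A j *v x - ivec k - s) \<le> norm (A j *v x - ivec k) + norm s"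
          by (rule norm_triangle_ineq4)
        ultimately show ?thesis using norm_ucube_le[OF that(2)] by (simp add: algebra_simps)
      qed
      have fx_mean: "m k - f x = (\<integral>s. indicator ucube s *\<^sub>R (f (matrix_inv (A j) *v (s + ivec k)) - f x) \<partial>lebesgue)" for k
      proof -
        have "integrable lebesgue (\<lambda>s. indicator ucube s *\<^sub>R f x)"
          by (intro integrable_scaleR_left integrable_ucube)
        from Bochner_Integration.integral_diff[OF cell_integrable[OF p Aj f(1), of k] this]
        show ?thesis by (simp add: m_def cell_mean_def scaleR_diff_right integral_scaleR_left integrable_ucube)
      qed
      have m_near: "norm (m k - f x) \<le> e'" if "t k \<noteq> 0" for k
      proof -
        have "norm (m k - f x) \<le> (\<integral>s. e' * indicator ucube s \<partial>(lebesgue :: (real^'n) measure))"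
          unfolding fx_mean
        proof (rule Bochner_Integration.integral_norm_bound_integral)
          show "integrable lebesgue (\<lambda>s. indicator ucube s *\<^sub>R (f (matrix_inv (A j) *v (s + ivec k)) - f x))"
            unfolding scaleR_diff_right
            by (intro Bochner_Integration.integrable_diff cell_integrable[OF p Aj f(1)]
                integrable_scaleR_left integrable_ucube)
          show "integrable lebesgue (\<lambda>s::real^'n. e' * indicator ucube s)"
            by (intro integrable_mult_right integrable_ucube)
          show "norm (indicator ucube s *\<^sub>R (f (matrix_inv (A j) *v (s + ivec k)) - f x)) \<le> e' * indicator ucube s" for s
            using elim near[OF that, of s] e'
            by (cases "s \<in> ucube") (auto simp: norm_minus_commute less_imp_le)
        qed
        then show ?thesis by (simp add: integral_ucube)
      qed
      \<comment> \<open>Outside the ball of radius \<open>R + 1\<close>, \<open>f\<close> vanishes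
        at \<open>x\<close> and on all contributing cells, so the error has the same fixed support
        for all large levels.\<close>
      have far: "(m k - f x) * t k = 0" if "R + 1 < norm x" for k
      proof (cases "t k = 0")
        case False
        have "f (matrix_inv (A j) *v (s + ivec k)) = 0" if s: "s \<in> ucube" for s
        proof -
          let ?y = "matrix_inv (A j) *v (s + ivec k)"
          have "norm (x - ?y) < 1" using elim near[OF False s] by blast
          then have "R < norm ?y" using norm_triangle_sub[of x ?y] \<open>R + 1 < norm x\<close> by linarith
          then show ?thesis by (rule f(3))
        qed
        then have "m k = (\<integral>s. 0 \<partial>(lebesgue :: (real^'n) measure))"
          unfolding m_def cell_mean_def
          by (intro Bochner_Integration.integral_cong) (auto simp: indicator_def)
        then show ?thesis using f(3)[of x] that by simp
      qed simp
      have d_le: "norm ((m k - f x) * t k) \<le> e' * norm (t k)" for k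
        using m_near[of k] by (cases "t k = 0") (auto simp: norm_mult intro: mult_right_mono)
      have d_sum: "(\<lambda>k. norm ((m k - f x) * t k)) summable_on UNIV"
        by (rule summable_on_comparison_test[OF summable_on_cmult_right[OF ts(1), of e']]) (use d_le in auto)
      have "(\<Sum>\<^sub>\<infinity>k. m k * t k) = (\<Sum>\<^sub>\<infinity>k. (m k - f x) * t k + f x * t k)"
        by (simp add: algebra_simps)
      also have "\<dots> = (\<Sum>\<^sub>\<infinity>k. (m k - f x) * t k) + (\<Sum>\<^sub>\<infinity>k. f x * t k)"
        by (intro infsum_add abs_summable_summable[OF d_sum] summable_on_cmult_right
            abs_summable_summable[OF ts(1)])
      also have "(\<Sum>\<^sub>\<infinity>k. f x * t k) = f x * (\<Sum>\<^sub>\<infinity>k. t k)"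
        by (intro infsum_cmult_right abs_summable_summable[OF ts(1)])
      finally have split: "(\<Sum>\<^sub>\<infinity>k. m k * t k) = (\<Sum>\<^sub>\<infinity>k. (m k - f x) * t k) + f x * (\<Sum>\<^sub>\<infinity>k. t k)" .
      have level: "synthesis_level p a b \<eta> (analysis p a b f) j x = of_real B * (\<Sum>\<^sub>\<infinity>k. m k * t k)"
        unfolding synthesis_level_def coef using B by (intro infsum_cmult_right') 
      have diff: "synthesis_level p a b \<eta> (analysis p a b f) j x - f x * (of_real B * (\<Sum>\<^sub>\<infinity>k. t k)) =
          of_real B * (\<Sum>\<^sub>\<infinity>k. (m k - f x) * t k)"
        unfolding level split by (simp add: algebra_simps)
      have "norm (\<Sum>\<^sub>\<infinity>k. (m k - f x) * t k) \<le> (\<Sum>\<^sub>\<infinity>k. norm ((m k - f x) * t k))"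
        by (rule norm_infsum_bound[OF d_sum])
      also have "\<dots> \<le> (\<Sum>\<^sub>\<infinity>k. e' * norm (t k))"
        by (intro infsum_mono d_sum summable_on_cmult_right ts(1) d_le)
      also have "\<dots> = e' * (\<Sum>\<^sub>\<infinity>k. norm (t k))" by (intro infsum_cmult_right ts(1))
      also have "\<dots> \<le> e' * M" using e' ts(2) by (intro mult_left_mono) auto
      finally have "B * norm (\<Sum>\<^sub>\<infinity>k. (m k - f x) * t k) \<le> e"
        using B e'e by (meson mult_left_mono less_imp_le order_trans)
      then have "norm (of_real B * (\<Sum>\<^sub>\<infinity>k. (m k - f x) * t k)) \<le> e" using B by (simp add: norm_mult)
      moreover have "(\<Sum>\<^sub>\<infinity>k. (m k - f x) * t k) = 0" if "R + 1 < norm x" by (simp only: far[OF that] infsum_0_simp)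
      ultimately show ?thesis
        unfolding t_def[symmetric] diff by (cases "norm x \<le> R + 1") auto
    qed
    then show ?case using j by simp
  qed
qed

section \<open>Averages of oscillating functions\<close>

lemma integrable_cball: "integrable lebesgue (\<lambda>x::'a::euclidean_space. C * indicator (cball 0 R) x :: real)"
  using emeasure_lborel_cball_finite[of "0::'a" R]
  by (intro integrable_mult_right integrable_real_indicator) auto

lemma integrable_bounded_support:
  fixes F :: "'a::euclidean_space \<Rightarrow> 'b::{banach, second_countable_topology}"
  assumes "F \<in> borel_measurable lebesgue" "\<And>x. norm (F x) \<le> C * indicator (cball 0 R) x"
  shows "integrable lebesgue F"
proof (rule Bochner_Integration.integrable_bound[OF integrable_cball assms(1)])
  show "AE x in lebesgue. norm (F x) \<le> norm (C * indicator (cball 0 R) x)"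
    using assms(2) by (intro AE_I2) (metis abs_ge_self order_trans real_norm_def)
qed

text \<open>For \<open>t \<le> s\<close> the first term suffices. Otherwise write
  \<open>t^p = t^2 * t^(p-2)\<close>: the last factor is monotone in \<open>t\<close>, increasing
  for \<open>p \<ge> 2\<close> and decreasing for \<open>p < 2\<close>, so its value at
  \<open>K\<close> or at \<open>s\<close> bounds it. Including both values covers all
  \<open>p\<close> at once.\<close>

lemma powr_interpolate:
  fixes t K s p :: real
  assumes "1 \<le> p" "0 \<le> t" "t \<le> K" "0 < s"
  shows "t powr p \<le> s powr p + t^2 * (s powr (p - 2) + K powr (p - 2))"
proof (cases "t \<le> s")
  case True
  then have "t powr p \<le> s powr p" using assms by (intro powr_mono2) auto
  moreover have "0 \<le> t^2 * (s powr (p - 2) + K powr (p - 2))" by simp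
  ultimately show ?thesis by linarith
next
  case False
  then have t: "0 < t" using assms by simp
  have "t powr (p - 2) \<le> s powr (p - 2) + K powr (p - 2)"
  proof (cases "2 \<le> p")
    case True
    then have "t powr (p - 2) \<le> K powr (p - 2)" using assms by (intro powr_mono2) auto
    then show ?thesis by (simp add: add_increasing)
  next
    case False
    then have "t powr (p - 2) \<le> s powr (p - 2)" using assms \<open>\<not> t \<le> s\<close> by (intro powr_mono2') auto
    then show ?thesis by (simp add: add_increasing2)
  qed
  then have "t^2 * t powr (p - 2) \<le> t^2 * (s powr (p - 2) + K powr (p - 2))"
    by (intro mult_left_mono) auto
  moreover have "t^2 * t powr (p - 2) = t powr p"
    using t by (simp add: powr_diff flip: powr_numeral)
  ultimately show ?thesis by (simp add: add_increasing)
qed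

text \<open>For functions with a common bound and a common ball as support, small values contribute
  little to the p-th power because the ball has finite measure, and large values are controlled by
  the square. This makes orthogonality usable for every \<open>p\<close>.\<close>

lemma Lp_norm_small_of_L2:
  assumes p: "1 \<le> p" and d: "0 < d"
  obtains \<epsilon> where "0 < \<epsilon>"
    "\<And>z :: 'a::euclidean_space \<Rightarrow> complex. z \<in> borel_measurable lebesgue \<Longrightarrow> (\<And>x. norm (z x) \<le> K * indicator (cball 0 R) x) \<Longrightarrow>
      (\<integral>x. (norm (z x))^2 \<partial>lebesgue) \<le> \<epsilon> \<Longrightarrow> z \<in> Lp_fun lebesgue p \<and> Lp_norm lebesgue p z \<le> d"
proof -
  define V where "V = measure lebesgue (cball (0::'a) R)"
  have V: "0 \<le> V" by (simp add: V_def)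
  \<comment> \<open>Half of the budget \<open>d powr p\<close> goes to the part below the threshold
    \<open>s\<close>, spread over a ball of measure \<open>V\<close>; the other half goes to the
    quadratic part through \<open>\<epsilon>\<close>.\<close>
  define s where "s = (d powr p / (2 * (V + 1))) powr (1 / p)"
  have s: "0 < s" using d V by (simp add: s_def)
  have sp: "s powr p = d powr p / (2 * (V + 1))"
    using p V by (simp add: s_def powr_powr)
  define Q where "Q = s powr (p - 2) + K powr (p - 2)"
  have Q: "0 < Q" using s by (simp add: Q_def add_pos_nonneg)
  define \<epsilon> where "\<epsilon> = d powr p / (2 * Q)"
  have \<epsilon>: "0 < \<epsilon>" using d Q by (simp add: \<epsilon>_def)
  show thesis
  proof (rule that[OF \<epsilon>])
    fix z :: "'a \<Rightarrow> complex"
    assume zm: "z \<in> borel_measurable lebesgue" and z_le: "\<And>x. norm (z x) \<le> K * indicator (cball 0 R) x"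
      and z2: "(\<integral>x. (norm (z x))^2 \<partial>lebesgue) \<le> \<epsilon>"
    have int2: "integrable lebesgue (\<lambda>x. (norm (z x))^2)"
    proof (rule integrable_bounded_support)
      show "norm ((norm (z x))^2) \<le> K^2 * indicator (cball 0 R) x" for x
        using power_mono[OF z_le[of x], of 2] by (auto simp: indicator_def split: if_splits)
    qed (use zm in measurable)
    have int1: "integrable lebesgue (\<lambda>x. s powr p * indicator (cball (0::'a) R) x)"
      by (rule integrable_cball)
    have le: "norm (z x) powr p \<le> s powr p * indicator (cball 0 R) x + (norm (z x))^2 * Q" for x
    proof (cases "x \<in> cball 0 R")
      case True
      then show ?thesis using powr_interpolate[OF p _ _ s, of "norm (z x)" K] z_le[of x] by (simp add: Q_def)
    next
      case False
      then have "z x = 0" using z_le[of x] by simp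
      then show ?thesis using False by simp
    qed
    have intp: "integrable lebesgue (\<lambda>x. norm (z x) powr p)"
      by (rule Bochner_Integration.integrable_bound[OF Bochner_Integration.integrable_add[OF int1 integrable_mult_left[OF int2, of Q]]])
        (use zm le Q in \<open>auto intro!: AE_I2 simp: abs_of_nonneg\<close>)
    have "(\<integral>x. norm (z x) powr p \<partial>lebesgue) \<le>
        (\<integral>x. s powr p * indicator (cball 0 R) x + (norm (z x))^2 * Q \<partial>lebesgue)"
      by (intro integral_mono intp Bochner_Integration.integrable_add int1 integrable_mult_left int2 le)
    also have "\<dots> = (\<integral>x. s powr p * indicator (cball (0::'a) R) x \<partial>lebesgue) + (\<integral>x. (norm (z x))^2 * Q \<partial>lebesgue)"
      by (intro Bochner_Integration.integral_add int1 integrable_mult_left int2)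
    also have "\<dots> = s powr p * V + (\<integral>x. (norm (z x))^2 \<partial>lebesgue) * Q"
      by (simp add: V_def)
    also have "\<dots> \<le> d powr p / 2 + d powr p / 2"
    proof (rule add_mono)
      have "s powr p * V \<le> s powr p * (V + 1)" by (intro mult_left_mono) auto
      also have "\<dots> = d powr p / 2" using V by (simp add: sp field_simps)
      finally show "s powr p * V \<le> d powr p / 2" .
      have "(\<integral>x. (norm (z x))^2 \<partial>lebesgue) * Q \<le> \<epsilon> * Q" using z2 Q by (intro mult_right_mono) auto
      then show "(\<integral>x. (norm (z x))^2 \<partial>lebesgue) * Q \<le> d powr p / 2" using Q by (simp add: \<epsilon>_def)
    qed
    finally have "(\<integral>x. norm (z x) powr p \<partial>lebesgue) \<le> d powr p" by simp
    then have "Lp_norm lebesgue p z \<le> d"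
      unfolding Lp_norm_def using p d by (intro powr_le_imp) auto
    then show "z \<in> Lp_fun lebesgue p \<and> Lp_norm lebesgue p z \<le> d"
      using zm intp by (simp add: Lp_fun_def)
  qed
qed

text \<open>The functions \<open>f(x) g(A\<^sub>j x)\<close> are asymptotically orthogonal in \<open>L\<^sup>2\<close>, so that the averages over
  suitably sparse sets of scales tend to zero in norm.\<close>

lemma oscillating_sum_L2:
  fixes A :: "nat \<Rightarrow> real^'n^'n" and g f :: "real^'n \<Rightarrow> complex"
  assumes A: "\<And>j. 0 < j \<Longrightarrow> invertible (A j)"
    and lim: "(\<lambda>j. onorm (\<lambda>x. matrix_inv (A j) *v x)) \<longlonglongrightarrow> 0"
    and g: "g \<in> borel_measurable lebesgue" "\<And>x. norm (g x) \<le> M" "\<And>x k. g (x + ivec k) = g x"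
      "(\<integral>x. indicator ucube x *\<^sub>R g x \<partial>lebesgue) = 0"
    and f: "f \<in> borel_measurable lebesgue" "\<And>x. norm (f x) \<le> F * indicator (cball 0 R) x"
  shows "\<exists>J. finite J \<and> card J = n \<and> J \<subseteq> {N<..} \<and>
    (\<integral>x. (norm (\<Sum>j\<in>J. f x * g (A j *v x)))^2 \<partial>lebesgue) \<le>
      real n * ((F * M)^2 * measure lebesgue (cball (0::real^'n) R) + 1)"
proof (induction n)
  case 0
  then show ?case by (intro exI[of _ "{}"]) auto
next
  case (Suc n)
  define V where "V = measure lebesgue (cball (0::real^'n) R)"
  then obtain J where J: "finite J" "card J = n" "J \<subseteq> {N<..}"
    and J_le: "(\<integral>x. (norm (\<Sum>j\<in>J. f x * g (A j *v x)))^2 \<partial>lebesgue) \<le> real n * ((F * M)^2 * V + 1)"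
    using Suc.IH by auto
  have M0: "0 \<le> M" using order_trans[OF norm_ge_zero g(2)] .
  have J0: "0 < j" if "j \<in> J" for j using J(3) that by auto
  define v where "v j x = f x * g (A j *v x)" for j x
  define U where "U x = (\<Sum>j\<in>J. v j x)" for x
  have vm: "v j \<in> borel_measurable lebesgue" if "0 < j" for j
    unfolding v_def[abs_def] using f(1) borel_measurable_affine[OF A[OF that] g(1), of 0] by simp
  have Um: "U \<in> borel_measurable lebesgue"
    unfolding U_def[abs_def] by (intro borel_measurable_sum vm J0)
  have v_le: "norm (v j x) \<le> (F * M) * indicator (cball 0 R) x" for j x
  proof -
    have "norm (f x) * norm (g (A j *v x)) \<le> (F * indicator (cball 0 R) x) * M"
      by (intro mult_mono f g) (use order_trans[OF norm_ge_zero f(2)] in auto)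
    then show ?thesis by (simp add: v_def norm_mult ac_simps)
  qed
  have U_le: "norm (U x) \<le> (real n * (F * M)) * indicator (cball 0 R) x" for x
  proof -
    have "norm (U x) \<le> (\<Sum>j\<in>J. norm (v j x))" unfolding U_def by (rule norm_sum)
    also have "\<dots> \<le> (\<Sum>j\<in>J. (F * M) * indicator (cball 0 R) x)" by (intro sum_mono v_le)
    finally show ?thesis by (simp add: J(2) mult.assoc)
  qed
  \<comment> \<open>The cross term between the sum so far and a new summand of index
    \<open>j\<close> is the integral of \<open>h x * g (A j *v x)\<close>. As \<open>h\<close> does
    not depend on \<open>j\<close>, weak convergence makes it small for large
    \<open>j\<close>.\<close>
  define h where "h x = cnj (U x) * f x" for x
  have hi: "integrable lebesgue h"
  proof (rule integrable_bounded_support)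
    show "h \<in> borel_measurable lebesgue"
      unfolding h_def[abs_def]
      by (intro borel_measurable_times f(1) measurable_compose[OF Um borel_measurable_continuous_onI]
          continuous_on_cnj continuous_on_id)
    show "norm (h x) \<le> ((real n * (F * M)) * F) * indicator (cball 0 R) x" for x
      using mult_mono[OF U_le[of x] f(2)[of x]] order_trans[OF norm_ge_zero U_le[of x]]
      by (auto simp: h_def norm_mult indicator_def split: if_splits)
  qed
  have "(\<lambda>j. \<integral>x. h x * g (A j *v x) \<partial>lebesgue) \<longlonglongrightarrow> 0"
    by (rule weak_convergence_oscillating[OF A lim g hi])
  \<comment> \<open>Below 1/2 the doubled real part is at most 1, which is the \<open>+ 1\<close>
    paid per summand in the bound. Going beyond \<open>Max (insert N J)\<close> keeps the new index
    above \<open>N\<close> and outside \<open>J\<close>.\<close>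
  then have "eventually (\<lambda>j. norm (\<integral>x. h x * g (A j *v x) \<partial>lebesgue) < 1 / 2) sequentially"
    by (intro order_tendstoD(2)[OF tendsto_norm_zero]) auto
  moreover have "eventually (\<lambda>j. Max (insert N J) < j) sequentially" by (rule eventually_gt_at_top)
  ultimately have "eventually (\<lambda>j. norm (\<integral>x. h x * g (A j *v x) \<partial>lebesgue) < 1 / 2 \<and> Max (insert N J) < j) sequentially"
    by (rule eventually_conj)
  then obtain i where i: "norm (\<integral>x. h x * g (A i *v x) \<partial>lebesgue) < 1 / 2" "Max (insert N J) < i"
    by (auto simp: eventually_sequentially)
  have iN: "N < i" "i \<notin> J" "0 < i" using i(2) J(1) by (auto simp: Max_less_iff)
  have intU: "integrable lebesgue (\<lambda>x. (norm (U x))^2)"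
  proof (rule integrable_bounded_support)
    show "norm ((norm (U x))^2) \<le> (real n * (F * M))^2 * indicator (cball 0 R) x" for x
      using power_mono[OF U_le[of x], of 2] by (auto simp: indicator_def split: if_splits)
  qed (use Um in measurable)
  have v2_le: "norm ((norm (v i x))^2) \<le> (F * M)^2 * indicator (cball 0 R) x" for x
    using power_mono[OF v_le[of i x], of 2] by (auto simp: indicator_def split: if_splits)
  have intv: "integrable lebesgue (\<lambda>x. (norm (v i x))^2)"
    by (rule integrable_bounded_support[OF _ v2_le]) (use vm[OF iN(3)] in measurable)
  have intUv: "integrable lebesgue (\<lambda>x. h x * g (A i *v x))"
  proof (rule integrable_bounded_support)
    show "(\<lambda>x. h x * g (A i *v x)) \<in> borel_measurable lebesgue"
      using borel_measurable_integrable[OF hi] borel_measurable_affine[OF A[OF iN(3)] g(1), of 0] by simp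
    show "norm (h x * g (A i *v x)) \<le> ((real n * (F * M)) * (F * M)) * indicator (cball 0 R) x" for x
      using mult_mono[OF U_le[of x] v_le[of i x]] order_trans[OF norm_ge_zero U_le[of x]]
      by (auto simp: h_def v_def norm_mult indicator_def mult.assoc split: if_splits)
  qed
  have expand: "(norm (U x + v i x))^2 = (norm (U x))^2 + (norm (v i x))^2 + 2 * Re (h x * g (A i *v x))" for x
  proof -
    have "h x * g (A i *v x) = cnj (U x) * v i x" by (simp add: h_def v_def)
    then show ?thesis unfolding cmod_power2 by (simp add: power2_eq_square algebra_simps)
  qed
  have "(\<integral>x. (norm (U x + v i x))^2 \<partial>lebesgue) =
      (\<integral>x. (norm (U x))^2 \<partial>lebesgue) + (\<integral>x. (norm (v i x))^2 \<partial>lebesgue) +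
      2 * Re (\<integral>x. h x * g (A i *v x) \<partial>lebesgue)"
  proof -
    have "(\<integral>x. (norm (U x + v i x))^2 \<partial>lebesgue) =
        (\<integral>x. (norm (U x))^2 + (norm (v i x))^2 \<partial>lebesgue) +
        (\<integral>x. 2 * Re (h x * g (A i *v x)) \<partial>lebesgue)"
      unfolding expand
      by (intro Bochner_Integration.integral_add Bochner_Integration.integrable_add intU intv
          integrable_mult_right integrable_Re[OF intUv])
    also have "(\<integral>x. 2 * Re (h x * g (A i *v x)) \<partial>lebesgue) = 2 * Re (\<integral>x. h x * g (A i *v x) \<partial>lebesgue)"
      unfolding integral_mult_right_zero integral_Re[OF intUv] ..
    finally show ?thesis using intU intv by simp
  qed
  also have "\<dots> \<le> real n * ((F * M)^2 * V + 1) + (F * M)^2 * V + 1"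
  proof -
    have "(\<integral>x. (norm (v i x))^2 \<partial>lebesgue) \<le> (\<integral>x. (F * M)^2 * indicator (cball (0::real^'n) R) x \<partial>lebesgue)"
      by (rule integral_mono[OF intv integrable_cball]) (use v2_le in auto)
    then have "(\<integral>x. (norm (v i x))^2 \<partial>lebesgue) \<le> (F * M)^2 * V" by (simp add: V_def)
    moreover have "Re (\<integral>x. h x * g (A i *v x) \<partial>lebesgue) \<le> 1 / 2"
      using i(1) complex_Re_le_cmod[of "\<integral>x. h x * g (A i *v x) \<partial>lebesgue"] by linarith
    ultimately show ?thesis using J_le by (simp add: U_def v_def)
  qed
  also have "\<dots> = real (Suc n) * ((F * M)^2 * V + 1)" by (simp add: algebra_simps)
  finally have "(\<integral>x. (norm (\<Sum>j\<in>insert i J. f x * g (A j *v x)))^2 \<partial>lebesgue) \<le>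
      real (Suc n) * ((F * M)^2 * V + 1)"
    using J(1) iN(2) by (simp add: U_def v_def add.commute)
  then show ?case
    using J iN by (intro exI[of _ "insert i J"]) (auto simp: V_def)
qed

text \<open>The squared L2 norm of the sum grows only linearly in the number \<open>n\<close> of
  levels, so division by \<open>n\<close> leaves \<open>C / n\<close>. The average also keeps the
  pointwise bound of its terms, as the passage from L2 to Lp demands.\<close>

lemma oscillating_average_small:
  fixes A :: "nat \<Rightarrow> real^'n^'n" and g f :: "real^'n \<Rightarrow> complex"
  assumes p: "1 \<le> p" and d: "0 < d"
    and A: "\<And>j. 0 < j \<Longrightarrow> invertible (A j)"
    and lim: "(\<lambda>j. onorm (\<lambda>x. matrix_inv (A j) *v x)) \<longlonglongrightarrow> 0"
    and g: "g \<in> borel_measurable lebesgue" "\<And>x. norm (g x) \<le> M" "\<And>x k. g (x + ivec k) = g x"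
      "(\<integral>x. indicator ucube x *\<^sub>R g x \<partial>lebesgue) = 0"
    and f: "f \<in> borel_measurable lebesgue" "\<And>x. norm (f x) \<le> F * indicator (cball 0 R) x"
  obtains J where "finite J" "J \<noteq> {}" "J \<subseteq> {N<..}"
    "(\<lambda>x. of_real (1 / real (card J)) * (\<Sum>j\<in>J. f x * g (A j *v x))) \<in> Lp_fun lebesgue p"
    "Lp_norm lebesgue p (\<lambda>x. of_real (1 / real (card J)) * (\<Sum>j\<in>J. f x * g (A j *v x))) \<le> d"
proof -
  obtain \<epsilon> where \<epsilon>: "0 < \<epsilon>"
    "\<And>z :: real^'n \<Rightarrow> complex. z \<in> borel_measurable lebesgue \<Longrightarrow> (\<And>x. norm (z x) \<le> (F * M) * indicator (cball 0 R) x) \<Longrightarrow>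
      (\<integral>x. (norm (z x))^2 \<partial>lebesgue) \<le> \<epsilon> \<Longrightarrow> z \<in> Lp_fun lebesgue p \<and> Lp_norm lebesgue p z \<le> d"
    using Lp_norm_small_of_L2[OF p d] by metis
  define C where "C = (F * M)^2 * measure lebesgue (cball (0::real^'n) R) + 1"
  obtain n :: nat where n: "max 1 (C / \<epsilon>) \<le> real n" using real_arch_simple by blast
  have n0: "0 < n" using n by (cases n) auto
  obtain J where J: "finite J" "card J = n" "J \<subseteq> {N<..}"
    and J_le: "(\<integral>x. (norm (\<Sum>j\<in>J. f x * g (A j *v x)))^2 \<partial>lebesgue) \<le> real n * C"
    using oscillating_sum_L2[OF A lim g f, of n N] by (auto simp: C_def)
  define z where "z x = of_real (1 / real (card J)) * (\<Sum>j\<in>J. f x * g (A j *v x))" for x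
  have M0: "0 \<le> M" using order_trans[OF norm_ge_zero g(2)] .
  have zm: "z \<in> borel_measurable lebesgue"
  proof -
    have "(\<lambda>x. g (A j *v x)) \<in> borel_measurable lebesgue" if "j \<in> J" for j
      using borel_measurable_affine[OF A g(1), of j 0] J(3) that by auto
    then show ?thesis unfolding z_def[abs_def]
      using f(1) by (intro borel_measurable_times borel_measurable_const borel_measurable_sum)
  qed
  have z_le: "norm (z x) \<le> (F * M) * indicator (cball 0 R) x" for x
  proof -
    have "norm (\<Sum>j\<in>J. f x * g (A j *v x)) \<le> (\<Sum>j\<in>J. (F * M) * indicator (cball 0 R) x)"
    proof (rule sum_norm_le)
      fix j
      have "norm (f x) * norm (g (A j *v x)) \<le> (F * indicator (cball 0 R) x) * M"
        by (intro mult_mono f g) (use order_trans[OF norm_ge_zero f(2)] in auto)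
      then show "norm (f x * g (A j *v x)) \<le> (F * M) * indicator (cball 0 R) x"
        by (simp add: norm_mult ac_simps)
    qed
    then have "norm (z x) \<le> (1 / real n) * (real n * ((F * M) * indicator (cball 0 R) x))"
      unfolding z_def norm_mult J(2) by (intro mult_mono) (auto simp: J(2) norm_divide)
    then show ?thesis using n0 by simp
  qed
  have "(norm (z x))^2 = (1 / real n)^2 * (norm (\<Sum>j\<in>J. f x * g (A j *v x)))^2" for x
    by (simp add: z_def norm_mult J(2) norm_divide power_mult_distrib power_divide)
  then have "(\<integral>x. (norm (z x))^2 \<partial>lebesgue) =
      (1 / real n)^2 * (\<integral>x. (norm (\<Sum>j\<in>J. f x * g (A j *v x)))^2 \<partial>lebesgue)" by simp
  also have "\<dots> \<le> (1 / real n)^2 * (real n * C)" by (intro mult_left_mono J_le) auto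
  also have "\<dots> = C / real n" using n0 by (simp add: power2_eq_square)
  also have "\<dots> \<le> \<epsilon>" using n n0 \<epsilon>(1) by (simp add: field_simps)
  finally have "z \<in> Lp_fun lebesgue p \<and> Lp_norm lebesgue p z \<le> d"
    by (intro \<epsilon>(2) zm z_le)
  moreover have "J \<noteq> {}" using J(2) n0 by auto
  ultimately show thesis using that[OF J(1) _ J(3)] by (simp add: z_def[abs_def])
qed

section \<open>Truncation of the generator\<close>

lemma
  fixes F :: "real^'n \<Rightarrow> 'b::euclidean_space"
  shows lattice_shift_summable:
      "(\<lambda>k. F (y + ivec l - ivec k)) summable_on UNIV \<longleftrightarrow> (\<lambda>k. F (y - ivec k)) summable_on UNIV"
    and lattice_shift_infsum: "(\<Sum>\<^sub>\<infinity>k. F (y + ivec l - ivec k)) = (\<Sum>\<^sub>\<infinity>k. F (y - ivec k))"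
proof -
  have bij: "bij_betw (\<lambda>k. l + k) UNIV (UNIV :: (int^'n) set)"
    by (rule bij_betw_byWitness[where f'="\<lambda>k. - l + k"]) auto
  have eq: "F (y + ivec l - ivec (l + k)) = F (y - ivec k)" for k
    by (simp add: ivec_add)
  show "(\<lambda>k. F (y + ivec l - ivec k)) summable_on UNIV \<longleftrightarrow> (\<lambda>k. F (y - ivec k)) summable_on UNIV"
    using summable_on_reindex_bij_betw[OF bij, of "\<lambda>k. F (y + ivec l - ivec k)"] by (simp add: eq)
  show "(\<Sum>\<^sub>\<infinity>k. F (y + ivec l - ivec k)) = (\<Sum>\<^sub>\<infinity>k. F (y - ivec k))"
    using infsum_reindex_bij_betw[OF bij, of "\<lambda>k. F (y + ivec l - ivec k)"] by (simp add: eq)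
qed

text \<open>Tiling produces the translates \<open>y + ivec k\<close>, whereas periodization uses
  \<open>y - ivec k\<close>.\<close>

lemma
  fixes F :: "real^'n \<Rightarrow> 'b::euclidean_space"
  shows lattice_reflect_summable:
      "(\<lambda>k. F (y + ivec k)) summable_on UNIV \<longleftrightarrow> (\<lambda>k. F (y - ivec k)) summable_on UNIV"
    and lattice_reflect_infsum: "(\<Sum>\<^sub>\<infinity>k. F (y + ivec k)) = (\<Sum>\<^sub>\<infinity>k. F (y - ivec k))"
proof -
  have bij: "bij_betw uminus UNIV (UNIV :: (int^'n) set)"
    by (rule bij_betw_byWitness[where f'=uminus]) auto
  show "(\<lambda>k. F (y + ivec k)) summable_on UNIV \<longleftrightarrow> (\<lambda>k. F (y - ivec k)) summable_on UNIV"
    using summable_on_reindex_bij_betw[OF bij, of "\<lambda>k. F (y + ivec k)"] by (simp add: ivec_uminus)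
  show "(\<Sum>\<^sub>\<infinity>k. F (y + ivec k)) = (\<Sum>\<^sub>\<infinity>k. F (y - ivec k))"
    using infsum_reindex_bij_betw[OF bij, of "\<lambda>k. F (y + ivec k)"] by (simp add: ivec_uminus)
qed

text \<open>Up to the factor \<open>|det b|\<close>, the periodization of the modulus of
  \<open>\<psi>\<close>, in coordinates where the lattice consists of the integer vectors.\<close>

definition lattice_majorant :: "real^'n^'n \<Rightarrow> (real^'n \<Rightarrow> complex) \<Rightarrow> real^'n \<Rightarrow> real" where
  "lattice_majorant b \<psi> y = (\<Sum>\<^sub>\<infinity>k. norm (\<psi> (b *v (y - ivec k))))"

lemma lattice_majorant_periodic: "lattice_majorant b \<psi> (y + ivec l) = lattice_majorant b \<psi> y"
  unfolding lattice_majorant_def by (rule lattice_shift_infsum)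

lemma lattice_majorant_nonneg: "0 \<le> lattice_majorant b \<psi> y"
  unfolding lattice_majorant_def by (intro infsum_nonneg) auto

lemma lattice_term_measurable:
  fixes b :: "real^'n^'n" and \<psi> :: "real^'n \<Rightarrow> complex"
  assumes "invertible b" "\<psi> \<in> borel_measurable lebesgue"
  shows "(\<lambda>y. \<psi> (b *v (y - ivec k))) \<in> borel_measurable lebesgue"
  using borel_measurable_affine[OF assms, of "- (b *v ivec k)"]
  by (simp add: matrix_vector_mult_diff_distrib)

lemma lattice_majorant_measurable:
  assumes "invertible b" "\<psi> \<in> borel_measurable lebesgue"
  shows "lattice_majorant b \<psi> \<in> borel_measurable lebesgue"
  unfolding lattice_majorant_def[abs_def]
  using lattice_term_measurable[OF assms] by (intro borel_measurable_infsum) simp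

text \<open>Folding the moment onto the unit cube sums the first factor over the lattice to another
  copy of the periodic function \<open>W\<close>. What remains is the integral of \<open>W^p\<close>
  over one cell, finite by local integrability of the periodization.\<close>

lemma
  fixes b :: "real^'n^'n"
  assumes p: "1 \<le> p" and b: "invertible b" and \<psi>: "\<psi> \<in> borel_measurable lebesgue"
    and per: "periodization_in_Lp_loc p b (\<lambda>x. norm (\<psi> x))"
  shows periodization_summable: "AE y in lebesgue. (\<lambda>k. norm (\<psi> (b *v (y - ivec k)))) summable_on UNIV"
    and periodization_moment:
      "(\<integral>\<^sup>+y. norm (\<psi> (b *v y)) * lattice_majorant b \<psi> y powr (p - 1) \<partial>lebesgue) < \<infinity>"
proof -
  let ?W = "lattice_majorant b \<psi>"
  have "AE x in lebesgue. (\<lambda>k. norm (\<psi> (x - lattice_point b k))) summable_on UNIV"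
    using per by (simp add: periodization_in_Lp_loc_def)
  from AE_affine[OF b this, of 0]
  show summ: "AE y in lebesgue. (\<lambda>k. norm (\<psi> (b *v (y - ivec k)))) summable_on UNIV"
    by (simp add: lattice_point_ivec matrix_vector_mult_diff_distrib)
  have det: "det b \<noteq> 0" using b by (simp add: invertible_det_nz)
  let ?P = "periodization b (\<lambda>x. norm (\<psi> x))"
  have P_eq: "?P (b *v y) = \<bar>det b\<bar> * ?W y" for y
    by (simp add: periodization_def lattice_majorant_def lattice_point_ivec matrix_vector_mult_diff_distrib)
  \<comment> \<open>The closed parallelepiped is compact and contains the image of the half-open
    cube.\<close>
  define K where "K = (*v) b ` cbox 0 (1 :: real^'n)"
  have K: "compact K" unfolding K_def
    by (intro compact_continuous_image linear_continuous_on matrix_vector_mul_bounded_linear) auto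
  then have Kint: "set_integrable lebesgue K (\<lambda>x. \<bar>?P x\<bar> powr p)"
    using per by (simp add: periodization_in_Lp_loc_def Lp_loc_def)
  define G where "G x = ennreal (norm (indicator K x *\<^sub>R \<bar>?P x\<bar> powr p))" for x
  have Gfin: "(\<integral>\<^sup>+x. G x \<partial>lebesgue) < \<infinity>" and Gm: "G \<in> borel_measurable lebesgue"
    using Kint unfolding set_integrable_def integrable_iff_bounded G_def[abs_def] by auto
  have "(\<integral>\<^sup>+y. G (b *v y) \<partial>lebesgue) < \<infinity>"
    using nn_integral_affine[OF b Gm, of 0] Gfin by (simp add: ennreal_mult_less_top)
  moreover have "(\<integral>\<^sup>+y. indicator ucube y * ennreal ((\<bar>det b\<bar> * ?W y) powr p) \<partial>lebesgue) \<le> (\<integral>\<^sup>+y. G (b *v y) \<partial>lebesgue)"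
  proof (rule nn_integral_mono)
    fix y :: "real^'n"
    show "indicator ucube y * ennreal ((\<bar>det b\<bar> * ?W y) powr p) \<le> G (b *v y)"
    proof (cases "y \<in> ucube")
      case True
      then have "b *v y \<in> K" unfolding K_def
        by (intro imageI) (auto simp: ucube_def mem_box_cart less_imp_le)
      then show ?thesis using True by (simp add: G_def P_eq lattice_majorant_nonneg)
    qed simp
  qed
  ultimately have cube_fin: "(\<integral>\<^sup>+y. indicator ucube y * ennreal ((\<bar>det b\<bar> * ?W y) powr p) \<partial>lebesgue) < \<infinity>"
    by simp
  define H where "H y = ennreal (norm (\<psi> (b *v y)) * ?W y powr (p - 1))" for y
  have \<psi>b: "(\<lambda>y. \<psi> (b *v y)) \<in> borel_measurable lebesgue"
    using borel_measurable_affine[OF b \<psi>, of 0] by simp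
  have Hm: "H \<in> borel_measurable lebesgue"
    unfolding H_def[abs_def] using \<psi>b lattice_majorant_measurable[OF b \<psi>] by measurable
  have "(\<lambda>y. H (y + ivec k)) \<in> borel_measurable lebesgue" for k
    by (rule borel_measurable_translate[OF Hm])
  then have Hkm: "(\<lambda>y. indicator ucube y * H (y + ivec k)) \<in> borel_measurable lebesgue" for k
    by (intro borel_measurable_times_ennreal borel_measurable_indicator ucube_lebesgue)
  have "(\<integral>\<^sup>+y. H y \<partial>lebesgue) =
      (\<integral>\<^sup>+y. \<integral>\<^sup>+k. indicator ucube y * H (y + ivec k) \<partial>count_space UNIV \<partial>lebesgue)"
    unfolding nn_integral_tiling[OF Hm]
    by (rule nn_integral_count_space_swap[OF sigma_finite_lebesgue Hkm, symmetric])
  also have "\<dots> = (\<integral>\<^sup>+y. indicator ucube y * ennreal (?W y powr p) \<partial>lebesgue)"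
  proof (rule nn_integral_cong_AE)
    show "AE y in lebesgue. (\<integral>\<^sup>+k. indicator ucube y * H (y + ivec k) \<partial>count_space UNIV) =
        indicator ucube y * ennreal (?W y powr p)"
      using summ
    proof eventually_elim
      case (elim y)
      have "(\<lambda>k. norm (\<psi> (b *v (y + ivec k)))) summable_on UNIV"
        using lattice_reflect_summable[of "\<lambda>z. norm (\<psi> (b *v z))" y] elim by blast
      then have "(\<integral>\<^sup>+k. ennreal (norm (\<psi> (b *v (y + ivec k)))) \<partial>count_space UNIV) = ennreal (?W y)"
        using lattice_reflect_infsum[of "\<lambda>z. norm (\<psi> (b *v z))" y]
        by (subst nn_integral_count_space_infsum) (auto simp: lattice_majorant_def)
      moreover have "?W y * ?W y powr (p - 1) = ?W y powr p"
        using p lattice_majorant_nonneg[of b \<psi> y] by (cases "?W y = 0") (auto simp: powr_diff)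
      moreover have "(\<integral>\<^sup>+k. H (y + ivec k) \<partial>count_space UNIV) =
          (\<integral>\<^sup>+k. ennreal (norm (\<psi> (b *v (y + ivec k)))) \<partial>count_space UNIV) * ennreal (?W y powr (p - 1))"
        unfolding H_def lattice_majorant_periodic by (simp add: ennreal_mult nn_integral_multc)
      ultimately have "(\<integral>\<^sup>+k. H (y + ivec k) \<partial>count_space UNIV) = ennreal (?W y powr p)"
        using lattice_majorant_nonneg[of b \<psi> y] by (simp flip: ennreal_mult)
      then show ?case by (simp add: nn_integral_cmult)
    qed
  qed
  also have "\<dots> < \<infinity>"
  proof -
    have "(\<integral>\<^sup>+y. indicator ucube y * ennreal ((\<bar>det b\<bar> * ?W y) powr p) \<partial>lebesgue) =
        (\<integral>\<^sup>+y. ennreal (\<bar>det b\<bar> powr p) * (indicator ucube y * ennreal (?W y powr p)) \<partial>lebesgue)"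
      using lattice_majorant_nonneg[of b \<psi>] by (simp add: powr_mult ennreal_mult ac_simps)
    also have "\<dots> = ennreal (\<bar>det b\<bar> powr p) * (\<integral>\<^sup>+y. indicator ucube y * ennreal (?W y powr p) \<partial>lebesgue)"
    proof (rule nn_integral_cmult)
      have "(\<lambda>y. ennreal (?W y powr p)) \<in> borel_measurable lebesgue"
        using lattice_majorant_measurable[OF b \<psi>] by measurable
      then show "(\<lambda>y. indicator ucube y * ennreal (?W y powr p)) \<in> borel_measurable lebesgue"
        by (intro borel_measurable_times_ennreal borel_measurable_indicator ucube_lebesgue)
    qed
    finally show ?thesis using cube_fin det by (auto simp: ennreal_mult_less_top)
  qed
  finally show "(\<integral>\<^sup>+y. norm (\<psi> (b *v y)) * ?W y powr (p - 1) \<partial>lebesgue) < \<infinity>"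
    by (simp add: H_def)
qed

text \<open>A function dominated by \<open>\<psi>\<close> keeps the majorant of
  \<open>\<psi>\<close>, so only the constant has to be found. For \<open>\<psi> - \<eta>\<close>
  the moment is then taken against a fixed weight, and dominated convergence can make it
  small.\<close>

lemma has_periodic_majorant_lattice_majorant:
  fixes b :: "real^'n^'n"
  assumes p: "1 \<le> p" and b: "invertible b" and \<psi>: "\<psi> \<in> borel_measurable lebesgue"
    and per: "periodization_in_Lp_loc p b (\<lambda>x. norm (\<psi> x))"
    and \<eta>: "\<eta> \<in> borel_measurable lebesgue" "\<And>x. norm (\<eta> x) \<le> norm (\<psi> x)"
    and D: "0 \<le> D" "(\<integral>\<^sup>+y. norm (\<eta> (b *v y)) * lattice_majorant b \<psi> y powr (p - 1) \<partial>lebesgue)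
      \<le> ennreal (D powr p / \<bar>det b\<bar>)"
  shows "has_periodic_majorant p b (lattice_majorant b \<psi>) \<eta> D"
proof -
  have "AE y in lebesgue. (\<lambda>k. norm (\<eta> (b *v (y - ivec k)))) summable_on UNIV \<and>
      (\<Sum>\<^sub>\<infinity>k. norm (\<eta> (b *v (y - ivec k)))) \<le> lattice_majorant b \<psi> y"
    using periodization_summable[OF p b \<psi> per]
  proof eventually_elim
    case (elim y)
    have "(\<lambda>k. norm (\<eta> (b *v (y - ivec k)))) summable_on UNIV"
      by (rule summable_on_comparison_test[OF elim]) (auto simp: \<eta>)
    then show ?case unfolding lattice_majorant_def using elim by (auto intro!: infsum_mono simp: \<eta>)
  qed
  then show ?thesis
    using \<eta>(1) D lattice_majorant_measurable[OF b \<psi>]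
    by (simp add: has_periodic_majorant_def lattice_majorant_periodic)
qed

text \<open>Cutting where \<open>W\<close> exceeds \<open>n\<close>, rather than where
  \<open>\<psi>\<close> is large, bounds all lattice sums by \<open>n\<close> at once, because that
  condition is periodic; cutting at norm \<open>n\<close> adds bounded support. Both the moment of
  the removed part and the change of the integral tend to 0 by dominated convergence, and a single
  \<open>n\<close> serves for both.\<close>

lemma truncation:
  fixes b :: "real^'n^'n"
  assumes p: "1 \<le> p" and b: "invertible b" and \<psi>: "\<psi> \<in> borel_measurable lebesgue"
    and per: "periodization_in_Lp_loc p b (\<lambda>x. norm (\<psi> x))" and int: "integrable lebesgue \<psi>"
    and d: "0 < d"
  obtains \<eta> M where "\<eta> \<in> borel_measurable lebesgue" "integrable lebesgue \<eta>"
    "\<And>y. (\<lambda>k. norm (\<eta> (b *v (y - ivec k)))) summable_on UNIV"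
    "\<And>y. (\<Sum>\<^sub>\<infinity>k. norm (\<eta> (b *v (y - ivec k)))) \<le> M"
    "\<And>y. M < norm y \<Longrightarrow> \<eta> (b *v y) = 0"
    "has_periodic_majorant p b (lattice_majorant b \<psi>) (\<lambda>x. \<psi> x - \<eta> x) d"
    "norm ((\<integral>x. \<psi> x \<partial>lebesgue) - (\<integral>x. \<eta> x \<partial>lebesgue)) \<le> d"
proof -
  let ?W = "lattice_majorant b \<psi>"
  have det: "det b \<noteq> 0" using b by (simp add: invertible_det_nz)
  define S where "S = {y. (\<lambda>k. norm (\<psi> (b *v (y - ivec k)))) summable_on UNIV}"
  \<comment> \<open>Membership in \<open>S\<close> must be demanded explicitly: where the lattice
    sum diverges, \<open>?W\<close> has the default value 0 and would pass the test. Excluding these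
    points makes the bounds for \<open>\<eta>\<close> hold at every \<open>y\<close>, not just
    almost everywhere.\<close>
  define E where "E n = {y \<in> S. norm y \<le> real n \<and> ?W y \<le> real n}" for n
  define \<eta> where "\<eta> n x = (if matrix_inv b *v x \<in> E n then \<psi> x else 0)" for n x
  have Sp: "y - ivec k \<in> S \<longleftrightarrow> y \<in> S" for y k
    using lattice_shift_summable[of "\<lambda>z. norm (\<psi> (b *v z))" y "- k"] by (simp add: S_def ivec_uminus)
  have Wp: "?W (y - ivec k) = ?W y" for y k
    using lattice_majorant_periodic[of b \<psi> y "- k"] by (simp add: ivec_uminus)
  have \<eta>b: "\<eta> n (b *v y) = (if y \<in> E n then \<psi> (b *v y) else 0)" for n y
    by (simp add: \<eta>_def matrix_inv_mult_vec[OF b])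
  have Wm: "?W \<in> borel_measurable lebesgue" by (rule lattice_majorant_measurable[OF b \<psi>])
  have "(\<lambda>y. \<integral>\<^sup>+k. ennreal (norm (\<psi> (b *v (y - ivec k)))) \<partial>count_space UNIV) \<in> borel_measurable lebesgue"
    using lattice_term_measurable[OF b \<psi>]
    by (intro sigma_finite_measure.borel_measurable_nn_integral
        sigma_finite_measure_count_space_countable measurable_count_space_pair) auto
  moreover have S_eq: "S = (\<lambda>y. \<integral>\<^sup>+k. ennreal (norm (\<psi> (b *v (y - ivec k)))) \<partial>count_space UNIV) -` {..<\<infinity>} \<inter> space lebesgue"
    by (auto simp: S_def summable_on_iff_nn_integral)
  ultimately have Sm: "S \<in> sets lebesgue"
    by (metis (no_types, lifting) measurable_sets borel_open open_lessThan)
  have Em: "E n \<in> sets lebesgue" for n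
  proof -
    have "?W -` {..real n} \<inter> space lebesgue \<in> sets lebesgue"
      by (rule measurable_sets[OF Wm]) simp
    moreover have "cball 0 (real n) \<in> sets lebesgue" by simp
    moreover have "E n = S \<inter> cball 0 (real n) \<inter> (?W -` {..real n} \<inter> space lebesgue)"
      by (auto simp: E_def)
    ultimately show ?thesis using Sm by (metis sets.Int)
  qed
  have Ebm: "{x. matrix_inv b *v x \<in> E n} \<in> sets lebesgue" for n
    using measurable_sets[OF measurable_affine[OF invertible_matrix_inv[OF b], of 0] Em[of n]]
    by (simp add: vimage_def)
  have \<eta>m: "\<eta> n \<in> borel_measurable lebesgue" for n
    unfolding \<eta>_def[abs_def] using Ebm[of n] \<psi> by (intro measurable_If) auto
  have \<eta>_le: "norm (\<eta> n x) \<le> norm (\<psi> x)" "norm (\<psi> x - \<eta> n x) \<le> norm (\<psi> x)" for n x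
    by (auto simp: \<eta>_def)
  have \<eta>_int: "integrable lebesgue (\<eta> n)" for n
    by (rule Bochner_Integration.integrable_bound[OF int \<eta>m]) (auto simp: \<eta>_le)
  have term_le: "norm (\<eta> n (b *v (y - ivec k))) \<le> (if y \<in> S \<and> ?W y \<le> real n then norm (\<psi> (b *v (y - ivec k))) else 0)"
    for n y k by (auto simp: \<eta>b E_def Sp Wp)
  have sum_\<eta>: "(\<lambda>k. norm (\<eta> n (b *v (y - ivec k)))) summable_on UNIV \<and>
      (\<Sum>\<^sub>\<infinity>k. norm (\<eta> n (b *v (y - ivec k)))) \<le> real n" for n y
  proof (cases "y \<in> S \<and> ?W y \<le> real n")
    case True
    then have s: "(\<lambda>k. norm (\<psi> (b *v (y - ivec k)))) summable_on UNIV" by (simp add: S_def)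
    have le: "norm (\<eta> n (b *v (y - ivec k))) \<le> norm (\<psi> (b *v (y - ivec k)))" for k
      using term_le[of n y k] True by simp
    have s': "(\<lambda>k. norm (\<eta> n (b *v (y - ivec k)))) summable_on UNIV"
      by (rule summable_on_comparison_test[OF s]) (auto simp: le)
    have "(\<Sum>\<^sub>\<infinity>k. norm (\<eta> n (b *v (y - ivec k)))) \<le> ?W y"
      unfolding lattice_majorant_def by (intro infsum_mono s s' le)
    then show ?thesis using s' True by simp
  next
    case False
    then have "\<eta> n (b *v (y - ivec k)) = 0" for k using term_le[of n y k] by auto
    then show ?thesis by simp
  qed
  have summ: "AE y in lebesgue. y \<in> S"
    using periodization_summable[OF p b \<psi> per] by (simp add: S_def)
  have ev_eq: "eventually (\<lambda>n. \<eta> n (b *v y) = \<psi> (b *v y)) sequentially" if "y \<in> S" for y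
  proof -
    obtain N :: nat where N: "max (norm y) (?W y) \<le> real N" using real_arch_simple by blast
    have "\<eta> n (b *v y) = \<psi> (b *v y)" if "N \<le> n" for n
      using N of_nat_mono[OF that, where 'a=real] \<open>y \<in> S\<close> by (simp add: \<eta>b E_def)
    then show ?thesis by (auto simp: eventually_sequentially)
  qed
  have \<psi>b: "(\<lambda>y. \<psi> (b *v y)) \<in> borel_measurable lebesgue"
    using borel_measurable_affine[OF b \<psi>, of 0] by simp
  have \<eta>bm: "(\<lambda>y. \<eta> n (b *v y)) \<in> borel_measurable lebesgue" for n
    using borel_measurable_affine[OF b \<eta>m[of n], of 0] by simp
  define u where "u n y = ennreal (norm (\<psi> (b *v y) - \<eta> n (b *v y)) * ?W y powr (p - 1))" for n y
  have um: "u n \<in> borel_measurable lebesgue" for n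
    unfolding u_def[abs_def] using \<psi>b \<eta>bm Wm by measurable
  define w where "w y = ennreal (norm (\<psi> (b *v y)) * ?W y powr (p - 1))" for y
  have wm: "w \<in> borel_measurable lebesgue"
    unfolding w_def[abs_def] using \<psi>b Wm by measurable
  have "(\<lambda>n. \<integral>\<^sup>+y. u n y \<partial>lebesgue) \<longlonglongrightarrow> (\<integral>\<^sup>+y. 0 \<partial>(lebesgue :: (real^'n) measure))"
  proof (rule nn_integral_dominated_convergence[where w=w])
    show "AE y in lebesgue. u n y \<le> w y" for n
      by (intro AE_I2) (auto simp: u_def w_def intro!: ennreal_leI mult_right_mono \<eta>_le)
    show "(\<integral>\<^sup>+y. w y \<partial>lebesgue) < \<infinity>"
      unfolding w_def by (rule periodization_moment[OF p b \<psi> per])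
    show "AE y in lebesgue. (\<lambda>n. u n y) \<longlonglongrightarrow> 0"
      using summ
    proof eventually_elim
      case (elim y)
      show ?case
        by (rule tendsto_eventually, rule eventually_mono[OF ev_eq[OF elim]]) (simp add: u_def)
    qed
  qed (use um wm in auto)
  then have lim1: "(\<lambda>n. \<integral>\<^sup>+y. u n y \<partial>lebesgue) \<longlonglongrightarrow> 0" by simp
  have "0 < ennreal (d powr p / \<bar>det b\<bar>)" using d det by simp
  then have ev1: "eventually (\<lambda>n. (\<integral>\<^sup>+y. u n y \<partial>lebesgue) < ennreal (d powr p / \<bar>det b\<bar>)) sequentially"
    by (rule order_tendstoD(2)[OF lim1])
  have "AE x in lebesgue. matrix_inv b *v x \<in> S"
    using AE_affine[OF invertible_matrix_inv[OF b] summ, of 0] by simp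
  then have lim_\<eta>: "AE x in lebesgue. (\<lambda>n. \<eta> n x) \<longlonglongrightarrow> \<psi> x"
  proof eventually_elim
    case (elim x)
    show ?case
      by (rule tendsto_eventually) (use ev_eq[OF elim] in \<open>simp add: matrix_inv_mult_vec[OF b]\<close>)
  qed
  have "(\<lambda>n. \<integral>x. \<eta> n x \<partial>lebesgue) \<longlonglongrightarrow> (\<integral>x. \<psi> x \<partial>lebesgue)"
    by (rule integral_dominated_convergence[where w="\<lambda>x. norm (\<psi> x)"])
      (use int \<eta>m \<psi> lim_\<eta> \<eta>_le in \<open>auto intro!: integrable_norm\<close>)
  then have ev2: "eventually (\<lambda>n. dist (\<integral>x. \<eta> n x \<partial>lebesgue) (\<integral>x. \<psi> x \<partial>lebesgue) < d) sequentially"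
    by (rule tendstoD[OF _ d])
  obtain n where n: "(\<integral>\<^sup>+y. u n y \<partial>lebesgue) < ennreal (d powr p / \<bar>det b\<bar>)"
    "dist (\<integral>x. \<eta> n x \<partial>lebesgue) (\<integral>x. \<psi> x \<partial>lebesgue) < d"
    using eventually_happens[OF eventually_conj[OF ev1 ev2]] by auto
  show thesis
  proof (rule that[of "\<eta> n" "real n", OF \<eta>m \<eta>_int])
    show "has_periodic_majorant p b ?W (\<lambda>x. \<psi> x - \<eta> n x) d"
    proof (rule has_periodic_majorant_lattice_majorant[OF p b \<psi> per])
      show "(\<lambda>x. \<psi> x - \<eta> n x) \<in> borel_measurable lebesgue" using \<psi> \<eta>m by measurable
      show "(\<integral>\<^sup>+y. norm (\<psi> (b *v y) - \<eta> n (b *v y)) * ?W y powr (p - 1) \<partial>lebesgue) \<le> ennreal (d powr p / \<bar>det b\<bar>)"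
        using n(1) by (simp add: u_def)
    qed (use d \<eta>_le in auto)
    show "norm ((\<integral>x. \<psi> x \<partial>lebesgue) - (\<integral>x. \<eta> n x \<partial>lebesgue)) \<le> d"
      using n(2) by (simp add: dist_norm norm_minus_commute)
    show "\<eta> n (b *v y) = 0" if "real n < norm y" for y
      using that by (simp add: \<eta>b E_def)
  qed (use sum_\<eta> in auto)
qed

section \<open>The approximation step\<close>

lemma Lp_norm_triangle_diff:
  assumes "1 \<le> p" "f \<in> Lp_fun M p" "g \<in> Lp_fun M p"
  shows "Lp_norm M p (\<lambda>x. f x - g x) \<le> Lp_norm M p f + Lp_norm M p g"
  using Lp_norm_triangle[OF assms(1,2) Lp_fun_uminus[OF assms(3)]] by (simp add: Lp_norm_def)

lemma Lp_average:
  assumes p: "1 \<le> p" and J: "finite J" "J \<noteq> {}"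
    and F: "\<And>j. j \<in> J \<Longrightarrow> F j \<in> Lp_fun M p" "\<And>j. j \<in> J \<Longrightarrow> Lp_norm M p (F j) \<le> t"
  shows "(\<lambda>x. of_real (1 / real (card J)) * (\<Sum>j\<in>J. F j x)) \<in> Lp_fun M p"
    and "Lp_norm M p (\<lambda>x. of_real (1 / real (card J)) * (\<Sum>j\<in>J. F j x)) \<le> t"
proof -
  show "(\<lambda>x. of_real (1 / real (card J)) * (\<Sum>j\<in>J. F j x)) \<in> Lp_fun M p"
    by (intro Lp_fun_cmult Lp_fun_sum[OF p J(1) F(1)])
  have c: "0 < card J" using J by (simp add: card_gt_0_iff)
  have "Lp_norm M p (\<lambda>x. \<Sum>j\<in>J. F j x) \<le> (\<Sum>j\<in>J. Lp_norm M p (F j))"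
    by (rule Lp_norm_sum_le[OF p J(1) F(1)])
  also have "\<dots> \<le> real (card J) * t" using F(2) by (intro sum_bounded_above) auto
  finally have "(1 / real (card J)) * Lp_norm M p (\<lambda>x. \<Sum>j\<in>J. F j x) \<le> (1 / real (card J)) * (real (card J) * t)"
    by (intro mult_left_mono) auto
  moreover have "Lp_norm M p (\<lambda>x. of_real (1 / real (card J)) * (\<Sum>j\<in>J. F j x)) =
      (1 / real (card J)) * Lp_norm M p (\<lambda>x. \<Sum>j\<in>J. F j x)"
    by (subst Lp_norm_cmult[OF p]) (simp add: norm_divide)
  moreover have "(1 / real (card J)) * (real (card J) * t) = t" using c by simp
  ultimately show "Lp_norm M p (\<lambda>x. of_real (1 / real (card J)) * (\<Sum>j\<in>J. F j x)) \<le> t"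
    by simp
qed

lemma synthesis_level_generator_diff:
  assumes "(\<lambda>k. norm (c j k * wavelet p a b \<psi> j k x)) summable_on UNIV"
    and "(\<lambda>k. norm (c j k * wavelet p a b (\<lambda>x. \<psi> x - \<eta> x) j k x)) summable_on UNIV"
  shows "synthesis_level p a b \<psi> c j x =
    synthesis_level p a b (\<lambda>x. \<psi> x - \<eta> x) c j x + synthesis_level p a b \<eta> c j x"
proof -
  have eq: "c j k * wavelet p a b \<eta> j k x = c j k * wavelet p a b \<psi> j k x +
      (-1) * (c j k * wavelet p a b (\<lambda>x. \<psi> x - \<eta> x) j k x)" for k
    by (simp add: wavelet_def algebra_simps)
  note s1 = abs_summable_summable[OF assms(1)] and s2 = abs_summable_summable[OF assms(2)]
  have "synthesis_level p a b \<eta> c j x =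
      synthesis_level p a b \<psi> c j x + (-1) * synthesis_level p a b (\<lambda>x. \<psi> x - \<eta> x) c j x"
    unfolding synthesis_level_def eq infsum_add[OF s1 summable_on_cmult_right[OF s2]]
      infsum_cmult_right[OF s2] ..
  then show ?thesis by simp
qed

text \<open>Tiling identifies the mean of the periodization with the integral of
  \<open>\<eta>\<close>. That integral is subtracted, not 1, because truncation may have changed it
  and weak convergence needs mean exactly 0.\<close>

lemma mean_zero_periodization:
  fixes b :: "real^'n^'n" and \<eta> :: "real^'n \<Rightarrow> complex"
  assumes b: "invertible b" and \<eta>: "\<eta> \<in> borel_measurable lebesgue" "integrable lebesgue \<eta>"
    and bound: "\<And>y. (\<lambda>k. norm (\<eta> (b *v (y - ivec k)))) summable_on UNIV"
      "\<And>y. (\<Sum>\<^sub>\<infinity>k. norm (\<eta> (b *v (y - ivec k)))) \<le> M"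
  defines "g \<equiv> \<lambda>y. of_real \<bar>det b\<bar> * (\<Sum>\<^sub>\<infinity>k. \<eta> (b *v (y - ivec k))) - (\<integral>x. \<eta> x \<partial>lebesgue)"
  shows "g \<in> borel_measurable lebesgue"
    and "norm (g y) \<le> \<bar>det b\<bar> * M + norm (\<integral>x. \<eta> x \<partial>lebesgue)"
    and "g (y + ivec l) = g y"
    and "(\<integral>x. indicator ucube x *\<^sub>R g x \<partial>lebesgue) = 0"
proof -
  define P where "P y = (\<Sum>\<^sub>\<infinity>k. \<eta> (b *v (y - ivec k)))" for y
  have g_eq: "g = (\<lambda>y. of_real \<bar>det b\<bar> * P y - (\<integral>x. \<eta> x \<partial>lebesgue))"
    by (simp add: g_def P_def)
  have det: "det b \<noteq> 0" using b by (simp add: invertible_det_nz)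
  have Pm: "P \<in> borel_measurable lebesgue"
    unfolding P_def[abs_def] by (intro borel_measurable_infsum lattice_term_measurable[OF b \<eta>(1)])
  then show "g \<in> borel_measurable lebesgue" unfolding g_eq by measurable
  have P_le: "norm (P y) \<le> M" for y
    unfolding P_def by (rule order_trans[OF norm_infsum_bound[OF bound(1)] bound(2)])
  have "norm (g y) \<le> norm (of_real \<bar>det b\<bar> * P y) + norm (\<integral>x. \<eta> x \<partial>lebesgue)"
    unfolding g_eq by (rule norm_triangle_ineq4)
  also have "norm (of_real \<bar>det b\<bar> * P y) \<le> \<bar>det b\<bar> * M"
    using P_le[of y] by (simp add: norm_mult mult_left_mono)
  finally show "norm (g y) \<le> \<bar>det b\<bar> * M + norm (\<integral>x. \<eta> x \<partial>lebesgue)" by simp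
  show "g (y + ivec l) = g y"
    using lattice_shift_infsum[of "\<lambda>z. \<eta> (b *v z)" y l] by (simp add: g_def)
  have \<eta>b: "integrable lebesgue (\<lambda>y. \<eta> (b *v y))"
    using integrable_affine[OF b \<eta>(2), of 0] by simp
  have "(\<integral>y. \<eta> (b *v y) \<partial>lebesgue) = (\<integral>y. indicator ucube y *\<^sub>R P y \<partial>lebesgue)"
    unfolding integral_tiling(2)[OF \<eta>b] P_def lattice_reflect_infsum[of "\<lambda>z. \<eta> (b *v z)"] ..
  then have mean: "(\<integral>y. indicator ucube y *\<^sub>R P y \<partial>lebesgue) = (1 / \<bar>det b\<bar>) *\<^sub>R (\<integral>x. \<eta> x \<partial>lebesgue)"
    using integral_affine[OF b \<eta>(1), of 0] by simp
  have intP: "integrable lebesgue (\<lambda>y. indicator ucube y *\<^sub>R P y)"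
  proof (rule Bochner_Integration.integrable_bound)
    show "integrable lebesgue (\<lambda>y::real^'n. indicator ucube y * M)"
      by (intro integrable_mult_left integrable_ucube)
    show "(\<lambda>y. indicator ucube y *\<^sub>R P y) \<in> borel_measurable lebesgue"
      by (intro borel_measurable_scaleR borel_measurable_indicator ucube_lebesgue Pm)
    show "AE y in lebesgue. norm (indicator ucube y *\<^sub>R P y) \<le> norm (indicator ucube y * M)"
      using P_le by (intro AE_I2) (auto simp: indicator_def intro: order_trans[OF _ abs_ge_self])
  qed
  have intc: "integrable lebesgue (\<lambda>y::real^'n. indicator ucube y *\<^sub>R z)" for z :: complex
    by (intro integrable_scaleR_left integrable_ucube)
  have "(\<integral>x. indicator ucube x *\<^sub>R g x \<partial>lebesgue) =
      (\<integral>x. of_real \<bar>det b\<bar> * (indicator ucube x *\<^sub>R P x) - indicator ucube x *\<^sub>R (\<integral>x. \<eta> x \<partial>lebesgue) \<partial>lebesgue)"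
    unfolding g_eq by (intro Bochner_Integration.integral_cong refl) (simp add: scaleR_diff_right)
  also have "\<dots> = of_real \<bar>det b\<bar> * (\<integral>x. indicator ucube x *\<^sub>R P x \<partial>lebesgue) -
      (\<integral>x. indicator ucube x *\<^sub>R (\<integral>x. \<eta> x \<partial>lebesgue) \<partial>(lebesgue :: (real^'n) measure))"
    by (subst Bochner_Integration.integral_diff[OF integrable_mult_right[OF intP] intc])
      (simp only: integral_mult_right_zero)
  also have "(\<integral>x. indicator ucube x *\<^sub>R (\<integral>x. \<eta> x \<partial>lebesgue) \<partial>(lebesgue :: (real^'n) measure)) = (\<integral>x. \<eta> x \<partial>lebesgue)"
    by (subst integral_scaleR_left) (simp_all add: integrable_ucube)
  finally show "(\<integral>x. indicator ucube x *\<^sub>R g x \<partial>lebesgue) = 0"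
    unfolding mean using det by (simp add: scaleR_conv_of_real)
qed

text \<open>An instance of the L2 criterion with \<open>K = 1\<close>: values bounded by
  \<open>e \<le> 1\<close> have squares bounded by \<open>e\<close>, so the squared integral is at
  most \<open>e * V\<close>.\<close>

lemma Lp_norm_cball_bound:
  assumes p: "1 \<le> p" and d: "0 < d"
  obtains e where "0 < e" "\<And>F :: 'a::euclidean_space \<Rightarrow> complex. F \<in> borel_measurable lebesgue \<Longrightarrow>
    (\<And>x. norm (F x) \<le> e * indicator (cball 0 R) x) \<Longrightarrow> F \<in> Lp_fun lebesgue p \<and> Lp_norm lebesgue p F \<le> d"
proof -
  obtain \<epsilon> where \<epsilon>: "0 < \<epsilon>"
    "\<And>z :: 'a \<Rightarrow> complex. z \<in> borel_measurable lebesgue \<Longrightarrow> (\<And>x. norm (z x) \<le> 1 * indicator (cball 0 R) x) \<Longrightarrow>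
      (\<integral>x. (norm (z x))^2 \<partial>lebesgue) \<le> \<epsilon> \<Longrightarrow> z \<in> Lp_fun lebesgue p \<and> Lp_norm lebesgue p z \<le> d"
    using Lp_norm_small_of_L2[OF p d] by metis
  define V where "V = measure lebesgue (cball (0::'a) R)"
  have V: "0 \<le> V" by (simp add: V_def)
  define e where "e = min 1 (\<epsilon> / (V + 1))"
  have e: "0 < e" "e \<le> 1" using \<epsilon> V by (auto simp: e_def)
  have "e * V \<le> e * (V + 1)" using e by simp
  also have "\<dots> \<le> (\<epsilon> / (V + 1)) * (V + 1)" using V by (intro mult_right_mono) (auto simp: e_def)
  also have "\<dots> = \<epsilon>" using V by simp
  finally have eV: "e * V \<le> \<epsilon>" .
  show thesis
  proof (rule that[OF e(1)])
    fix F :: "'a \<Rightarrow> complex"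
    assume Fm: "F \<in> borel_measurable lebesgue" and F_le: "\<And>x. norm (F x) \<le> e * indicator (cball 0 R) x"
    have sq: "(norm (F x))^2 \<le> e * indicator (cball 0 R) x" for x
    proof (cases "x \<in> cball 0 R")
      case True
      then have "norm (F x) * norm (F x) \<le> e * 1" using F_le[of x] e by (intro mult_mono) auto
      then show ?thesis using True by (simp add: power2_eq_square)
    next
      case False
      then show ?thesis using F_le[of x] by simp
    qed
    have int: "integrable lebesgue (\<lambda>x. (norm (F x))^2)"
      by (rule integrable_bounded_support[of _ e R]) (use Fm sq in auto)
    have "(\<integral>x. (norm (F x))^2 \<partial>lebesgue) \<le> (\<integral>x. e * indicator (cball (0::'a) R) x \<partial>lebesgue)"
      by (intro integral_mono int integrable_cball sq)
    also have "\<dots> \<le> \<epsilon>" using eV by (simp add: V_def)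
    finally show "F \<in> Lp_fun lebesgue p \<and> Lp_norm lebesgue p F \<le> d"
    proof (intro \<epsilon>(2) Fm)
      show "norm (F x) \<le> 1 * indicator (cball 0 R) x" for x
        by (rule order_trans[OF F_le mult_right_mono[OF e(2)]]) simp
    qed
  qed
qed

text \<open>Six errors add up: \<open>f1\<close> from replacing \<open>f\<close> by
  \<open>f0\<close>, its synthesis \<open>X1\<close>, the truncated part \<open>X2\<close> of the
  generator, the deviation \<open>X3\<close> from the product form, the oscillation
  \<open>X4\<close>, and \<open>X5\<close> because the mean of \<open>\<eta>\<close> is not exactly
  1. The order of choices matters: \<open>f0\<close> first; then \<open>\<eta>\<close>, with an
  accuracy depending on the norm of \<open>f0\<close>; then the threshold \<open>N1\<close>,
  depending on both; the levels \<open>J\<close> last. Only \<open>X4\<close> needs the average to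
  become small; the others are small on each level.\<close>

lemma approximation_step:
  fixes a :: "nat \<Rightarrow> real^'n^'n" and b :: "real^'n^'n"
  assumes p: "1 \<le> p" and a: "\<And>j. 0 < j \<Longrightarrow> invertible (a j)" and b: "invertible b"
    and lim: "(\<lambda>j. onorm (\<lambda>x. matrix_inv (matrix_inv b ** a j) *v x)) \<longlonglongrightarrow> 0"
    and \<psi>: "\<psi> \<in> borel_measurable lebesgue" "integrable lebesgue \<psi>" "(\<integral>x. \<psi> x \<partial>lebesgue) = 1"
    and per: "periodization_in_Lp_loc p b (\<lambda>x. norm (\<psi> x))"
    and maj: "has_periodic_majorant p b (lattice_majorant b \<psi>) \<psi> D"
    and f: "f \<in> Lp_fun lebesgue p" and d: "0 < d"
  obtains J where "finite J" "J \<noteq> {}" "J \<subseteq> {N<..}"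
    "Lp_norm lebesgue p (\<lambda>x. f x - of_real (1 / real (card J)) *
      (\<Sum>j\<in>J. synthesis_level p a b \<psi> (analysis p a b f) j x)) \<le> d"
proof -
  let ?L = "lebesgue :: (real^'n) measure"
  define A where "A j = matrix_inv b ** a j" for j
  have A: "invertible (A j)" if "0 < j" for j
    unfolding A_def by (rule invertible_matrix_inv_mult[OF b a[OF that]])
  define \<beta> where "\<beta> = \<bar>det b\<bar> powr (1 - 1 / p)"
  have \<beta>: "0 \<le> \<beta>" by (simp add: \<beta>_def)
  have D: "0 \<le> D" using maj by (simp add: has_periodic_majorant_def)
  have D\<beta>: "0 \<le> D * \<beta>" using D \<beta> by simp
  \<comment> \<open>The part \<open>f - f0\<close> enters both directly and after analysis and
    synthesis, with factor \<open>D * \<beta>\<close>; dividing by \<open>X\<close> bounds both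
    contributions.\<close>
  define X where "X = 1 + D * \<beta>"
  have X: "0 < X" using D\<beta> by (simp add: X_def)
  define d1 where "d1 = d / (5 * X)"
  have d1: "0 < d1" "d1 \<le> d / 5" "D * (\<beta> * d1) \<le> d / 5"
  proof -
    show "0 < d1" using d X by (simp add: d1_def)
    have eq: "d1 + D * \<beta> * d1 = d / 5"
    proof -
      have "d1 + D * \<beta> * d1 = X * d1" by (simp add: X_def algebra_simps)
      also have "\<dots> = d / 5" using X by (simp add: d1_def)
      finally show ?thesis .
    qed
    then show "d1 \<le> d / 5" "D * (\<beta> * d1) \<le> d / 5"
      using \<open>0 < d1\<close> D\<beta> mult_nonneg_nonneg[OF D\<beta>, of d1] by (simp_all add: mult.assoc)
  qed
  obtain f0 R where f0: "f0 \<in> Lp_fun lebesgue p" "Lp_norm lebesgue p (\<lambda>x. f x - f0 x) < d1"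
    "continuous_on UNIV f0" and f0_0: "\<And>x. R < norm x \<Longrightarrow> f0 x = 0"
    using Lp_dense_continuous[OF p f d1(1)] by blast
  define n0 where "n0 = Lp_norm lebesgue p f0"
  have n0: "0 \<le> n0" by (simp add: n0_def Lp_norm_nonneg)
  \<comment> \<open>\<open>Y\<close> dominates both \<open>\<beta> * n0\<close>, the factor of the
    truncation error, and \<open>n0\<close>, the factor of the error in the mean.\<close>
  define Y where "Y = (\<beta> + 1) * (n0 + 1)"
  have Y: "0 < Y" using \<beta> n0 by (simp add: Y_def)
  define e0 where "e0 = d / (5 * Y)"
  have e0: "0 < e0" "e0 * (\<beta> * n0) \<le> d / 5" "e0 * n0 \<le> d / 5"
  proof -
    show e0: "0 < e0" using d Y by (simp add: e0_def)
    have eq: "e0 * Y = d / 5"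
      using Y by (simp add: e0_def)
    have "\<beta> * n0 \<le> Y" "n0 \<le> Y"
      using \<beta> n0 mult_nonneg_nonneg[OF \<beta> n0] by (simp_all add: Y_def algebra_simps)
    then have "e0 * (\<beta> * n0) \<le> e0 * Y" "e0 * n0 \<le> e0 * Y"
      using e0 by (simp_all add: mult_left_mono)
    then show "e0 * (\<beta> * n0) \<le> d / 5" "e0 * n0 \<le> d / 5" unfolding eq .
  qed
  obtain \<eta> M where \<eta>: "\<eta> \<in> borel_measurable lebesgue" "integrable lebesgue \<eta>"
    "\<And>y. (\<lambda>k. norm (\<eta> (b *v (y - ivec k)))) summable_on UNIV"
    "\<And>y. (\<Sum>\<^sub>\<infinity>k. norm (\<eta> (b *v (y - ivec k)))) \<le> M"
    "\<And>y. M < norm y \<Longrightarrow> \<eta> (b *v y) = 0"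
    and maj_diff: "has_periodic_majorant p b (lattice_majorant b \<psi>) (\<lambda>x. \<psi> x - \<eta> x) e0"
    and mean_diff: "norm ((\<integral>x. \<psi> x \<partial>lebesgue) - (\<integral>x. \<eta> x \<partial>lebesgue)) \<le> e0"
    by (rule truncation[OF p b \<psi>(1) per \<psi>(2) e0(1)]) (rule that; assumption)
  define \<mu> where "\<mu> = (\<integral>x. \<eta> x \<partial>lebesgue)"
  define g where "g y = of_real \<bar>det b\<bar> * (\<Sum>\<^sub>\<infinity>k. \<eta> (b *v (y - ivec k))) - \<mu>" for y
  define M' where "M' = \<bar>det b\<bar> * M + norm \<mu>"
  have g: "g \<in> borel_measurable lebesgue" "\<And>x. norm (g x) \<le> M'" "\<And>x k. g (x + ivec k) = g x"
    "(\<integral>x. indicator ucube x *\<^sub>R g x \<partial>lebesgue) = 0"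
    unfolding g_def[abs_def] M'_def \<mu>_def by (rule mean_zero_periodization[OF b \<eta>(1,2,3,4)])+
  have d10: "0 < d / 10" using d by simp
  obtain e where e: "0 < e" "\<And>F :: real^'n \<Rightarrow> complex. F \<in> borel_measurable lebesgue \<Longrightarrow>
    (\<And>x. norm (F x) \<le> e * indicator (cball 0 (R + 1)) x) \<Longrightarrow> F \<in> Lp_fun lebesgue p \<and> Lp_norm lebesgue p F \<le> d / 10"
    using Lp_norm_cball_bound[where R="R + 1" and 'a="real^'n", OF p d10] by blast
  obtain N1 where N1: "\<And>j x. N1 \<le> j \<Longrightarrow> norm (synthesis_level p a b \<eta> (analysis p a b f0) j x -
      f0 x * (of_real \<bar>det b\<bar> * (\<Sum>\<^sub>\<infinity>k. \<eta> (b *v (A j *v x - ivec k)))))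
    \<le> e * indicator (cball 0 (R + 1)) x"
    using analysis_synthesis_uniform[OF p a b lim f0(1,3) f0_0 \<eta>(3,4,5) e(1)]
    unfolding eventually_sequentially A_def by blast
  obtain F where F: "\<And>x. norm (f0 x) \<le> F * indicator (cball 0 R) x"
  proof -
    have "bounded (f0 ` cball 0 R)"
      by (intro compact_imp_bounded compact_continuous_image continuous_on_subset[OF f0(3)]) auto
    then obtain F where "\<And>x. x \<in> cball 0 R \<Longrightarrow> norm (f0 x) \<le> F"
      unfolding bounded_iff by blast
    then show thesis using f0_0 by (intro that[of F]) (auto simp: indicator_def)
  qed
  have f0m: "f0 \<in> borel_measurable lebesgue" using f0(1) by (simp add: Lp_fun_def)
  \<comment> \<open>Levels beyond \<open>N1\<close> make \<open>X3\<close> uniformly small, and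
    levels beyond \<open>N\<close> leave room below for the levels of earlier steps.\<close>
  obtain J where J: "finite J" "J \<noteq> {}" "J \<subseteq> {max N N1<..}"
    and Y4L: "(\<lambda>x. of_real (1 / real (card J)) * (\<Sum>j\<in>J. f0 x * g (A j *v x))) \<in> Lp_fun lebesgue p"
    and Y4: "Lp_norm lebesgue p (\<lambda>x. of_real (1 / real (card J)) * (\<Sum>j\<in>J. f0 x * g (A j *v x))) \<le> d / 10"
    using oscillating_average_small[OF p d10 A lim[folded A_def] g f0m F, of "max N N1"] by blast
  have j0: "0 < j" if "j \<in> J" for j using J(3) that by auto
  have jN1: "N1 \<le> j" if "j \<in> J" for j using J(3) that by auto
  define av where "av X x = of_real (1 / real (card J)) * (\<Sum>j\<in>J. X j x)" for X :: "nat \<Rightarrow> real^'n \<Rightarrow> complex" and x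
  define f1 where "f1 x = f x - f0 x" for x
  have f1: "f1 \<in> Lp_fun lebesgue p" unfolding f1_def by (rule Lp_fun_diff[OF p f f0(1)])
  have f1n: "Lp_norm lebesgue p f1 \<le> d1" using f0(2) by (simp add: f1_def[abs_def])
  define X1 where "X1 = synthesis_level p a b \<psi> (analysis p a b f1)"
  define X2 where "X2 = synthesis_level p a b (\<lambda>x. \<psi> x - \<eta> x) (analysis p a b f0)"
  define X3 where "X3 j x = synthesis_level p a b \<eta> (analysis p a b f0) j x -
      f0 x * (of_real \<bar>det b\<bar> * (\<Sum>\<^sub>\<infinity>k. \<eta> (b *v (A j *v x - ivec k))))" for j x
  define X4 where "X4 j x = f0 x * g (A j *v x)" for j x
  have X1: "X1 j \<in> Lp_fun lebesgue p" "Lp_norm lebesgue p (X1 j) \<le> d / 5"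
    and X2: "X2 j \<in> Lp_fun lebesgue p" "Lp_norm lebesgue p (X2 j) \<le> d / 5" if j: "j \<in> J" for j
  proof -
    note aj = a[OF j0[OF j]]
    show "X1 j \<in> Lp_fun lebesgue p" "X2 j \<in> Lp_fun lebesgue p"
      unfolding X1_def X2_def
      by (rule synthesis_analysis_Lp[where a=a and j=j, OF p aj b maj f1]
          synthesis_analysis_Lp[where a=a and j=j, OF p aj b maj_diff f0(1)])+
    have "Lp_norm lebesgue p (X1 j) \<le> D * (\<beta> * Lp_norm lebesgue p f1)" unfolding X1_def \<beta>_def
      by (rule synthesis_analysis_norm_le[where a=a and j=j, OF p aj b maj f1])
    also have "\<dots> \<le> D * (\<beta> * d1)" by (intro mult_left_mono f1n D \<beta>)
    finally show "Lp_norm lebesgue p (X1 j) \<le> d / 5" using d1(3) by simp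
    have "Lp_norm lebesgue p (X2 j) \<le> e0 * (\<beta> * n0)" unfolding X2_def \<beta>_def n0_def
      by (rule synthesis_analysis_norm_le[where a=a and j=j, OF p aj b maj_diff f0(1)])
    then show "Lp_norm lebesgue p (X2 j) \<le> d / 5" using e0(2) by simp
  qed
  have X3: "X3 j \<in> Lp_fun lebesgue p" "Lp_norm lebesgue p (X3 j) \<le> d / 10" if j: "j \<in> J" for j
  proof -
    have "(\<lambda>y. of_real \<bar>det b\<bar> * (\<Sum>\<^sub>\<infinity>k. \<eta> (b *v (y - ivec k)))) \<in> borel_measurable lebesgue"
      by (intro borel_measurable_times borel_measurable_const borel_measurable_infsum
          lattice_term_measurable[OF b \<eta>(1)])
    from borel_measurable_affine[OF A[OF j0[OF j]] this, of 0]
    have m1: "(\<lambda>x. of_real \<bar>det b\<bar> * (\<Sum>\<^sub>\<infinity>k. \<eta> (b *v (A j *v x - ivec k)))) \<in> borel_measurable lebesgue"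
      by simp
    have "X3 j \<in> borel_measurable lebesgue"
      unfolding X3_def[abs_def]
      by (intro borel_measurable_diff borel_measurable_times[OF f0m m1]
          synthesis_level_measurable[where a=a and j=j, OF a[OF j0[OF j]] \<eta>(1)])
    then have "X3 j \<in> Lp_fun lebesgue p \<and> Lp_norm lebesgue p (X3 j) \<le> d / 10"
      by (rule e(2)) (use N1[OF jN1[OF j]] in \<open>simp add: X3_def\<close>)
    then show "X3 j \<in> Lp_fun lebesgue p" "Lp_norm lebesgue p (X3 j) \<le> d / 10" by auto
  qed
  have av1: "av X1 \<in> Lp_fun lebesgue p" "Lp_norm lebesgue p (av X1) \<le> d / 5"
    using Lp_average[where F=X1, OF p J(1,2) X1] by (simp_all add: av_def[abs_def])
  have av2: "av X2 \<in> Lp_fun lebesgue p" "Lp_norm lebesgue p (av X2) \<le> d / 5"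
    using Lp_average[where F=X2, OF p J(1,2) X2] by (simp_all add: av_def[abs_def])
  have av3: "av X3 \<in> Lp_fun lebesgue p" "Lp_norm lebesgue p (av X3) \<le> d / 10"
    using Lp_average[where F=X3, OF p J(1,2) X3] by (simp_all add: av_def[abs_def])
  have av4: "av X4 \<in> Lp_fun lebesgue p" "Lp_norm lebesgue p (av X4) \<le> d / 10"
    using Y4L Y4 by (simp_all add: av_def[abs_def] X4_def)
  define X5 where "X5 x = (\<mu> - 1) * f0 x" for x
  have X5: "X5 \<in> Lp_fun lebesgue p" "Lp_norm lebesgue p X5 \<le> d / 5"
  proof -
    show "X5 \<in> Lp_fun lebesgue p" unfolding X5_def by (rule Lp_fun_cmult[OF f0(1)])
    have "Lp_norm lebesgue p X5 = norm (\<mu> - 1) * n0"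
      unfolding X5_def n0_def by (rule Lp_norm_cmult[OF p])
    also have "\<dots> \<le> e0 * n0" using mean_diff \<psi>(3) n0
      by (intro mult_right_mono) (auto simp: \<mu>_def norm_minus_commute)
    finally show "Lp_norm lebesgue p X5 \<le> d / 5" using e0(3) by simp
  qed
  define T where "T = synthesis_level p a b \<psi> (analysis p a b f)"
  \<comment> \<open>Splitting \<open>f\<close> into \<open>f0 + f1\<close> and the generator into
    \<open>\<eta>\<close> plus the rest is valid where the three series involved converge
    absolutely, hence almost everywhere.\<close>
  have T_eq: "AE x in lebesgue. T j x = X1 j x + X2 j x + X3 j x + X4 j x + \<mu> * f0 x" if j: "j \<in> J" for j
    using synthesis_analysis_summable[where a=a and j=j, OF p a[OF j0[OF j]] b maj f0(1)]
      synthesis_analysis_summable[where a=a and j=j, OF p a[OF j0[OF j]] b maj f1]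
      synthesis_analysis_summable[where a=a and j=j, OF p a[OF j0[OF j]] b maj_diff f0(1)]
  proof eventually_elim
    case (elim x)
    have "f = (\<lambda>x. f0 x + 1 * f1 x)" by (simp add: f1_def)
    then have "analysis p a b f j k = analysis p a b f0 j k + 1 * analysis p a b f1 j k" for k
      using analysis_add[where a=a and j=j, OF p a[OF j0[OF j]] b f0(1) f1, of k] by simp
    then have "T j x = synthesis_level p a b \<psi> (\<lambda>j k. analysis p a b f0 j k + 1 * analysis p a b f1 j k) j x"
      by (simp add: T_def synthesis_level_def)
    also have "\<dots> = synthesis_level p a b \<psi> (analysis p a b f0) j x + 1 * X1 j x"
      unfolding X1_def by (rule synthesis_level_add_cmult[where j=j and c="analysis p a b f0" and e="analysis p a b f1", OF elim(1,2)])
    also have "synthesis_level p a b \<psi> (analysis p a b f0) j x =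
        X2 j x + synthesis_level p a b \<eta> (analysis p a b f0) j x"
      unfolding X2_def by (rule synthesis_level_generator_diff[where j=j and c="analysis p a b f0", OF elim(1,3)])
    also have "synthesis_level p a b \<eta> (analysis p a b f0) j x = X3 j x + X4 j x + \<mu> * f0 x"
      by (simp add: X3_def X4_def g_def algebra_simps)
    finally show ?case by simp
  qed
  have "AE x in lebesgue. \<forall>j\<in>J. T j x = X1 j x + X2 j x + X3 j x + X4 j x + \<mu> * f0 x"
    using T_eq J(1) by (intro AE_finite_allI) auto
  then have main_eq: "AE x in lebesgue. f x - av T x = f1 x - (av X1 x + (av X2 x + (av X3 x + (av X4 x + X5 x))))"
  proof eventually_elim
    case (elim x)
    have c: "of_nat (card J) \<noteq> (0::complex)" using J by simp
    have "(\<Sum>j\<in>J. T j x) = (\<Sum>j\<in>J. X1 j x) + (\<Sum>j\<in>J. X2 j x) + (\<Sum>j\<in>J. X3 j x) + (\<Sum>j\<in>J. X4 j x)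
        + of_nat (card J) * (\<mu> * f0 x)"
      using elim by (simp add: sum.distrib)
    then have "av T x = av X1 x + av X2 x + av X3 x + av X4 x + \<mu> * f0 x"
      using c by (simp add: av_def field_simps)
    then show ?case by (simp add: f1_def X5_def algebra_simps)
  qed
  have TL: "av T \<in> borel_measurable lebesgue"
    unfolding av_def[abs_def] T_def using a[OF j0] \<psi>(1)
    by (intro borel_measurable_times borel_measurable_const borel_measurable_sum
        synthesis_level_measurable) auto
  note Lsum = Lp_fun_add[OF p av1(1) Lp_fun_add[OF p av2(1) Lp_fun_add[OF p av3(1) Lp_fun_add[OF p av4(1) X5(1)]]]]
  have "Lp_norm lebesgue p (\<lambda>x. f x - av T x) =
      Lp_norm lebesgue p (\<lambda>x. f1 x - (av X1 x + (av X2 x + (av X3 x + (av X4 x + X5 x)))))"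
    using f TL Lp_fun_diff[OF p f1 Lsum] main_eq
    by (intro Lp_norm_cong_AE) (auto simp: Lp_fun_def)
  also have "\<dots> \<le> Lp_norm lebesgue p f1 + Lp_norm lebesgue p (\<lambda>x. av X1 x + (av X2 x + (av X3 x + (av X4 x + X5 x))))"
    by (rule Lp_norm_triangle_diff[OF p f1 Lsum])
  \<comment> \<open>The budget: \<open>f1\<close>, \<open>X1\<close>, \<open>X2\<close> and
    \<open>X5\<close> receive a fifth of \<open>d\<close> each, while \<open>X3\<close> and
    \<open>X4\<close> share the remaining fifth.\<close>
  also have "\<dots> \<le> d1 + (d / 5 + (d / 5 + (d / 10 + (d / 10 + d / 5))))"
    using Lp_norm_triangle[OF p av1(1) Lp_fun_add[OF p av2(1) Lp_fun_add[OF p av3(1) Lp_fun_add[OF p av4(1) X5(1)]]]]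
      Lp_norm_triangle[OF p av2(1) Lp_fun_add[OF p av3(1) Lp_fun_add[OF p av4(1) X5(1)]]]
      Lp_norm_triangle[OF p av3(1) Lp_fun_add[OF p av4(1) X5(1)]]
      Lp_norm_triangle[OF p av4(1) X5(1)] av1(2) av2(2) av3(2) av4(2) X5(2) f1n by linarith
  also have "\<dots> \<le> d" using d1(2) by simp
  finally have "Lp_norm lebesgue p (\<lambda>x. f x - av T x) \<le> d" .
  then show thesis
    using that[OF J(1,2)] J(3) by (force simp: av_def T_def)
qed

section \<open>Exact representation\<close>

lemma lp_norm_cmult:
  assumes "1 \<le> p"
  shows "lp_norm p (\<lambda>k. z * u k) = norm z * lp_norm p u"
proof -
  have "(\<Sum>\<^sub>\<infinity>k. norm (z * u k) powr p) = norm z powr p * (\<Sum>\<^sub>\<infinity>k. norm (u k) powr p)"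
    by (simp add: norm_mult powr_mult infsum_cmult_right')
  then show ?thesis
    using assms by (simp add: lp_norm_def powr_mult powr_powr infsum_nonneg)
qed

lemma lp_norm_zero [simp]: "lp_norm p (\<lambda>k. 0) = 0"
  by (simp add: lp_norm_def)

definition residual :: "real \<Rightarrow> (nat \<Rightarrow> real^'n^'n) \<Rightarrow> real^'n^'n \<Rightarrow> (real^'n \<Rightarrow> complex) \<Rightarrow>
    nat set \<Rightarrow> (real^'n \<Rightarrow> complex) \<Rightarrow> real^'n \<Rightarrow> complex" where
  "residual p a b \<psi> J r x = r x - of_real (1 / real (card J)) *
     (\<Sum>j\<in>J. synthesis_level p a b \<psi> (analysis p a b r) j x)"

text \<open>Dependent choice on pairs of a residual and the last level used so far; carrying the
  level along forces the sets \<open>J i\<close> into consecutive disjoint blocks.\<close>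

lemma residual_sequence:
  fixes a :: "nat \<Rightarrow> real^'n^'n" and b :: "real^'n^'n" and \<delta> :: "nat \<Rightarrow> real"
  assumes step: "\<And>r d N. r \<in> Lp_fun lebesgue p \<Longrightarrow> 0 < d \<Longrightarrow> \<exists>J. finite J \<and> J \<noteq> {} \<and> J \<subseteq> {N<..} \<and>
      residual p a b \<psi> J r \<in> Lp_fun lebesgue p \<and> Lp_norm lebesgue p (residual p a b \<psi> J r) \<le> d"
    and f: "f \<in> Lp_fun lebesgue p" and \<delta>: "\<And>i. 0 < \<delta> i"
  obtains r :: "nat \<Rightarrow> real^'n \<Rightarrow> complex" and N :: "nat \<Rightarrow> nat" and J :: "nat \<Rightarrow> nat set"
  where "r 0 = f" "N 0 = 0" "\<And>i. r i \<in> Lp_fun lebesgue p" "\<And>i. finite (J i)" "\<And>i. J i \<noteq> {}"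
    "\<And>i. J i \<subseteq> {N i<..N (Suc i)}" "\<And>i. r (Suc i) = residual p a b \<psi> (J i) (r i)"
    "\<And>i. Lp_norm lebesgue p (r (Suc i)) \<le> \<delta> i"
proof -
  define P where "P i x \<longleftrightarrow> fst x \<in> Lp_fun lebesgue p \<and> (i = 0 \<longrightarrow> x = (f, 0))"
    for i :: nat and x :: "(real^'n \<Rightarrow> complex) \<times> nat"
  define Q where "Q i x y \<longleftrightarrow> (\<exists>J. finite J \<and> J \<noteq> {} \<and> J \<subseteq> {snd x<..snd y} \<and>
      fst y = residual p a b \<psi> J (fst x) \<and> Lp_norm lebesgue p (fst y) \<le> \<delta> i)"
    for i :: nat and x y :: "(real^'n \<Rightarrow> complex) \<times> nat"
  have ex: "\<exists>s. \<forall>i. P i (s i) \<and> Q i (s i) (s (Suc i))"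
  proof (rule dependent_nat_choice)
    show "\<exists>x. P 0 x" using f by (auto simp: P_def)
    fix x i assume "P i x"
    then have "fst x \<in> Lp_fun lebesgue p" by (simp add: P_def)
    from step[OF this \<delta>[of i], of "snd x"] obtain J where J: "finite J" "J \<noteq> {}" "J \<subseteq> {snd x<..}"
      "residual p a b \<psi> J (fst x) \<in> Lp_fun lebesgue p"
      "Lp_norm lebesgue p (residual p a b \<psi> J (fst x)) \<le> \<delta> i" by blast
    \<comment> \<open>\<open>Max J\<close> becomes the threshold for the next step; as
      \<open>J\<close> is nonempty, it lies strictly above the old one.\<close>
    have "J \<subseteq> {snd x<..Max J}" using J by auto
    then have "P (Suc i) (residual p a b \<psi> J (fst x), Max J) \<and> Q i x (residual p a b \<psi> J (fst x), Max J)"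
      using J by (auto simp: P_def Q_def)
    then show "\<exists>y. P (Suc i) y \<and> Q i x y" by blast
  qed
  then obtain s where s: "\<And>i. P i (s i)" "\<And>i. Q i (s i) (s (Suc i))" by blast
  from s(2) have "\<exists>J. \<forall>i. finite (J i) \<and> J i \<noteq> {} \<and> J i \<subseteq> {snd (s i)<..snd (s (Suc i))} \<and>
      fst (s (Suc i)) = residual p a b \<psi> (J i) (fst (s i)) \<and> Lp_norm lebesgue p (fst (s (Suc i))) \<le> \<delta> i"
    unfolding Q_def by (intro choice) blast
  then obtain J where J: "\<And>i. finite (J i) \<and> J i \<noteq> {} \<and> J i \<subseteq> {snd (s i)<..snd (s (Suc i))} \<and>
      fst (s (Suc i)) = residual p a b \<psi> (J i) (fst (s i)) \<and> Lp_norm lebesgue p (fst (s (Suc i))) \<le> \<delta> i"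
    by blast
  show thesis
  proof (rule that[of "\<lambda>i. fst (s i)" "\<lambda>i. snd (s i)" J])
    show "fst (s 0) = f" "snd (s 0) = 0" using s(1)[of 0] by (auto simp: P_def)
    show "fst (s i) \<in> Lp_fun lebesgue p" for i using s(1)[of i] by (simp add: P_def)
    show "Lp_norm lebesgue p (fst (s (Suc i))) \<le> \<delta> i" for i using J by blast
  qed (use J in auto)
qed

text \<open>The residuals telescope, \<open>r m\<close> being \<open>f\<close> minus the partial sum
  up to level \<open>N m\<close>. The norm of \<open>c\<close> is at most \<beta> times the sum of
  the residual norms: the term \<open>r 0 = f\<close> gives the main part, and the later terms are
  bounded by the prescribed \<open>\<delta> i\<close>.\<close>

lemma synthesis_representation:
  fixes a :: "nat \<Rightarrow> real^'n^'n" and b :: "real^'n^'n"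
  assumes p: "1 \<le> p" and a: "\<And>j. 0 < j \<Longrightarrow> invertible (a j)" and b: "invertible b"
    and lim: "(\<lambda>j. onorm (\<lambda>x. matrix_inv (matrix_inv b ** a j) *v x)) \<longlonglongrightarrow> 0"
    and \<psi>: "\<psi> \<in> borel_measurable lebesgue" "integrable lebesgue \<psi>" "(\<integral>x. \<psi> x \<partial>lebesgue) = 1"
    and per: "periodization_in_Lp_loc p b (\<lambda>x. norm (\<psi> x))"
    and maj: "has_periodic_majorant p b (lattice_majorant b \<psi>) \<psi> D"
    and f: "f \<in> Lp_fun lebesgue p" and \<epsilon>: "0 < \<epsilon>"
  obtains c where "c \<in> l1lp p" "synthesis_sums p a b \<psi> c f"
    "l1lp_norm p c \<le> \<bar>det b\<bar> powr (1 - 1 / p) * Lp_norm lebesgue p f + \<epsilon>"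
proof -
  define \<beta> where "\<beta> = \<bar>det b\<bar> powr (1 - 1 / p)"
  have \<beta>: "0 \<le> \<beta>" by (simp add: \<beta>_def)
  \<comment> \<open>These bounds sum to at most \<open>\<epsilon> / (\<beta> + 1)\<close>, so after
    multiplication by \<beta> they cost no more than \<epsilon>, also if \<beta> is below 1.\<close>
  define \<delta> where "\<delta> i = \<epsilon> / (\<beta> + 1) * (1 / 2) ^ Suc i" for i :: nat
  have \<delta>: "0 < \<delta> i" for i using \<epsilon> \<beta> by (simp add: \<delta>_def)
  have step: "\<exists>J. finite J \<and> J \<noteq> {} \<and> J \<subseteq> {N<..} \<and>
      residual p a b \<psi> J r \<in> Lp_fun lebesgue p \<and> Lp_norm lebesgue p (residual p a b \<psi> J r) \<le> d"
    if r: "r \<in> Lp_fun lebesgue p" and d: "0 < d" for r d N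
  proof -
    obtain J where J: "finite J" "J \<noteq> {}" "J \<subseteq> {N<..}"
      "Lp_norm lebesgue p (\<lambda>x. r x - of_real (1 / real (card J)) *
        (\<Sum>j\<in>J. synthesis_level p a b \<psi> (analysis p a b r) j x)) \<le> d"
      using approximation_step[OF p a b lim \<psi> per maj r d, of N] by blast
    have "residual p a b \<psi> J r \<in> Lp_fun lebesgue p"
      unfolding residual_def[abs_def]
      by (intro Lp_fun_diff[OF p r] Lp_fun_cmult Lp_fun_sum[OF p J(1)]
          synthesis_analysis_Lp[where a=a, OF p a b maj r]) (use J(3) in auto)
    then show ?thesis using J unfolding residual_def[abs_def] by blast
  qed
  obtain r N J where r0: "r 0 = f" and N0: "N 0 = 0" and rL: "\<And>i. r i \<in> Lp_fun lebesgue p"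
    and J: "\<And>i. finite (J i)" "\<And>i. J i \<noteq> {}" "\<And>i. J i \<subseteq> {N i<..N (Suc i)}"
    and r_Suc: "\<And>i. r (Suc i) = residual p a b \<psi> (J i) (r i)"
    and r_le: "\<And>i. Lp_norm lebesgue p (r (Suc i)) \<le> \<delta> i"
    using residual_sequence[where \<delta>=\<delta>, OF step f \<delta>] by blast
  have N_Suc: "N i < N (Suc i)" for i using J(2,3)[of i] by fastforce
  then have N_mono: "strict_mono N" by (rule strict_monoI_Suc)
  have J_unique: "i = l" if "j \<in> J i" "j \<in> J l" for i l j
  proof -
    have "\<not> i < l" if "j \<in> J i" "j \<in> J l" for i l
    proof
      assume "i < l"
      then have "N (Suc i) \<le> N l" using strict_mono_mono[OF N_mono] by (simp add: monoD)
      then show False using that J(3)[of i] J(3)[of l] by fastforce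
    qed
    then show ?thesis using that by (meson linorder_neqE_nat)
  qed
  \<comment> \<open>Disjointness of the blocks makes the description by \<open>THE\<close> unique;
    levels outside every block, among them \<open>j = 0\<close>, get coefficient 0.\<close>
  define c where "c j k = (if \<exists>i. j \<in> J i then
      (let i = (THE i. j \<in> J i) in of_real (1 / real (card (J i))) * analysis p a b (r i) j k) else 0)"
    for j k
  have c_in: "c j = (\<lambda>k. of_real (1 / real (card (J i))) * analysis p a b (r i) j k)" if "j \<in> J i" for i j
  proof -
    have "(THE i. j \<in> J i) = i" using that J_unique by blast
    then show ?thesis using that by (auto simp: c_def fun_eq_iff)
  qed
  have c_out: "c j = (\<lambda>k. 0)" if "\<And>i. j \<notin> J i" for j using that by (simp add: c_def fun_eq_iff)
  have J_pos: "0 < j" if "j \<in> J i" for i j using J(3)[of i] that by auto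
  have c_block: "j \<in> {N i<..N (Suc i)} \<Longrightarrow> j \<notin> J i \<Longrightarrow> c j = (\<lambda>k. 0)" for i j
  proof (rule c_out)
    fix l assume j: "j \<in> {N i<..N (Suc i)}" "j \<notin> J i"
    show "j \<notin> J l"
    proof
      assume jl: "j \<in> J l"
      then have "i \<noteq> l" using j by auto
      then consider "Suc i \<le> l" | "Suc l \<le> i" by linarith
      then show False
      proof cases
        case 1
        then have "N (Suc i) \<le> N l" using strict_mono_mono[OF N_mono] by (simp add: monoD)
        then show False using jl j J(3)[of l] by fastforce
      next
        case 2
        then have "N (Suc l) \<le> N i" using strict_mono_mono[OF N_mono] by (simp add: monoD)
        then show False using jl j J(3)[of l] by fastforce
      qed
    qed
  qed
  have cL: "(\<lambda>k. norm (c j k) powr p) summable_on UNIV" for j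
  proof (cases "\<exists>i. j \<in> J i")
    case True
    then obtain i where i: "j \<in> J i" by blast
    show ?thesis
      unfolding lp_summable_iff c_in[OF i]
      by (intro Lp_fun_cmult analysis_Lp[where a=a and j=j, OF p a[OF J_pos[OF i]] b rL])
  next
    case False
    then show ?thesis using c_out[of j] by simp
  qed
  \<comment> \<open>The weights \<open>1 / card (J i)\<close> add up to 1 over the block, so
    averaging over many levels costs no more than using a single one.\<close>
  have block_sum: "(\<Sum>j\<in>{N i<..N (Suc i)}. lp_norm p (c j)) \<le> \<beta> * Lp_norm lebesgue p (r i)" for i
  proof -
    have "(\<Sum>j\<in>{N i<..N (Suc i)}. lp_norm p (c j)) = (\<Sum>j\<in>J i. lp_norm p (c j))"
      using J(3)[of i] c_block[of _ i] by (intro sum.mono_neutral_right) auto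
    also have "\<dots> \<le> (\<Sum>j\<in>J i. (1 / real (card (J i))) * (\<beta> * Lp_norm lebesgue p (r i)))"
    proof (rule sum_mono)
      fix j assume j: "j \<in> J i"
      have "lp_norm p (c j) = (1 / real (card (J i))) * lp_norm p (analysis p a b (r i) j)"
        unfolding c_in[OF j] lp_norm_cmult[OF p] by (simp add: norm_divide)
      also have "\<dots> \<le> (1 / real (card (J i))) * (\<beta> * Lp_norm lebesgue p (r i))"
        unfolding \<beta>_def
        by (intro mult_left_mono analysis_norm_le[where a=a and j=j, OF p a[OF J_pos[OF j]] b rL]) simp
      finally show "lp_norm p (c j) \<le> (1 / real (card (J i))) * (\<beta> * Lp_norm lebesgue p (r i))" .
    qed
    also have "\<dots> = \<beta> * Lp_norm lebesgue p (r i)" using J(1,2)[of i] by simp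
    finally show ?thesis .
  qed
  have partial: "(\<Sum>j\<in>{0<..N m}. lp_norm p (c j)) \<le> \<beta> * (\<Sum>i<m. Lp_norm lebesgue p (r i))" for m
  proof (induction m)
    case (Suc m)
    have "{0<..N (Suc m)} = {0<..N m} \<union> {N m<..N (Suc m)}" using N_Suc[of m] by auto
    then have "(\<Sum>j\<in>{0<..N (Suc m)}. lp_norm p (c j)) =
        (\<Sum>j\<in>{0<..N m}. lp_norm p (c j)) + (\<Sum>j\<in>{N m<..N (Suc m)}. lp_norm p (c j))"
      by (simp add: sum.union_disjoint)
    then show ?case using Suc block_sum[of m] by (simp add: distrib_left)
  qed (simp add: N0)
  have geom: "(\<Sum>i<m. (1 / 2) ^ Suc i) \<le> (1 :: real)" for m
  proof -
    have "(\<Sum>i<m. (1 / 2) ^ Suc i) = 1 - (1 / 2 :: real) ^ m"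
      by (induction m) (simp_all add: field_simps)
    then show ?thesis by simp
  qed
  have res_sum: "(\<Sum>i<m. Lp_norm lebesgue p (r i)) \<le> Lp_norm lebesgue p f + \<epsilon> / (\<beta> + 1)" for m
  proof (cases m)
    case 0
    then show ?thesis using \<epsilon> \<beta> by (simp add: Lp_norm_nonneg)
  next
    case (Suc l)
    have "(\<Sum>i<m. Lp_norm lebesgue p (r i)) = Lp_norm lebesgue p f + (\<Sum>i<l. Lp_norm lebesgue p (r (Suc i)))"
      unfolding Suc sum.lessThan_Suc_shift by (simp add: r0)
    also have "(\<Sum>i<l. Lp_norm lebesgue p (r (Suc i))) \<le> (\<Sum>i<l. \<delta> i)"
      by (intro sum_mono r_le)
    also have "(\<Sum>i<l. \<delta> i) = \<epsilon> / (\<beta> + 1) * (\<Sum>i<l. (1 / 2) ^ Suc i)"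
      by (simp add: \<delta>_def sum_distrib_left)
    also have "\<dots> \<le> \<epsilon> / (\<beta> + 1) * 1"
      using \<epsilon> \<beta> by (intro mult_left_mono geom) auto
    finally show ?thesis by simp
  qed
  define T where "T = \<beta> * Lp_norm lebesgue p f + \<epsilon>"
  have bound: "(\<Sum>j\<in>X. lp_norm p (c j)) \<le> T" if X: "finite X" "X \<subseteq> {0<..}" for X
  proof -
    obtain m where m: "\<And>j. j \<in> X \<Longrightarrow> j \<le> m" using X(1) by (meson finite_nat_set_iff_bounded_le)
    have "m \<le> N m" by (rule strict_mono_imp_increasing[OF N_mono])
    then have sub: "X \<subseteq> {0<..N m}" using m X(2) by fastforce
    have "(\<Sum>j\<in>X. lp_norm p (c j)) \<le> (\<Sum>j\<in>{0<..N m}. lp_norm p (c j))"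
      using sub by (intro sum_mono2) (auto simp: lp_norm_nonneg)
    also have "\<dots> \<le> \<beta> * (\<Sum>i<m. Lp_norm lebesgue p (r i))" by (rule partial)
    also have "\<dots> \<le> \<beta> * (Lp_norm lebesgue p f + \<epsilon> / (\<beta> + 1))"
      by (rule mult_left_mono[OF res_sum \<beta>])
    also have "\<dots> \<le> T"
    proof -
      have "\<beta> / (\<beta> + 1) * \<epsilon> \<le> 1 * \<epsilon>" using \<beta> \<epsilon> by (intro mult_right_mono) auto
      then show ?thesis by (simp add: T_def distrib_left)
    qed
    finally show ?thesis .
  qed
  have sum_c: "(\<lambda>j. lp_norm p (c j)) summable_on {0<..}"
    by (rule nonneg_bounded_partial_sums_imp_summable_on[where C=T])
      (use bound in \<open>auto simp: lp_norm_nonneg eventually_finite_subsets_at_top\<close>)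
  have "0 \<notin> J i" for i using J_pos[of 0 i] by auto
  then have "c 0 = (\<lambda>k. 0)" by (rule c_out)
  then have c: "c \<in> l1lp p" using cL sum_c by (simp add: l1lp_def)
  have norm_c: "l1lp_norm p c \<le> T"
    unfolding l1lp_norm_def by (rule infsum_le_finite_sums[OF sum_c bound])
  \<comment> \<open>Telescoping gives convergence to \<open>f\<close> only along the block ends
    \<open>N m\<close>. Completeness supplies a limit \<open>h\<close> of the full sequence of
    partial sums, and the subsequence then identifies \<open>h\<close> with \<open>f\<close> almost
    everywhere.\<close>
  obtain h where h: "synthesis_sums p a b \<psi> c h"
    by (rule synthesis_exists[OF p a b maj c])
  then have hL: "h \<in> Lp_fun lebesgue p" by (simp add: synthesis_sums_def)
  define s where "s n x = (\<Sum>j=1..n. synthesis_level p a b \<psi> c j x)" for n x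
  have level_c: "synthesis_level p a b \<psi> c j x =
      of_real (1 / real (card (J i))) * synthesis_level p a b \<psi> (analysis p a b (r i)) j x"
    if "j \<in> J i" for i j x
    unfolding synthesis_level_def c_in[OF that] mult.assoc by (rule infsum_cmult_right')
  have level_0: "synthesis_level p a b \<psi> c j x = 0" if "c j = (\<lambda>k. 0)" for j x
    using that by (simp add: synthesis_level_def)
  have r_eq: "r m x = f x - s (N m) x" for m x
  proof (induction m)
    case 0
    then show ?case by (simp add: r0 N0 s_def)
  next
    case (Suc m)
    have split: "{1..N (Suc m)} = {1..N m} \<union> {N m<..N (Suc m)}" using N_Suc[of m] by auto
    have "s (N (Suc m)) x = s (N m) x + (\<Sum>j\<in>{N m<..N (Suc m)}. synthesis_level p a b \<psi> c j x)"
      unfolding s_def split by (rule sum.union_disjoint) auto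
    also have "(\<Sum>j\<in>{N m<..N (Suc m)}. synthesis_level p a b \<psi> c j x) =
        (\<Sum>j\<in>J m. synthesis_level p a b \<psi> c j x)"
      using J(3)[of m] c_block[of _ m] level_0 by (intro sum.mono_neutral_right) auto
    also have "\<dots> = of_real (1 / real (card (J m))) *
        (\<Sum>j\<in>J m. synthesis_level p a b \<psi> (analysis p a b (r m)) j x)"
      unfolding sum_distrib_left by (intro sum.cong refl level_c)
    finally show ?case using Suc by (simp add: r_Suc residual_def)
  qed
  have "\<delta> \<longlonglongrightarrow> \<epsilon> / (\<beta> + 1) * 0"
    unfolding \<delta>_def[abs_def] by (intro tendsto_mult tendsto_const LIMSEQ_Suc LIMSEQ_realpow_zero) auto
  then have "(\<lambda>m. Lp_norm lebesgue p (r (Suc m))) \<longlonglongrightarrow> 0"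
    by (intro Lim_null_comparison[of "\<lambda>m. Lp_norm lebesgue p (r (Suc m))" \<delta>])
      (use r_le in \<open>auto simp: Lp_norm_nonneg\<close>)
  then have r_lim: "(\<lambda>m. Lp_norm lebesgue p (r m)) \<longlonglongrightarrow> 0" by (rule LIMSEQ_imp_Suc)
  have "(\<lambda>n. Lp_norm lebesgue p (\<lambda>x. h x - s n x)) \<longlonglongrightarrow> 0"
    using h by (simp add: synthesis_sums_def s_def)
  then have h_lim: "(\<lambda>m. Lp_norm lebesgue p (\<lambda>x. h x - s (N m) x)) \<longlonglongrightarrow> 0"
    using LIMSEQ_subseq_LIMSEQ[OF _ N_mono] by (force simp: o_def)
  have "Lp_norm lebesgue p (\<lambda>x. h x - f x) \<le>
      Lp_norm lebesgue p (\<lambda>x. h x - s (N m) x) + Lp_norm lebesgue p (r m)" for m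
  proof -
    have "(\<lambda>x. h x - s (N m) x) \<in> Lp_fun lebesgue p"
    proof -
      have "s (N m) = (\<lambda>x. f x - r m x)" by (simp add: r_eq fun_eq_iff)
      then show ?thesis using Lp_fun_diff[OF p hL Lp_fun_diff[OF p f rL[of m]]] by simp
    qed
    from Lp_norm_triangle_diff[OF p this rL[of m]] show ?thesis by (simp add: r_eq)
  qed
  then have "Lp_norm lebesgue p (\<lambda>x. h x - f x) \<le> 0 + 0"
    by (intro LIMSEQ_le_const[OF tendsto_add[OF h_lim r_lim]]) auto
  then have "Lp_norm lebesgue p (\<lambda>x. h x - f x) = 0" by (simp add: Lp_norm_nonneg antisym)
  then have "(h, f) \<in> Lp_eq lebesgue p"
    using Lp_norm_eq_0_iff[OF Lp_fun_diff[OF p hL f]] hL f by (simp add: Lp_eq_def)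
  then have "f \<in> synthesis p a b \<psi> c" using synthesis_in_Lp_space(2)[OF p h] by simp
  then have "synthesis_sums p a b \<psi> c f" by (simp add: synthesis_def)
  then show thesis using that[OF c] norm_c by (simp add: T_def \<beta>_def)
qed

section \<open>Passage to the original dilations and exponents, and the theorem\<close>

lemma onorm_matrix_inv_mult_tendsto_0:
  fixes a :: "nat \<Rightarrow> real^'n^'n" and b :: "real^'n^'n"
  assumes a: "\<And>j. 0 < j \<Longrightarrow> invertible (a j)" and b: "invertible b"
    and lim: "(\<lambda>j. onorm (\<lambda>x. matrix_inv (a j) *v x)) \<longlonglongrightarrow> 0"
  shows "(\<lambda>j. onorm (\<lambda>x. matrix_inv (matrix_inv b ** a j) *v x)) \<longlonglongrightarrow> 0"
proof (rule Lim_null_comparison)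
  \<comment> \<open>The inverse of \<open>matrix_inv b ** a j\<close> is
    \<open>matrix_inv (a j) ** b\<close>, and the operator norm is submultiplicative. The bound is
    only eventual because \<open>a 0\<close> need not be invertible.\<close>
  show "eventually (\<lambda>j. norm (onorm (\<lambda>x. matrix_inv (matrix_inv b ** a j) *v x)) \<le>
      onorm (\<lambda>x. matrix_inv (a j) *v x) * onorm (\<lambda>x. b *v x)) sequentially"
    using eventually_gt_at_top[of 0]
  proof eventually_elim
    case (elim j)
    note aj = a[OF elim]
    have eq: "matrix_inv (matrix_inv b ** a j) *v x = matrix_inv (a j) *v (b *v x)" for x
    proof -
      have "(matrix_inv b ** a j) *v (matrix_inv (matrix_inv b ** a j) *v x) = x"
        by (rule matrix_inv_mult_vec(2)[OF invertible_matrix_inv_mult[OF b aj]])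
      then have "matrix_inv b *v (a j *v (matrix_inv (matrix_inv b ** a j) *v x)) = x"
        by (metis matrix_vector_mul_assoc)
      then have "a j *v (matrix_inv (matrix_inv b ** a j) *v x) = b *v x"
        by (metis matrix_inv_mult_vec(2)[OF b])
      then show ?thesis by (metis matrix_inv_mult_vec(1)[OF aj])
    qed
    have "onorm (\<lambda>x. matrix_inv (matrix_inv b ** a j) *v x) \<le>
        onorm (\<lambda>x. matrix_inv (a j) *v x) * onorm (\<lambda>x. b *v x)"
      unfolding eq
      using onorm_compose[OF matrix_vector_mul_bounded_linear matrix_vector_mul_bounded_linear,
          of "matrix_inv (a j)" b] by (simp add: o_def)
    then show ?case
      using onorm_pos_le[OF matrix_vector_mul_bounded_linear[of "matrix_inv (matrix_inv b ** a j)"]] by simp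
  qed
  show "(\<lambda>j. onorm (\<lambda>x. matrix_inv (a j) *v x) * onorm (\<lambda>x. b *v x)) \<longlonglongrightarrow> 0"
    using tendsto_mult_right[OF lim, of "onorm (\<lambda>x. b *v x)"] by (simp add: mult.commute)
qed

text \<open>Extended values of \<open>q\<close> include the case \<open>p = 1\<close>, where
  \<open>1 / q = 0\<close>. Finiteness of \<open>1 / q\<close> is established first, since
  \<open>enn2real\<close> is additive on finite values only.\<close>

lemma conjugate_exponent:
  fixes q :: ennreal
  assumes "1 \<le> p" "1 / ennreal p + 1 / q = 1"
  shows "enn2real (1 / q) = 1 - 1 / p"
proof -
  have p: "1 / ennreal p = ennreal (1 / p)"
    using assms(1) by (simp add: divide_ennreal flip: ennreal_1)
  have "1 / q \<le> 1 / ennreal p + 1 / q" by simp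
  then have "1 / q \<le> 1" using assms(2) by simp
  then have fin: "1 / q < top" using order.strict_trans1 ennreal_one_less_top by blast
  have "enn2real (1 / ennreal p + 1 / q) = enn2real (1 / ennreal p) + enn2real (1 / q)"
    by (rule enn2real_plus) (use fin p in auto)
  then show ?thesis using assms p by simp
qed

theorem theorem2:
  fixes a :: "nat \<Rightarrow> real^'n^'n" and b :: "real^'n^'n"
    and p :: real and q :: ennreal and \<psi> :: "real^'n \<Rightarrow> complex"
  assumes "\<And>j. j > 0 \<Longrightarrow> invertible (a j)"
    and "(\<lambda>j. onorm (\<lambda>x. matrix_inv (a j) *v x)) \<longlonglongrightarrow> 0"
    and "invertible b"
    and "1 \<le> p"
    and "1 / ennreal p + 1 / q = 1"
    and "\<psi> \<in> Lp_fun lebesgue p"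
    and "periodization_in_Lp_loc p b (\<lambda>x. norm (\<psi> x))"
    and "(\<integral>x. \<psi> x \<partial>lebesgue) = 1"
  shows "synthesis p a b \<psi> \<in> l1lp p \<rightarrow> Lp_space lebesgue p \<and>
    open_map (l1lp_topology p) (Lp_topology lebesgue p) (synthesis p a b \<psi>) \<and>
    synthesis p a b \<psi> ` l1lp p = Lp_space lebesgue p \<and>
    (\<forall>f \<in> Lp_fun lebesgue p. \<forall>\<epsilon>>0. \<exists>c \<in> l1lp p.
       synthesis_sums p a b \<psi> c f \<and>
       l1lp_norm p c \<le> \<bar>det b\<bar> powr enn2real (1 / q) * Lp_norm lebesgue p f + \<epsilon>)"
proof -
  note a = assms(1) and b = assms(3) and p = assms(4) and per = assms(7)
  note lim = onorm_matrix_inv_mult_tendsto_0[OF a b assms(2)]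
  let ?S = "synthesis p a b \<psi>"
  define \<beta> where "\<beta> = \<bar>det b\<bar> powr enn2real (1 / q)"
  have \<beta>_eq: "\<beta> = \<bar>det b\<bar> powr (1 - 1 / p)"
    unfolding \<beta>_def conjugate_exponent[OF p assms(5)] ..
  have \<beta>: "0 \<le> \<beta>" by (simp add: \<beta>_def)
  have \<psi>m: "\<psi> \<in> borel_measurable lebesgue" using assms(6) by (simp add: Lp_fun_def)
  \<comment> \<open>A function that is not integrable has integral 0 by convention, so the value 1
    already forces integrability.\<close>
  have \<psi>i: "integrable lebesgue \<psi>" using assms(8) not_integrable_integral_eq[of lebesgue \<psi>] by force
  obtain D where maj: "has_periodic_majorant p b (lattice_majorant b \<psi>) \<psi> D"
  proof -
    let ?I = "\<integral>\<^sup>+y. norm (\<psi> (b *v y)) * lattice_majorant b \<psi> y powr (p - 1) \<partial>lebesgue"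
    obtain R where R: "0 \<le> R" "?I = ennreal R"
      using periodization_moment[OF p b \<psi>m per] by (cases ?I) auto
    \<comment> \<open>Chosen so that \<open>D powr p / |det b|\<close> is exactly the moment
      \<open>R\<close> of \<open>\<psi>\<close>.\<close>
    define D where "D = (R * \<bar>det b\<bar>) powr (1 / p)"
    have "D powr p / \<bar>det b\<bar> = R" using R(1) p b by (simp add: D_def powr_powr invertible_det_nz)
    then show thesis
      using that[of D] has_periodic_majorant_lattice_majorant[OF p b \<psi>m per \<psi>m order_refl, of D] R
      by (simp add: D_def)
  qed
  have rep: "\<exists>c \<in> l1lp p. synthesis_sums p a b \<psi> c f \<and> l1lp_norm p c \<le> \<beta> * Lp_norm lebesgue p f + \<epsilon>"
    if "f \<in> Lp_fun lebesgue p" "0 < \<epsilon>" for f \<epsilon>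
    using synthesis_representation[OF p a b lim \<psi>m \<psi>i assms(8) per maj that] unfolding \<beta>_eq by blast
  have into: "?S c \<in> Lp_space lebesgue p" if c: "c \<in> l1lp p" for c
  proof -
    obtain f where "synthesis_sums p a b \<psi> c f" by (rule synthesis_exists[OF p a b maj c])
    then show ?thesis by (rule synthesis_in_Lp_space(1)[OF p])
  qed
  \<comment> \<open>The value of the operator is a whole class, so it suffices to reach one
    representative of \<open>F\<close>.\<close>
  have class_eq: "?S c = F" if "F \<in> Lp_space lebesgue p" "f \<in> F" "synthesis_sums p a b \<psi> c f" for F f c
    using synthesis_in_Lp_space(2)[OF p that(3)] Lp_space_some(3)[OF that(1,2)] by simp
  have surj: "?S ` l1lp p = Lp_space lebesgue p"
  proof
    show "Lp_space lebesgue p \<subseteq> ?S ` l1lp p"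
    proof
      fix F :: "(real^'n \<Rightarrow> complex) set" assume F: "F \<in> Lp_space lebesgue p"
      let ?f = "SOME f. f \<in> F"
      have f: "?f \<in> F" "?f \<in> Lp_fun lebesgue p" using Lp_space_some(1,2)[OF F] by auto
      obtain c where "c \<in> l1lp p" "synthesis_sums p a b \<psi> c ?f" using rep[OF f(2), of 1] by auto
      then show "F \<in> ?S ` l1lp p" using class_eq[OF F f(1)] by blast
    qed
  qed (use into in auto)
  interpret X: Metric_space "l1lp p :: (nat \<Rightarrow> int^'n \<Rightarrow> complex) set" "l1lp_dist p"
    by (rule Metric_space_l1lp[OF p])
  interpret Y: Metric_space "Lp_space (lebesgue :: (real^'n) measure) p" "Lp_dist lebesgue p"
    by (rule Metric_space_Lp[OF p])
  have open_S: "open_map (l1lp_topology p) (Lp_topology lebesgue p) ?S"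
    unfolding open_map_def
  proof (intro allI impI)
    fix U :: "(nat \<Rightarrow> int^'n \<Rightarrow> complex) set"
    assume "openin (l1lp_topology p) U"
    then have U: "U \<subseteq> l1lp p" "\<And>c. c \<in> U \<Longrightarrow> \<exists>r>0. X.mball c r \<subseteq> U"
      unfolding l1lp_topology_def X.openin_mtopology by auto
    have "\<exists>r>0. Y.mball F r \<subseteq> ?S ` U" if F: "F \<in> ?S ` U" for F
    proof -
      obtain c where c: "c \<in> U" "F = ?S c" using F by blast
      obtain r where r: "0 < r" "X.mball c r \<subseteq> U" using U(2)[OF c(1)] by blast
      have cL: "c \<in> l1lp p" using c(1) U(1) by blast
      \<comment> \<open>A perturbation of norm below \<open>s\<close> has a preimage of norm at most
        \<open>\<beta> * s < r / 2\<close> plus a slack of \<open>r / 2\<close>, hence within the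
        ball around \<open>c\<close>; the \<open>+ 1\<close> covers \<open>\<beta> = 0\<close> in
        the division and makes the inequality strict.\<close>
      define s where "s = r / (2 * (\<beta> + 1))"
      have s: "0 < s" using r(1) \<beta> by (simp add: s_def)
      have "(\<beta> + 1) * s = r / 2" using \<beta> by (simp add: s_def field_simps)
      then have \<beta>s: "\<beta> * s < r / 2" using s by (simp add: algebra_simps)
      have "Y.mball F s \<subseteq> ?S ` U"
      proof
        fix G assume "G \<in> Y.mball F s"
        then have G: "F \<in> Lp_space lebesgue p" "G \<in> Lp_space lebesgue p" "Lp_dist lebesgue p F G < s"
          by auto
        define h where "h = (SOME f. f \<in> F)"
        define g where "g = (SOME g. g \<in> G)"
        have hF: "h \<in> F" "h \<in> Lp_fun lebesgue p" using Lp_space_some(1,2)[OF G(1)] by (auto simp: h_def)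
        have gG: "g \<in> G" "g \<in> Lp_fun lebesgue p" using Lp_space_some(1,2)[OF G(2)] by (auto simp: g_def)
        have diff: "(\<lambda>x. g x - h x) \<in> Lp_fun lebesgue p" by (rule Lp_fun_diff[OF p gG(2) hF(2)])
        have small: "Lp_norm lebesgue p (\<lambda>x. g x - h x) < s"
          using G(3) Lp_norm_minus_commute[of lebesgue p g h] by (simp add: Lp_dist_def h_def g_def)
        \<comment> \<open>Only the difference of the representatives is represented anew; by
          linearity, adding its coefficients to \<open>c\<close> moves the image from
          \<open>F\<close> to \<open>G\<close>.\<close>
        obtain e where e: "e \<in> l1lp p" "synthesis_sums p a b \<psi> e (\<lambda>x. g x - h x)"
          "l1lp_norm p e \<le> \<beta> * Lp_norm lebesgue p (\<lambda>x. g x - h x) + r / 2"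
          using rep[OF diff, of "r / 2"] r(1) by auto
        have "l1lp_norm p e < r"
          using e(3) \<beta>s mult_left_mono[OF less_imp_le[OF small] \<beta>] by linarith
        moreover have ce: "(\<lambda>j k. c j k + e j k) \<in> l1lp p" by (rule l1lp_add(1)[OF p cL e(1)])
        moreover have "l1lp_dist p c (\<lambda>j k. c j k + e j k) = l1lp_norm p e"
          by (simp add: l1lp_dist_def l1lp_norm_def lp_norm_def)
        ultimately have "(\<lambda>j k. c j k + e j k) \<in> U" using r(2) cL by auto
        moreover have "?S (\<lambda>j k. c j k + e j k) = G"
        proof (rule class_eq[OF G(2) gG(1)])
          have "synthesis_sums p a b \<psi> c h" using hF(1) c(2) by (simp add: synthesis_def)
          from synthesis_sums_add[OF p this e(2)]
          show "synthesis_sums p a b \<psi> (\<lambda>j k. c j k + e j k) g"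
            using synthesis_level_measurable[where a=a, OF a \<psi>m] by simp
        qed
        ultimately show "G \<in> ?S ` U" by blast
      qed
      then show ?thesis using s by blast
    qed
    moreover have "?S ` U \<subseteq> Lp_space lebesgue p" using into U(1) by blast
    ultimately show "openin (Lp_topology lebesgue p) (?S ` U)"
      unfolding Lp_topology_def Y.openin_mtopology by blast
  qed
  show ?thesis using into surj open_S rep unfolding \<beta>_def by blast
qed

end
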